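(* Assume that the distribution of $\xi$ is spread-out, that $\mathbb{E}\xi^3<\infty$ and $\mathbb{E}\eta^2<\infty$. Put $m:=\mathbb{E}\xi$. Then, for any positive integer-valued function $j=j(t)$ satisfying $j(t)=o(t^{2/3})$ as $t\to\infty$, $$V_{j}(t)\sim\frac{t^{j}}{m^{j}\,j!}\exp\left(\frac{\gamma_0\, m\, j^2}{t}\right),\qquad t\to\infty,\quad j=j(t),$$ where $$\gamma_0:=\int_{[0,\infty)}d\big(V(y)-m^{-1}y\big)=\lim_{t\to\infty}\big(V(t)-m^{-1}t\big)=\frac{\mathbb{E}\xi^2}{2m^2}-\frac{\mathbb{E}\eta}{m}$$ ($\gamma_0$ may be positive, negative or zero).
   Context: Let $(\xi_i,\eta_i)_{i\in\mathbb{N}}$ be independent copies of a random vector $(\xi,\eta)$ whose components are almost surely positive and arbitrarily dependent. Put $S_0:=0$, $S_i:=\xi_1+\cdots+\xi_i$ and $T_i:=S_{i-1}+\eta_i$ for $i\in\mathbb{N}$ (a perturbed random walk). Let $N(t):=\sum_{i\ge1}\mathbf{1}_{\{T_i\le t\}}$ and $V(t):=\mathbb{E}N(t)$ for $t\ge0$, and $V(t):=0$ for $t<0$. Define $V_1:=V$ and, for $j\ge2$ and $t\ge0$, $V_j(t):=\int_{[0,t]}V_{j-1}(t-y)\,dV(y)$ (Lebesgue–Stieltjes integral), i.e. $V_j$ is the $j$-fold Lebesgue–Stieltjes convolution power of $V$. (Equivalently, $V_j(t)$ is the expected number of $j$th generation individuals born in $[0,t]$ in the general branching process started by one ancestor at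 time $0$ in which each individual independently produces offspring at times, relative to its own birth, distributed as $(T_i)_{i\in\mathbb{N}}$.) The distribution of $\xi$ is called spread-out if some convolution power of the distribution function $t\mapsto\mathbb{P}\{\xi\le t\}$ has a (nontrivial) absolutely continuous component with respect to Lebesgue measure. The notation $u(t)\sim v(t)$ means $u(t)/v(t)\to1$ as $t\to\infty$. *)

theory Defs
  imports "HOL-Probability.Probability" "HOL-Library.Landau_Symbols"
begin

text \<open>The families \<open>X i = \<xi>\<^sub>i\<close> and \<open>Y i = \<eta>\<^sub>i\<close> are used for \<open>i \<ge> 1\<close> only; \<open>X 0\<close> and \<open>Y 0\<close> play no role.\<close>

definition iid_copies ::
  "'a measure \<Rightarrow> (nat \<Rightarrow> 'a \<Rightarrow> real) \<Rightarrow> (nat \<Rightarrow> 'a \<Rightarrow> real) \<Rightarrow> 'b measure \<Rightarrow> ('b \<Rightarrow> real) \<Rightarrow> ('b \<Rightarrow> real) \<Rightarrow> bool"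
where
  "iid_copies M X Y P \<xi> \<eta> \<longleftrightarrow>
     prob_space.indep_vars M (\<lambda>_. borel :: (real \<times> real) measure) (\<lambda>i \<omega>. (X i \<omega>, Y i \<omega>)) {1..} \<and>
     (\<forall>i\<ge>1. distr M (borel :: (real \<times> real) measure) (\<lambda>\<omega>. (X i \<omega>, Y i \<omega>))
           = distr P borel (\<lambda>\<omega>. (\<xi> \<omega>, \<eta> \<omega>)))"

definition walk :: "(nat \<Rightarrow> 'a \<Rightarrow> real) \<Rightarrow> nat \<Rightarrow> 'a \<Rightarrow> real" where
  "walk X i \<omega> = (\<Sum>k=1..i. X k \<omega>)"

definition perturbed_walk ::
  "(nat \<Rightarrow> 'a \<Rightarrow> real) \<Rightarrow> (nat \<Rightarrow> 'a \<Rightarrow> real) \<Rightarrow> nat \<Rightarrow> 'a \<Rightarrow> real" where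
  "perturbed_walk X Y i \<omega> = walk X (i - 1) \<omega> + Y i \<omega>"

text \<open>The sum runs over \<open>i \<ge> 1\<close>, whence the \<open>Suc\<close>; it is taken in \<open>ennreal\<close>, so no convergence
  is presupposed.\<close>

definition counting ::
  "(nat \<Rightarrow> 'a \<Rightarrow> real) \<Rightarrow> (nat \<Rightarrow> 'a \<Rightarrow> real) \<Rightarrow> real \<Rightarrow> 'a \<Rightarrow> ennreal" where
  "counting X Y t \<omega> = (\<Sum>i. indicator {..t} (perturbed_walk X Y (Suc i) \<omega>))"

text \<open>For i.i.d. pairs with almost surely positive components the expectation is finite for every
  \<open>t\<close>, since \<open>V t \<le> (\<Sum>i\<ge>0. Prob (walk X i \<le> t)) < \<infinity>\<close>; hence \<open>enn2real\<close> loses nothing.\<close>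

definition mean_counting ::
  "'a measure \<Rightarrow> (nat \<Rightarrow> 'a \<Rightarrow> real) \<Rightarrow> (nat \<Rightarrow> 'a \<Rightarrow> real) \<Rightarrow> real \<Rightarrow> real" where
  "mean_counting M X Y t = (if t < 0 then 0 else enn2real (\<integral>\<^sup>+\<omega>. counting X Y t \<omega> \<partial>M))"

text \<open>Lebesgue--Stieltjes convolution powers of a nondecreasing right-continuous function vanishing
  on the negative half-line. The power with index \<open>0\<close> is the convolution unit and is only there
  to make the function total.\<close>

fun LS_power :: "(real \<Rightarrow> real) \<Rightarrow> nat \<Rightarrow> real \<Rightarrow> real" where
  "LS_power F 0 = indicator {0..}"
| "LS_power F (Suc 0) = F"
| "LS_power F (Suc (Suc j)) = (\<lambda>t. LINT y:{0..t}|interval_measure F. LS_power F (Suc j) (t - y))"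

primrec conv_power :: "real measure \<Rightarrow> nat \<Rightarrow> real measure" where
  "conv_power \<mu> 0 = return borel 0"
| "conv_power \<mu> (Suc n) = convolution \<mu> (conv_power \<mu> n)"

text \<open>The absolutely continuous part \<open>\<alpha>\<close> of the Lebesgue decomposition \<open>\<mu> = \<alpha> + \<sigma>\<close> is nonzero.\<close>

definition has_nontrivial_ac_component :: "real measure \<Rightarrow> bool" where
  "has_nontrivial_ac_component \<mu> \<longleftrightarrow>
     (\<exists>\<alpha> \<sigma>. sets \<alpha> = sets borel \<and> sets \<sigma> = sets borel \<and>
        (\<forall>A\<in>sets borel. emeasure \<mu> A = emeasure \<alpha> A + emeasure \<sigma> A) \<and>
        absolutely_continuous lborel \<alpha> \<and>
        (\<exists>Z\<in>null_sets lborel. emeasure \<sigma> (- Z) = 0) \<and>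
        emeasure \<alpha> UNIV > 0)"

definition spread_out :: "real measure \<Rightarrow> bool" where
  "spread_out \<mu> \<longleftrightarrow> (\<exists>n\<ge>1. has_nontrivial_ac_component (conv_power \<mu> n))"

text \<open>\<open>has_LS_total_mass G c\<close> says that \<open>G\<close>, extended by \<open>0\<close> to the negative half-line, is of bounded
  variation and right-continuous, and that \<open>\<integral>\<^bsub>[0,\<infinity>)\<^esub> dG = c\<close>. The finite signed measure \<open>dG\<close> on
  \<open>[0,\<infinity>)\<close> is represented as a difference \<open>P - N\<close> of finite measures. It gives \<open>[0,t]\<close> the mass
  \<open>G t\<close> (so a nonzero \<open>G 0\<close> is an atom at \<open>0\<close>), which determines it, and \<open>c\<close>, uniquely.\<close>

definition has_LS_total_mass :: "(real \<Rightarrow> real) \<Rightarrow> real \<Rightarrow> bool" where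
  "has_LS_total_mass G c \<longleftrightarrow>
     (\<exists>P N. finite_borel_measure P \<and> finite_borel_measure N \<and>
        (\<forall>t\<ge>0. measure P {0..t} - measure N {0..t} = G t) \<and>
        c = measure P {0..} - measure N {0..})"

end

theory Submission
  imports Defs
begin

text \<open>Let \<open>\<mu>\<close> and \<open>\<nu>\<close> be the laws of \<open>\<xi>\<close> and \<open>\<eta>\<close>, let \<open>m\<close> be the mean of \<open>\<mu>\<close>, and let the
  intensity be the measure with distribution function \<open>V\<close>. The proof has a renewal part and an
  expansion part.

  \<^bold>\<open>Renewal part.\<close> The signed measure \<open>dV - dy / m\<close> on the half-line has finite total variation
  and a finite first absolute moment. By duality this is a bound, uniform in the test function
  \<open>f\<close> with \<open>\<bar>f u\<bar> \<le> 1 + u\<close>, on the difference of the integrals of \<open>f\<close> against the intensity and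
  against \<open>dy / m\<close> (\<open>intensity_test_bound\<close>; \<open>signed_deviation\<close> passes to the Jordan
  decomposition). Let \<open>h\<close> be the potential of \<open>f\<close>, that is the sum over \<open>i \<ge> 0\<close> of \<open>E f (x +
  S\<^sub>i)\<close>. Then the first integral is \<open>E h \<eta>\<close> (\<open>integral_intensity\<close>) and the second is the mean of
  the integral of \<open>h\<close> over \<open>[0,\<xi>]\<close>, divided by \<open>m\<close> (\<open>integral_potential\<close>). Hence it suffices to
  bound \<open>h x - h 0\<close> by a multiple of \<open>1 + x\<^sup>2\<close>, whence the moments that are assumed. This is
  \<open>potential_oscillation\<close>, an analytic version of the coupling of two renewal processes: of two
  points far apart the lower one jumps, and a Lyapunov function decreases (\<open>quadratic_drift\<close>);
  two points close to each other both make \<open>N\<close> jumps, after which a fixed part of their laws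
  coincides (\<open>coupled_difference\<close>), because a convolution power of a spread-out law dominates a
  multiple of Lebesgue measure on a long interval (\<open>spread_out_minorized\<close>). The total mass of
  the deviation is the limit \<open>\<gamma>\<^sub>0\<close> of \<open>V t - t / m\<close>, and it is computed in \<open>gamma_eq\<close> by
  choosing \<open>f\<close> such that \<open>h\<close> is \<open>(T - x)\<^sup>+\<close>.

  \<^bold>\<open>Expansion part.\<close> Put \<open>a = m * \<gamma>\<^sub>0\<close>. The measure with distribution function \<open>(t + a)\<^sup>+ / m\<close>
  has the explicit convolution powers \<open>(t + n * a)^n / (m^n * n!)\<close>, and \<open>(1 + n * a / t)^n\<close> is
  \<open>exp (a * n\<^sup>2 / t + O (n\<^sup>3 / t\<^sup>2))\<close>, which is exactly the claim. So let \<open>W\<close> and \<open>A\<close> be the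
  convolutions with the intensity and with this model, and let \<open>D = W - A\<close>. The operators
  commute, and the \<open>n\<close>-th convolution power of \<open>V\<close> is the sum of \<open>(n choose k) * D^k A^(n - k)\<close>
  applied to the indicator of the half-line (\<open>W_power_expansion\<close>). The operator \<open>D\<close> is bounded
  since the deviation has finite total variation. So is \<open>D A\<close>: it is the convolution with a
  shift of \<open>V s - (s + a)\<^sup>+ / m\<close>, which is integrable because the deviation has a first moment
  and because \<open>a\<close> was chosen to make it vanish at infinity (\<open>D_A_bound\<close>). Dropping two factors
  \<open>A\<close> from the main term divides it by about \<open>(t / (m * n))\<^sup>2\<close>; so the terms with \<open>2 * k \<le> n\<close>
  are at most \<open>(C * n\<^sup>3 / t\<^sup>2)^k / k!\<close> times the main term, and all others together at most \<open>(C
  * n / t)^n\<close> times (\<open>expansion_error\<close>). Both contributions vanish if \<open>n\<^sup>3 = o(t\<^sup>2)\<close>. Since the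
  model already carries the factor \<open>exp (a * n\<^sup>2 / t)\<close>, no cancellation between the terms is
  required, whatever the sign of \<open>\<gamma>\<^sub>0\<close>.\<close>

section \<open>Potentials of a positive law\<close>

lemma abs_integral_le:
  fixes f g :: "'a \<Rightarrow> real"
  assumes "integrable M g" and le: "AE x in M. \<bar>f x\<bar> \<le> g x"
  shows "\<bar>LINT x|M. f x\<bar> \<le> (LINT x|M. g x)"
proof -
  have "AE x in M. 0 \<le> g x" by (rule eventually_mono[OF le]) linarith
  then have "(LINT x|M. \<bar>f x\<bar>) \<le> (LINT x|M. g x)" using assms by (intro integral_mono_AE')
  with integral_abs_bound[of M f] show ?thesis by linarith
qed

lemma density_real:
  fixes f d :: "'a \<Rightarrow> real"
  assumes "f \<in> borel_measurable M" "d \<in> borel_measurable M" "\<And>x. 0 \<le> d x"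
  shows "integrable (density M (\<lambda>x. ennreal (d x))) f \<longleftrightarrow> integrable M (\<lambda>x. d x * f x)"
    and "(LINT x|density M (\<lambda>x. ennreal (d x)). f x) = (LINT x|M. d x * f x)"
  using integrable_density[of f M d] integral_density[of f M d] assms by auto

text \<open>The weight \<open>exp (- u)\<close> is an eigenfunction of the operator \<open>f \<mapsto> E f (\<cdot> + \<xi>)\<close>, with an
  eigenvalue less than one when \<open>\<xi>\<close> is positive. On functions dominated by it the Neumann series
  of that operator converges geometrically, without any appeal to the elementary renewal
  theorem. Bounded functions with bounded support belong to the class.\<close>
definition exp_dominated :: "real \<Rightarrow> (real \<Rightarrow> real) \<Rightarrow> bool" where
  "exp_dominated C f \<longleftrightarrow> f \<in> borel_measurable borel \<and> (\<forall>u. \<bar>f u\<bar> \<le> C * exp (- u))"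

lemma exp_dominated_measurable: "exp_dominated C f \<Longrightarrow> f \<in> borel_measurable borel"
  by (simp add: exp_dominated_def)

lemma exp_dominated_le: "exp_dominated C f \<Longrightarrow> \<bar>f u\<bar> \<le> C * exp (- u)"
  by (simp add: exp_dominated_def)

lemma exp_dominated_nonneg: "exp_dominated C f \<Longrightarrow> 0 \<le> C"
  using exp_dominated_le[of C f 0] by simp

lemma exp_dominated_add_le:
  assumes "exp_dominated C f" "0 \<le> s"
  shows "\<bar>f (x + s)\<bar> \<le> C * exp (- x)"
proof -
  have "C * exp (- (x + s)) \<le> C * exp (- x)"
    using exp_dominated_nonneg[OF assms(1)] assms(2) by (intro mult_left_mono) auto
  with exp_dominated_le[OF assms(1), of "x + s"] show ?thesis by linarith
qed

lemma exp_dominated_const_le: "exp_dominated C f \<Longrightarrow> 0 \<le> u \<Longrightarrow> \<bar>f u\<bar> \<le> C"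
  using exp_dominated_add_le[of C f u 0] by simp

lemma exp_dominated_diff:
  assumes "exp_dominated C f" "exp_dominated D g"
  shows "exp_dominated (C + D) (\<lambda>x. f x - g x)"
  unfolding exp_dominated_def
proof safe
  show "(\<lambda>x. f x - g x) \<in> borel_measurable borel"
    using assms[THEN exp_dominated_measurable] by measurable
  fix u
  have "\<bar>f u\<bar> \<le> C * exp (- u)" "\<bar>g u\<bar> \<le> D * exp (- u)" using assms by (auto simp: exp_dominated_def)
  then show "\<bar>f u - g u\<bar> \<le> (C + D) * exp (- u)" by (auto simp: algebra_simps)
qed

locale positive_law = real_distribution \<mu> for \<mu> :: "real measure" +
  assumes pos: "AE s in \<mu>. 0 < s"
begin

definition step :: "(real \<Rightarrow> real) \<Rightarrow> real \<Rightarrow> real" where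
  "step f x = (LINT s|\<mu>. f (x + s))"

definition rho :: real where "rho = (LINT s|\<mu>. exp (- s))"

definition potential :: "(real \<Rightarrow> real) \<Rightarrow> real \<Rightarrow> real" where
  "potential f x = (\<Sum>n. (step ^^ n) f x)"

lemma integrable_exp_minus: "integrable \<mu> (\<lambda>s. exp (- s))"
  by (rule integrable_const_bound[where B=1]) (use pos in \<open>auto elim: eventually_mono\<close>)

lemma rho_nonneg: "0 \<le> rho"
  unfolding rho_def by (intro integral_nonneg_AE) auto

lemma rho_less_1: "rho < 1"
proof -
  have "(LINT s|\<mu>. exp (- s)) < (LINT s|\<mu>. 1)"
  proof (rule integral_less_AE_space)
    show "AE s in \<mu>. exp (- s) < 1" using pos by (auto elim: eventually_mono)
    show "emeasure \<mu> (space \<mu>) \<noteq> 0" by (subst emeasure_space_1) simp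
  qed (auto intro: integrable_exp_minus)
  then show ?thesis by (simp add: rho_def prob_space del: space_eq_univ)
qed

lemma measurable_step[measurable]:
  assumes [measurable]: "f \<in> borel_measurable borel"
  shows "step f \<in> borel_measurable borel"
  unfolding step_def by measurable

lemma measurable_step_power[measurable]:
  assumes [measurable]: "f \<in> borel_measurable borel"
  shows "(step ^^ n) f \<in> borel_measurable borel"
  by (induction n) auto

lemma exp_dominated_integrable:
  assumes "exp_dominated C f"
  shows "integrable \<mu> (\<lambda>s. f (x + s))"
proof (rule Bochner_Integration.integrable_bound)
  show "integrable \<mu> (\<lambda>s. C * exp (-x) * exp (- s))" using integrable_exp_minus by simp
  show "(\<lambda>s. f (x + s)) \<in> borel_measurable \<mu>"
    using exp_dominated_measurable[OF assms] by measurable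
  have "\<bar>f (x + s)\<bar> \<le> \<bar>C * exp (-x) * exp (- s)\<bar>" for s
    using assms unfolding exp_dominated_def
    by (metis abs_ge_self exp_add minus_add_distrib mult.assoc order_trans)
  then show "AE s in \<mu>. norm (f (x + s)) \<le> norm (C * exp (-x) * exp (- s))" by simp
qed

text \<open>Each step multiplies the constant by \<open>rho = E exp (- \<xi>)\<close>, because \<open>exp (- (x + s))\<close>
  factorizes.\<close>
lemma exp_dominated_step:
  assumes "exp_dominated C f"
  shows "exp_dominated (C * rho) (step f)"
proof -
  have [measurable]: "f \<in> borel_measurable borel" using assms by (simp add: exp_dominated_def)
  have "\<bar>step f x\<bar> \<le> C * rho * exp (- x)" for x
  proof -
    have "\<bar>step f x\<bar> \<le> (LINT s|\<mu>. C * exp (-x) * exp (- s))"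
      unfolding step_def
    proof (rule abs_integral_le)
      show "AE s in \<mu>. \<bar>f (x + s)\<bar> \<le> C * exp (- x) * exp (- s)"
        using exp_dominated_le[OF assms] by (intro AE_I2) (metis exp_add minus_add_distrib mult.assoc)
    qed (use integrable_exp_minus in simp)
    then show ?thesis by (simp add: rho_def mult_ac)
  qed
  then show ?thesis by (simp add: exp_dominated_def)
qed

lemma exp_dominated_step_power:
  assumes "exp_dominated C f"
  shows "exp_dominated (C * rho ^ n) ((step ^^ n) f)"
proof (induction n)
  case (Suc n)
  from exp_dominated_step[OF this] show ?case by (simp add: mult_ac)
qed (use assms in simp)

lemma step_power_bound:
  assumes "exp_dominated C f"
  shows "\<bar>(step ^^ n) f x\<bar> \<le> C * exp (- x) * rho ^ n"
  using exp_dominated_step_power[OF assms, of n] unfolding exp_dominated_def by (simp add: mult_ac)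

lemma summable_rho: "summable (\<lambda>n. c * rho ^ n)"
  using rho_nonneg rho_less_1 by (intro summable_mult summable_geometric) auto

lemma summable_potential:
  assumes "exp_dominated C f"
  shows "summable (\<lambda>n. \<bar>(step ^^ n) f x\<bar>)"
  using step_power_bound[OF assms]
  by (intro summable_comparison_test'[OF summable_rho[of "C * exp (- x)"], of 0]) auto

lemma exp_dominated_potential:
  assumes "exp_dominated C f"
  shows "exp_dominated (C / (1 - rho)) (potential f)"
proof -
  have [measurable]: "f \<in> borel_measurable borel" using assms by (simp add: exp_dominated_def)
  have "\<bar>potential f x\<bar> \<le> C / (1 - rho) * exp (- x)" for x
  proof -
    have "\<bar>potential f x\<bar> \<le> (\<Sum>n. \<bar>(step ^^ n) f x\<bar>)"
      unfolding potential_def by (intro summable_rabs summable_potential[OF assms])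
    also have "\<dots> \<le> (\<Sum>n. C * exp (- x) * rho ^ n)"
      by (intro suminf_le summable_potential[OF assms] summable_rho step_power_bound[OF assms])
    also have "\<dots> = C * exp (- x) * (1 / (1 - rho))"
      using rho_nonneg rho_less_1 by (subst suminf_mult) (auto simp: suminf_geometric)
    finally show ?thesis by (simp add: mult_ac)
  qed
  moreover have "potential f \<in> borel_measurable borel"
    unfolding potential_def by measurable
  ultimately show ?thesis by (simp add: exp_dominated_def)
qed

text \<open>The renewal equation for the potential: the zeroth term of the series splits off, and one
  step may be taken out of the remaining sum by dominated convergence.\<close>
lemma potential_eq:
  assumes "exp_dominated C f"
  shows "potential f x = f x + step (potential f) x"
proof -
  have [measurable]: "f \<in> borel_measurable borel" using assms by (simp add: exp_dominated_def)
  have sum: "summable (\<lambda>n. (step ^^ n) f x)" for x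
    using summable_potential[OF assms] by (rule summable_rabs_cancel)
  have "step (potential f) x = (LINT s|\<mu>. (\<Sum>n. (step ^^ n) f (x + s)))"
    by (simp add: step_def potential_def)
  also have "\<dots> = (\<Sum>n. LINT s|\<mu>. (step ^^ n) f (x + s))"
  proof (rule integral_suminf)
    show "integrable \<mu> (\<lambda>s. (step ^^ n) f (x + s))" for n
      by (rule exp_dominated_integrable[OF exp_dominated_step_power[OF assms]])
    show "AE s in \<mu>. summable (\<lambda>n. norm ((step ^^ n) f (x + s)))"
      using summable_potential[OF assms] by simp
    show "summable (\<lambda>n. LINT s|\<mu>. norm ((step ^^ n) f (x + s)))"
    proof (rule summable_comparison_test'[OF summable_rho[of "C * exp (-x) * rho"], of 0])
      fix n
      have "\<bar>LINT s|\<mu>. \<bar>(step ^^ n) f (x + s)\<bar>\<bar> \<le> (LINT s|\<mu>. C * exp (-x) * rho ^ n * exp (- s))"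
      proof (rule abs_integral_le)
        have "\<bar>(step ^^ n) f (x + s)\<bar> \<le> C * exp (-x) * rho ^ n * exp (- s)" for s
          using step_power_bound[OF assms, of n "x + s"] by (simp add: exp_diff exp_minus field_simps)
        then show "AE s in \<mu>. \<bar>\<bar>(step ^^ n) f (x + s)\<bar>\<bar> \<le> C * exp (-x) * rho ^ n * exp (- s)" by simp
      qed (use integrable_exp_minus in simp)
      then show "norm (LINT s|\<mu>. norm ((step ^^ n) f (x + s))) \<le> C * exp (-x) * rho * rho ^ n"
        by (simp add: rho_def mult_ac)
    qed
  qed
  also have "\<dots> = (\<Sum>n. (step ^^ Suc n) f x)" by (simp add: step_def)
  also have "\<dots> = potential f x - f x"
    unfolding potential_def by (subst suminf_split_head[OF sum]) simp
  finally show ?thesis by simp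
qed

lemma step_diff:
  assumes "exp_dominated C f" "exp_dominated D g"
  shows "step (\<lambda>x. f x - g x) x = step f x - step g x"
  unfolding step_def by (intro Bochner_Integration.integral_diff exp_dominated_integrable[OF assms(1)]
      exp_dominated_integrable[OF assms(2)])

lemma step_power_diff:
  assumes "exp_dominated C f" "exp_dominated D g"
  shows "(step ^^ n) (\<lambda>x. f x - g x) = (\<lambda>x. (step ^^ n) f x - (step ^^ n) g x)"
proof (induction n)
  case (Suc n)
  show ?case
    by (simp add: Suc) (intro ext step_diff[OF exp_dominated_step_power[OF assms(1)]
      exp_dominated_step_power[OF assms(2)]])
qed simp

lemma potential_iterate:
  assumes "exp_dominated C f"
  shows "potential f x = (\<Sum>i<N. (step ^^ i) f x) + (step ^^ N) (potential f) x"
proof (induction N)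
  case (Suc N)
  have eq: "f = (\<lambda>x. potential f x - step (potential f) x)"
    using potential_eq[OF assms] by (simp add: fun_eq_iff)
  note d = exp_dominated_potential[OF assms]
  have "(step ^^ N) f x = (step ^^ N) (potential f) x - (step ^^ N) (step (potential f)) x"
    by (subst eq, subst step_power_diff[OF d exp_dominated_step[OF d]]) simp
  then show ?case using Suc by (simp add: funpow_swap1)
qed simp

text \<open>The partial sums of the potential of \<open>h - step h\<close> telescope to \<open>h\<close> minus an iterate of
  \<open>step\<close>, and the iterates die out geometrically.\<close>
lemma potential_unique:
  assumes "exp_dominated C h"
  shows "potential (\<lambda>x. h x - step h x) = h"
proof
  fix x
  let ?f = "\<lambda>x. h x - step h x"
  note d = exp_dominated_diff[OF assms exp_dominated_step[OF assms]]
  have "(\<Sum>i<N. (step ^^ i) ?f x) = h x - (step ^^ N) h x" for N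
  proof (induction N)
    case (Suc N)
    have "(step ^^ N) ?f x = (step ^^ N) h x - (step ^^ Suc N) h x"
      by (subst step_power_diff[OF assms exp_dominated_step[OF assms]]) (simp add: funpow_swap1)
    then show ?case using Suc by simp
  qed simp
  moreover have "(\<lambda>N. h x - (step ^^ N) h x) \<longlonglongrightarrow> h x - 0"
  proof (intro tendsto_intros)
    have "(\<lambda>N. C * exp (- x) * rho ^ N) \<longlonglongrightarrow> 0"
      using summable_LIMSEQ_zero[OF summable_rho] .
    then show "(\<lambda>N. (step ^^ N) h x) \<longlonglongrightarrow> 0"
      by (rule tendsto_rabs_zero_cancel[OF tendsto_sandwich[rotated 3]])
         (use step_power_bound[OF assms] in \<open>auto\<close>)
  qed
  ultimately have "(\<lambda>N. \<Sum>i<N. (step ^^ i) ?f x) \<longlonglongrightarrow> h x" by simp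
  then show "potential ?f x = h x"
    unfolding potential_def by (simp add: sums_def sums_iff[symmetric] suminf_eq_lim limI)
qed

end

lemma integrable_exp_half_line: "integrable lborel (\<lambda>y::real. indicator {0..} y * exp (- y))"
proof (rule integrableI_bounded)
  have "(\<integral>\<^sup>+y. ennreal (norm (indicator {0..} y * exp (- y :: real))) \<partial>lborel)
     = (\<integral>\<^sup>+y. ennreal (y ^ 0 * exp (- y)) * indicator {0..} y \<partial>lborel)"
    by (intro nn_integral_cong) (auto split: split_indicator)
  also have "\<dots> = 1" by (subst nn_intergal_power_times_exp_Ici) simp
  finally show "(\<integral>\<^sup>+y. ennreal (norm (indicator {0..} y * exp (- y :: real))) \<partial>lborel) < \<infinity>" by simp
qed measurable

lemma exp_dominated_integrable_half_line:
  assumes "exp_dominated C f" "A \<in> sets borel" "A \<subseteq> {0..}"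
  shows "integrable lborel (\<lambda>y. indicator A y * f y)"
proof (rule Bochner_Integration.integrable_bound)
  show "integrable lborel (\<lambda>y::real. C * (indicator {0..} y * exp (- y)))"
    using integrable_exp_half_line by (rule integrable_mult_right)
  show "(\<lambda>y. indicator A y * f y) \<in> borel_measurable lborel"
    using exp_dominated_measurable[OF assms(1)] assms(2) by measurable
  have "norm (indicator A y * f y) \<le> norm (C * (indicator {0..} y * exp (- y)))" for y
    using assms(3) exp_dominated_le[OF assms(1)] by (auto split: split_indicator intro: order_trans[OF _ abs_ge_self])
  then show "AE y in lborel. norm (indicator A y * f y) \<le> norm (C * (indicator {0..} y * exp (- y)))" by simp
qed

lemma measurable_partial_integral[measurable]:
  fixes f :: "real \<Rightarrow> real"
  assumes [measurable]: "f \<in> borel_measurable borel"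
  shows "(\<lambda>s. LINT y|lborel. indicator {0..s} y * f y) \<in> borel_measurable borel"
proof -
  have "(\<lambda>s. LINT y|lborel. (if 0 \<le> y \<and> y \<le> s then f y else 0)) \<in> borel_measurable borel"
    by measurable
  also have "(\<lambda>s. LINT y|lborel. (if 0 \<le> y \<and> y \<le> s then f y else 0)) = (\<lambda>s. LINT y|lborel. indicator {0..s} y * f y)"
    by (intro ext Bochner_Integration.integral_cong) (auto split: split_indicator)
  finally show ?thesis .
qed

context positive_law
begin

text \<open>With \<open>h\<close> the potential of \<open>f\<close> one has \<open>f = h - step h\<close>. Integrated over the half-line, the
  shift by \<open>s\<close> inside \<open>step h\<close> cancels everything except the integral of \<open>h\<close> over \<open>[0,s]\<close>.
  Divided by the mean of \<open>\<mu>\<close> the right-hand side is the integral of \<open>h\<close> against the stationary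
  delay law, so this says that the stationary renewal process has Lebesgue intensity.\<close>
lemma integral_potential:
  assumes f: "exp_dominated C f"
  shows "(LINT y|lborel. indicator {0..} y * f y)
       = (LINT s|\<mu>. (LINT y|lborel. indicator {0..s} y * potential f y))"
proof -
  define h where "h = potential f"
  obtain D where h: "exp_dominated D h" using exp_dominated_potential[OF f] h_def by blast
  note [measurable] = exp_dominated_measurable[OF h]
  interpret p: pair_sigma_finite lborel \<mu> ..
  have bound: "\<bar>h (y + s)\<bar> \<le> D * exp (- y) * exp (- s)" for y s
    using exp_dominated_le[OF h, of "y + s"] by (simp add: exp_diff exp_minus field_simps)
  have int: "integrable (lborel \<Otimes>\<^sub>M \<mu>) (\<lambda>(y, s). indicator {0..} y * h (y + s))"
  proof (rule p.Fubini_integrable)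
    show "(\<lambda>(y, s). indicator {0..} y * h (y + s)) \<in> borel_measurable (lborel \<Otimes>\<^sub>M \<mu>)" by measurable
    show "AE y in lborel. integrable \<mu> (\<lambda>s. (case (y, s) of (y, s) \<Rightarrow> indicator {0..} y * h (y + s)))"
      using exp_dominated_integrable[OF h] by simp
    have *: "\<bar>LINT s|\<mu>. \<bar>h (y + s)\<bar>\<bar> \<le> D * rho * exp (- y)" for y
    proof -
      have "\<bar>LINT s|\<mu>. \<bar>h (y + s)\<bar>\<bar> \<le> (LINT s|\<mu>. D * exp (- y) * exp (- s))"
        using integrable_exp_minus bound by (intro abs_integral_le) simp_all
      then show ?thesis by (simp add: rho_def mult_ac)
    qed
    show "integrable lborel (\<lambda>y. LINT s|\<mu>. norm (case (y, s) of (y, s) \<Rightarrow> indicator {0..} y * h (y + s)))"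
    proof (rule Bochner_Integration.integrable_bound)
      show "integrable lborel (\<lambda>y::real. D * rho * (indicator {0..} y * exp (- y)))"
        using integrable_exp_half_line by (rule integrable_mult_right)
      have "norm (LINT s|\<mu>. \<bar>indicator {0..} y * h (y + s)\<bar>) \<le> norm (D * rho * (indicator {0..} y * exp (- y)))" for y
        using * [of y] exp_dominated_nonneg[OF h] rho_nonneg by (auto split: split_indicator simp: abs_mult intro: order_trans[OF _ abs_ge_self])
      then show "AE y in lborel. norm (LINT s|\<mu>. norm (case (y, s) of (y, s) \<Rightarrow> indicator {0..} y * h (y + s)))
          \<le> norm (D * rho * (indicator {0..} y * exp (- y)))" by simp
    qed measurable
  qed
  have ih: "integrable lborel (\<lambda>y. indicator A y * h y)" if "A \<in> sets borel" "A \<subseteq> {0..}" for A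
    by (rule exp_dominated_integrable_half_line[OF h that])
  have shift: "(LINT y|lborel. indicator {0..} y * h (y + s)) = (LINT y|lborel. indicator {s..} y * h y)" for s
    by (subst (2) lborel_integral_real_affine[where c = 1 and t = s])
       (auto intro!: Bochner_Integration.integral_cong split: split_indicator simp: add.commute)
  have "(LINT y|lborel. indicator {0..} y * f y)
      = (LINT y|lborel. indicator {0..} y * h y - indicator {0..} y * step h y)"
    using potential_eq[OF f] by (intro Bochner_Integration.integral_cong) (auto simp: h_def algebra_simps)
  also have "\<dots> = (LINT y|lborel. indicator {0..} y * h y) - (LINT y|lborel. indicator {0..} y * step h y)"
    by (intro Bochner_Integration.integral_diff ih exp_dominated_integrable_half_line[OF exp_dominated_step[OF h]]) auto
  also have "(LINT y|lborel. indicator {0..} y * step h y) = (LINT y|lborel. LINT s|\<mu>. indicator {0..} y * h (y + s))"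
    by (simp add: step_def)
  also have "\<dots> = (LINT s|\<mu>. LINT y|lborel. indicator {0..} y * h (y + s))"
    by (rule p.Fubini_integral[OF int, symmetric])
  also have "\<dots> = (LINT s|\<mu>. LINT y|lborel. indicator {s..} y * h y)"
    by (simp only: shift)
  finally have 1: "(LINT y|lborel. indicator {0..} y * f y)
     = (LINT y|lborel. indicator {0..} y * h y) - (LINT s|\<mu>. LINT y|lborel. indicator {s..} y * h y)" .
  have int2: "integrable \<mu> (\<lambda>s. LINT y|lborel. indicator {s..} y * h y)"
    using p.integrable_snd[OF int] by (simp add: shift)
  have "(LINT s|\<mu>. (LINT y|lborel. indicator {0..s} y * h y))
      = (LINT s|\<mu>. (LINT y|lborel. indicator {0..} y * h y) - (LINT y|lborel. indicator {s..} y * h y))"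
  proof (rule integral_cong_AE)
    show "AE s in \<mu>. (LINT y|lborel. indicator {0..s} y * h y)
       = (LINT y|lborel. indicator {0..} y * h y) - (LINT y|lborel. indicator {s..} y * h y)"
      using pos
    proof (rule eventually_mono)
      fix s :: real assume s: "0 < s"
      have "(LINT y|lborel. indicator {0..s} y * h y) = (LINT y|lborel. indicator {0..} y * h y - indicator {s..} y * h y)"
      proof (rule integral_cong_AE)
        show "AE y in lborel. indicator {0..s} y * h y = indicator {0..} y * h y - indicator {s..} y * h y"
          using AE_lborel_singleton[of s] by (rule eventually_mono) (use s in \<open>auto split: split_indicator\<close>)
      qed measurable
      also have "\<dots> = (LINT y|lborel. indicator {0..} y * h y) - (LINT y|lborel. indicator {s..} y * h y)"
        using s by (intro Bochner_Integration.integral_diff ih) auto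
      finally show "(LINT y|lborel. indicator {0..s} y * h y)
        = (LINT y|lborel. indicator {0..} y * h y) - (LINT y|lborel. indicator {s..} y * h y)" .
    qed
    have "(\<lambda>s. LINT y|lborel. indicator {s..} y * h y) \<in> borel_measurable \<mu>" using int2 by simp
    then show "(\<lambda>s. (LINT y|lborel. indicator {0..} y * h y) - (LINT y|lborel. indicator {s..} y * h y)) \<in> borel_measurable \<mu>"
      by simp
    show "(\<lambda>s. LINT y|lborel. indicator {0..s} y * h y) \<in> borel_measurable \<mu>" by simp
  qed
  also have "\<dots> = (LINT y|lborel. indicator {0..} y * h y) - (LINT s|\<mu>. LINT y|lborel. indicator {s..} y * h y)"
    using int2 by (subst Bochner_Integration.integral_diff) (auto simp: prob_space[simplified])
  finally show ?thesis using 1 by (simp add: h_def)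
qed

end

section \<open>Minorization by Lebesgue measure\<close>

text \<open>Domination of a multiple of Lebesgue measure on \<open>E\<close>, stated for integrals of functions
  because that is how it enters Fubini arguments.\<close>
definition minorized :: "real \<Rightarrow> real set \<Rightarrow> real measure \<Rightarrow> bool" where
  "minorized c E \<kappa> \<longleftrightarrow> (\<forall>f\<in>borel_measurable borel.
     ennreal c * (\<integral>\<^sup>+x. f x * indicator E x \<partial>lborel) \<le> (\<integral>\<^sup>+x. f x \<partial>\<kappa>))"

lemma minorizedD:
  "minorized c E \<kappa> \<Longrightarrow> f \<in> borel_measurable borel \<Longrightarrow>
     ennreal c * (\<integral>\<^sup>+x. f x * indicator E x \<partial>lborel) \<le> (\<integral>\<^sup>+x. f x \<partial>\<kappa>)"
  by (simp add: minorized_def)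

text \<open>The convolution of the restrictions of Lebesgue measure to \<open>E\<close> and \<open>E'\<close> has at \<open>w\<close> the
  density \<open>\<bar>E \<inter> (w - E')\<bar>\<close>.\<close>
lemma minorized_convolution:
  assumes "finite_measure \<kappa>" "finite_measure \<kappa>'" "sets \<kappa> = sets borel" "sets \<kappa>' = sets borel"
    and min: "minorized c E \<kappa>" and min': "minorized c' E' \<kappa>'"
    and pos: "0 \<le> c" "0 \<le> c'" "0 \<le> e"
    and [measurable]: "E \<in> sets borel" "E' \<in> sets borel" "J \<in> sets borel"
    and over: "\<And>w. w \<in> J \<Longrightarrow> ennreal e \<le> emeasure lborel (E \<inter> {x. w - x \<in> E'})"
  shows "minorized (c * c' * e) J (\<kappa> \<star> \<kappa>')"
  unfolding minorized_def
proof
  fix f :: "real \<Rightarrow> ennreal" assume f[measurable]: "f \<in> borel_measurable borel"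
  interpret \<kappa>': finite_measure \<kappa>' by fact
  note [measurable_cong] = assms(3,4)
  have "ennreal (c * c' * e) * (\<integral>\<^sup>+w. f w * indicator J w \<partial>lborel)
      = ennreal (c * c') * (ennreal e * (\<integral>\<^sup>+w. f w * indicator J w \<partial>lborel))"
    using pos by (simp add: ennreal_mult mult.assoc)
  also have "ennreal e * (\<integral>\<^sup>+w. f w * indicator J w \<partial>lborel)
      \<le> (\<integral>\<^sup>+w. f w * emeasure lborel (E \<inter> {x. w - x \<in> E'}) \<partial>lborel)"
  proof (subst nn_integral_cmult[symmetric])
    show "(\<integral>\<^sup>+w. ennreal e * (f w * indicator J w) \<partial>lborel)
      \<le> (\<integral>\<^sup>+w. f w * emeasure lborel (E \<inter> {x. w - x \<in> E'}) \<partial>lborel)"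
      using over by (intro nn_integral_mono)
        (auto split: split_indicator simp: mult.commute[of "ennreal e"] intro!: mult_left_mono)
  qed measurable
  also have "\<dots> = (\<integral>\<^sup>+w. (\<integral>\<^sup>+x. f w * (indicator E x * indicator E' (w - x)) \<partial>lborel) \<partial>lborel)"
  proof (rule nn_integral_cong)
    fix w
    have "emeasure lborel (E \<inter> {x. w - x \<in> E'}) = (\<integral>\<^sup>+x. indicator (E \<inter> {x. w - x \<in> E'}) x \<partial>lborel)"
      by (rule nn_integral_indicator[symmetric]) measurable
    also have "\<dots> = (\<integral>\<^sup>+x. indicator E x * indicator E' (w - x) \<partial>lborel)"
      by (rule nn_integral_cong) (auto split: split_indicator)
    finally show "f w * emeasure lborel (E \<inter> {x. w - x \<in> E'})
        = (\<integral>\<^sup>+x. f w * (indicator E x * indicator E' (w - x)) \<partial>lborel)"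
      by (simp add: nn_integral_cmult)
  qed
  also have "\<dots> = (\<integral>\<^sup>+x. (\<integral>\<^sup>+w. f w * (indicator E x * indicator E' (w - x)) \<partial>lborel) \<partial>lborel)"
    by (rule lborel_pair.Fubini') measurable
  also have "\<dots> = (\<integral>\<^sup>+x. (\<integral>\<^sup>+y. f (x + y) * indicator E' y \<partial>lborel) * indicator E x \<partial>lborel)"
  proof (rule nn_integral_cong)
    fix x
    show "(\<integral>\<^sup>+w. f w * (indicator E x * indicator E' (w - x)) \<partial>lborel)
      = (\<integral>\<^sup>+y. f (x + y) * indicator E' y \<partial>lborel) * indicator E x"
      by (subst nn_integral_real_affine[where c = 1 and t = x])
         (auto simp: nn_integral_cmult mult_ac)
  qed
  also have "ennreal (c * c') * \<dots>
     = ennreal c * (\<integral>\<^sup>+x. (ennreal c' * (\<integral>\<^sup>+y. f (x + y) * indicator E' y \<partial>lborel)) * indicator E x \<partial>lborel)"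
    using pos by (simp add: ennreal_mult mult.assoc nn_integral_cmult)
  also have "\<dots> \<le> (\<integral>\<^sup>+x. (ennreal c' * (\<integral>\<^sup>+y. f (x + y) * indicator E' y \<partial>lborel)) \<partial>\<kappa>)"
    by (rule minorizedD[OF min]) measurable
  also have "\<dots> \<le> (\<integral>\<^sup>+x. (\<integral>\<^sup>+y. f (x + y) \<partial>\<kappa>') \<partial>\<kappa>)"
    by (intro nn_integral_mono minorizedD[OF min']) measurable
  also have "\<dots> = (\<integral>\<^sup>+x. f x \<partial>(\<kappa> \<star> \<kappa>'))"
    by (rule nn_integral_convolution[symmetric]) (use assms in auto)
  finally show "ennreal (c * c' * e) * (\<integral>\<^sup>+w. f w * indicator J w \<partial>lborel) \<le> (\<integral>\<^sup>+x. f x \<partial>(\<kappa> \<star> \<kappa>'))"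
    by (simp add: mult_left_mono)
qed

lemma conv_power_prob:
  assumes "real_distribution \<mu>"
  shows "real_distribution (conv_power \<mu> n)"
proof (induction n)
  case 0
  show ?case by (auto simp: real_distribution_def real_distribution_axioms_def intro!: prob_space_return)
next
  case (Suc n)
  interpret \<mu>: real_distribution \<mu> by fact
  interpret n: real_distribution "conv_power \<mu> n" by fact
  interpret p: pair_prob_space \<mu> "conv_power \<mu> n" ..
  show ?case
    by (auto simp: real_distribution_def real_distribution_axioms_def convolution_def
      intro!: p.prob_space_distr)
qed

lemma conv_power_add:
  assumes "real_distribution \<mu>"
  shows "conv_power \<mu> (n + k) = (conv_power \<mu> n \<star> conv_power \<mu> k)"
proof (induction n)
  case 0
  interpret k: real_distribution "conv_power \<mu> k" by (rule conv_power_prob[OF assms])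
  show ?case
  proof (rule measure_eqI)
    fix A assume "A \<in> sets (conv_power \<mu> (0 + k))"
    then have [measurable]: "A \<in> sets borel" by simp
    show "emeasure (conv_power \<mu> (0 + k)) A = emeasure (conv_power \<mu> 0 \<star> conv_power \<mu> k) A"
      by (simp add: convolution_emeasure' k.finite_measure_axioms prob_space_return
          prob_space.finite_measure nn_integral_return)
  qed simp
next
  case (Suc n)
  interpret \<mu>: real_distribution \<mu> by fact
  interpret n: real_distribution "conv_power \<mu> n" by (rule conv_power_prob[OF assms])
  interpret k: real_distribution "conv_power \<mu> k" by (rule conv_power_prob[OF assms])
  show ?case
    by (simp add: Suc) (rule convolution_associative; simp add: \<mu>.finite_measure_axioms
      n.finite_measure_axioms k.finite_measure_axioms)
qed

text \<open>The density of the absolutely continuous part is bounded below by some \<open>1 / (n + 1)\<close> on a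
  bounded set of positive measure, since otherwise it would vanish almost everywhere.\<close>
lemma ac_component_minorized:
  assumes "has_nontrivial_ac_component \<kappa>" and [measurable_cong]: "sets \<kappa> = sets borel"
  obtains c E r where "0 < c" "E \<in> sets borel" "E \<subseteq> {-r..r}" "0 < emeasure lborel E" "minorized c E \<kappa>"
proof -
  obtain \<alpha> \<sigma> where sets_\<alpha>[measurable_cong]: "sets \<alpha> = sets borel"
    and sum: "\<And>A. A \<in> sets borel \<Longrightarrow> emeasure \<kappa> A = emeasure \<alpha> A + emeasure \<sigma> A"
    and ac: "absolutely_continuous lborel \<alpha>" and pos: "emeasure \<alpha> UNIV > 0"
    using assms unfolding has_nontrivial_ac_component_def by blast
  define g where "g = RN_deriv lborel \<alpha>"
  have g[measurable]: "g \<in> borel_measurable borel"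
    unfolding g_def using borel_measurable_RN_deriv[of lborel \<alpha>] by simp
  have \<alpha>: "\<alpha> = density lborel g"
    unfolding g_def using sigma_finite_measure.density_RN_deriv[OF sigma_finite_lborel ac] sets_\<alpha> by simp
  define E where "E n = {x. ennreal (1 / real (Suc n)) \<le> g x} \<inter> {- real n..real n}" for n
  have [measurable]: "E n \<in> sets borel" for n unfolding E_def by measurable
  have "\<exists>n. 0 < emeasure lborel (E n)"
  proof (rule ccontr)
    assume "\<not> ?thesis"
    then have "E n \<in> null_sets lborel" for n by (auto simp: null_sets_def)
    then have "(\<Union>n. E n) \<in> null_sets lborel" by (rule null_sets_UN)
    then have "AE x in lborel. x \<notin> (\<Union>n. E n)" by (rule AE_not_in)
    moreover have "g x = 0" if x: "x \<notin> (\<Union>n. E n)" for x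
    proof (rule ccontr)
      assume "g x \<noteq> 0"
      note x = x this
      have "\<exists>e>0. ennreal e \<le> g x"
      proof (cases "g x")
        case (real e)
        then show ?thesis using x(2) by (intro exI[of _ e]) (auto simp: ennreal_eq_0_iff)
      next
        case top
        then show ?thesis by (intro exI[of _ 1]) simp
      qed
      then obtain e where e: "0 < e" "ennreal e \<le> g x" by blast
      obtain n1 where n1: "1 / real (Suc n1) < e" using e(1) nat_approx_posE by blast
      obtain n2 where n2: "\<bar>x\<bar> \<le> real n2" using real_arch_simple by blast
      let ?n = "max n1 n2"
      have "1 / real (Suc ?n) \<le> 1 / real (Suc n1)" by (intro divide_left_mono) auto
      then have "ennreal (1 / real (Suc ?n)) \<le> g x"
        using n1 e(2) by (meson ennreal_leI less_imp_le order_trans)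
      moreover have "x \<in> {- real ?n..real ?n}" using n2 by auto
      ultimately show False using x(1) by (auto simp: E_def)
    qed
    ultimately have "AE x in lborel. g x = 0" by (rule eventually_mono)
    then have "emeasure \<alpha> UNIV = 0"
      unfolding \<alpha> by (subst emeasure_density) (auto simp: nn_integral_0_iff_AE)
    with pos show False by simp
  qed
  then obtain n where n: "0 < emeasure lborel (E n)" by blast
  have "minorized (1 / real (Suc n)) (E n) \<kappa>"
    unfolding minorized_def
  proof
    fix f :: "real \<Rightarrow> ennreal" assume [measurable]: "f \<in> borel_measurable borel"
    have "ennreal (1 / real (Suc n)) * (\<integral>\<^sup>+x. f x * indicator (E n) x \<partial>lborel)
       = (\<integral>\<^sup>+x. ennreal (1 / real (Suc n)) * (f x * indicator (E n) x) \<partial>lborel)"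
      by (rule nn_integral_cmult[symmetric]) measurable
    also have "\<dots> \<le> (\<integral>\<^sup>+x. g x * f x \<partial>lborel)"
      by (intro nn_integral_mono) (auto simp: E_def split: split_indicator intro!: mult_right_mono)
    also have "\<dots> = (\<integral>\<^sup>+x. f x \<partial>\<alpha>)"
      unfolding \<alpha> by (rule nn_integral_density[symmetric]) auto
    also have "\<dots> \<le> (\<integral>\<^sup>+x. f x \<partial>\<kappa>)"
    proof (rule nn_integral_mono_measure)
      show "\<alpha> \<le> \<kappa>" using sum by (subst le_measure) (auto simp: assms sets_\<alpha>)
    qed (simp add: assms sets_\<alpha>)
    finally show "ennreal (1 / real (Suc n)) * (\<integral>\<^sup>+x. f x * indicator (E n) x \<partial>lborel) \<le> (\<integral>\<^sup>+x. f x \<partial>\<kappa>)" .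
  qed
  then show ?thesis using n by (intro that[of "1 / real (Suc n)" "E n" "real n"]) (auto simp: E_def)
qed

text \<open>A weak form of the Lebesgue density theorem. Cover \<open>E\<close> by non-overlapping intervals inside
  an open set of measure at most \<open>5/4 \<bar>E\<bar>\<close>. If \<open>E\<close> filled less than three quarters of each of
  them, its measure would be at most \<open>15/16 \<bar>E\<bar>\<close>.\<close>
lemma exists_dense_interval:
  assumes [measurable]: "E \<in> sets borel" and E: "E \<subseteq> {-r..r}" "0 < emeasure lborel E"
  obtains a b :: real where "a < b" "ennreal (3/4 * (b - a)) \<le> emeasure lborel (E \<inter> {a..b})"
proof -
  have r: "0 < r"
  proof (rule ccontr)
    assume "\<not> 0 < r"
    then have "emeasure lborel {-r..r} = 0" by (cases "r = 0") auto
    then show False using E emeasure_mono[OF E(1), of lborel] by simp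
  qed
  define v where "v = measure lborel E"
  have fin: "emeasure lborel E < \<infinity>"
    using emeasure_mono[OF E(1), of lborel] r by (auto intro: le_less_trans)
  have v: "emeasure lborel E = ennreal v" 
    unfolding v_def using fin by (subst emeasure_eq_ennreal_measure) auto
  have "0 < v" using E(2) v by simp
  then have v4: "0 < v / 4" by simp
  obtain U where U: "open U" "E \<subseteq> U" "emeasure lborel (U - E) < ennreal (v / 4)"
    by (rule outer_regular_lborel[OF assms(1) v4])
  have [measurable]: "U \<in> sets borel" using U(1) by simp
  have Ule: "emeasure lborel U \<le> ennreal (5/4 * v)"
  proof -
    have "emeasure lborel U = emeasure lborel E + emeasure lborel (U - E)"
      using U(2) by (subst plus_emeasure) (auto intro!: arg_cong[where f = "emeasure lborel"])
    also have "\<dots> \<le> ennreal v + ennreal (v / 4)" using U(3) v by (intro add_mono) auto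
    also have "\<dots> = ennreal (5/4 * v)" using \<open>0 < v\<close> by (subst ennreal_plus[symmetric]) auto
    finally show ?thesis .
  qed
  have "\<forall>x. \<exists>e>0. x \<in> U \<longrightarrow> ball x e \<subseteq> U" 
  proof
    fix x show "\<exists>e>0. x \<in> U \<longrightarrow> ball x e \<subseteq> U"
    proof (cases "x \<in> U")
      case True
      then show ?thesis using U(1) unfolding open_contains_ball by blast
    qed (intro exI[of _ 1], simp)
  qed
  from choice[OF this] obtain e where e: "\<And>x. 0 < e x" "\<And>x. x \<in> U \<Longrightarrow> ball x (e x) \<subseteq> U" by blast
  have "gauge (\<lambda>x. ball x (e x))" using e(1) by (simp add: gauge_def)
  have box: "E \<subseteq> cbox (-r) r" "box (-r) r \<noteq> {}" using E(1) r by auto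
  obtain \<D> where D0: "countable \<D>" "\<Union>\<D> \<subseteq> cbox (-r) r"
    "\<And>K. K \<in> \<D> \<Longrightarrow> interior K \<noteq> {} \<and> (\<exists>c d. K = cbox c d)"
    "pairwise (\<lambda>A B. interior A \<inter> interior B = {}) \<D>"
    "\<And>K. K \<in> \<D> \<Longrightarrow> \<exists>x\<in>E \<inter> K. K \<subseteq> ball x (e x)"
    "\<And>u v. cbox u v \<in> \<D> \<Longrightarrow> \<exists>n. \<forall>i \<in> Basis. v \<bullet> i - u \<bullet> i = (r \<bullet> i - (-r) \<bullet> i) / 2^n"
    "E \<subseteq> \<Union>\<D>"
    by (rule covering_lemma[OF box \<open>gauge _\<close>]) (rule that)
  note D = D0(1,3,4,5,7)
  have disj: "disjoint_family_on interior \<D>"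
    using D(3) by (auto simp: disjoint_family_on_def pairwise_def)
  then have disjE: "disjoint_family_on (\<lambda>K. E \<inter> interior K) \<D>"
    by (auto simp: disjoint_family_on_def)
  have inU: "(\<Union>K\<in>\<D>. interior K) \<subseteq> U"
  proof safe
    fix x K assume x: "x \<in> interior K" and K: "K \<in> \<D>"
    obtain y where "y \<in> E" "K \<subseteq> ball y (e y)" using D(4)[OF K] by blast
    moreover have "x \<in> K" using x interior_subset by blast
    ultimately show "x \<in> U" using U(2) e(2)[of y] by blast
  qed
  note witness = that
  show ?thesis
  proof (rule ccontr)
    assume no: "\<not> thesis"
    have small: "emeasure lborel (E \<inter> interior K) \<le> ennreal (3/4) * emeasure lborel (interior K)"
      if K: "K \<in> \<D>" for K
    proof -
      obtain a b where ab: "K = {a..b}" using D(2)[OF K] by (auto simp: cbox_interval)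
      have "a < b" using D(2)[OF K] ab by (auto simp: interior_atLeastAtMost_real)
      then have "emeasure lborel (E \<inter> {a..b}) < ennreal (3/4 * (b - a))"
        using no witness[of a b] by (meson not_le)
      moreover have "emeasure lborel (E \<inter> interior K) \<le> emeasure lborel (E \<inter> {a..b})"
        unfolding ab by (intro emeasure_mono) (use interior_subset in auto)
      moreover have "ennreal (3/4) * emeasure lborel (interior K) = ennreal (3/4 * (b - a))"
        using \<open>a < b\<close> by (simp add: ab interior_atLeastAtMost_real ennreal_mult[symmetric])
      ultimately show ?thesis by simp
    qed
    have "(\<Union>K\<in>\<D>. K - interior K) \<in> null_sets lborel"
    proof (intro null_sets_UN' D(1))
      fix K assume K: "K \<in> \<D>"
      obtain a b where ab: "K = {a..b}" using D(2)[OF K] by (auto simp: cbox_interval)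
      have "K - interior K \<subseteq> {a, b}" by (auto simp: ab interior_atLeastAtMost_real)
      then show "K - interior K \<in> null_sets lborel"
        by (intro countable_imp_null_set_lborel countable_finite) (rule finite_subset, auto)
    qed
    then have "AE x in lborel. x \<notin> (\<Union>K\<in>\<D>. K - interior K)" by (rule AE_not_in)
    then have "emeasure lborel E \<le> emeasure lborel (\<Union>K\<in>\<D>. E \<inter> interior K)"
    proof (intro emeasure_mono_AE)
      assume *: "AE x in lborel. x \<notin> (\<Union>K\<in>\<D>. K - interior K)"
      show "AE x in lborel. x \<in> E \<longrightarrow> x \<in> (\<Union>K\<in>\<D>. E \<inter> interior K)"
        by (rule eventually_mono[OF *]) (use D(5) in blast)
      show "(\<Union>K\<in>\<D>. E \<inter> interior K) \<in> sets lborel"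
        using D(1) by (intro sets.countable_UN') auto
    qed
    also have "\<dots> = (\<integral>\<^sup>+K. emeasure lborel (E \<inter> interior K) \<partial>count_space \<D>)"
      by (rule emeasure_UN_countable) (use D(1) disjE in auto)
    also have "\<dots> \<le> (\<integral>\<^sup>+K. ennreal (3/4) * emeasure lborel (interior K) \<partial>count_space \<D>)"
      using small by (intro nn_integral_mono) auto
    also have "\<dots> = ennreal (3/4) * (\<integral>\<^sup>+K. emeasure lborel (interior K) \<partial>count_space \<D>)"
      by (rule nn_integral_cmult) simp
    also have "(\<integral>\<^sup>+K. emeasure lborel (interior K) \<partial>count_space \<D>) = emeasure lborel (\<Union>K\<in>\<D>. interior K)"
      by (rule emeasure_UN_countable[symmetric]) (use D(1) disj in auto)
    also have "\<dots> \<le> emeasure lborel U" by (rule emeasure_mono[OF inU]) simp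
    also have "\<dots> \<le> ennreal (5/4 * v)" by (rule Ule)
    also have "ennreal (3/4) * ennreal (5/4 * v) = ennreal (15/16 * v)"
      using \<open>0 < v\<close> by (subst ennreal_mult[symmetric]) auto
    finally show False using v \<open>0 < v\<close> by (simp add: mult_left_mono)
  qed
qed

text \<open>For \<open>w\<close> close to \<open>a + b\<close> both \<open>E\<close> and \<open>w - E\<close> fill three quarters of an interval of length
  \<open>b - a\<close>, and these two intervals almost coincide. So the convolution square of the restriction
  of Lebesgue measure to \<open>E\<close> has a density bounded below near \<open>a + b\<close>, as in the theorem of
  Steinhaus.\<close>
lemma self_overlap:
  assumes [measurable]: "E \<in> sets borel" and E: "E \<subseteq> {a..b}" "a < b"
    and dense: "ennreal (3/4 * (b - a)) \<le> emeasure lborel E"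
    and w: "w \<in> {a + b - (b - a) / 4 .. a + b + (b - a) / 4}"
  shows "ennreal ((b - a) / 4) \<le> emeasure lborel (E \<inter> {x. w - x \<in> E})"
proof -
  let ?F = "{x. w - x \<in> E}"
  have [measurable]: "?F \<in> sets borel" by measurable
  have F: "emeasure lborel ?F = emeasure lborel E"
  proof -
    have "emeasure lborel E = (\<integral>\<^sup>+x. indicator E x \<partial>lborel)" by simp
    also have "\<dots> = (\<integral>\<^sup>+x. indicator E (w + (-1) * x) \<partial>lborel)"
      by (subst nn_integral_real_affine[where c = "-1" and t = w]) auto
    also have "\<dots> = (\<integral>\<^sup>+x. indicator ?F x \<partial>lborel)"
      by (intro nn_integral_cong) (auto split: split_indicator)
    also have "\<dots> = emeasure lborel ?F" by (rule nn_integral_indicator) simp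
    finally show ?thesis by simp
  qed
  have "E \<union> ?F \<subseteq> {min a (w - b) .. max b (w - a)}" using E by force
  then have "emeasure lborel (E \<union> ?F) \<le> emeasure lborel {min a (w - b) .. max b (w - a)}"
    by (rule emeasure_mono) simp
  also have "\<dots> = ennreal (max b (w - a) - min a (w - b))"
    using E by (subst emeasure_lborel_Icc) (auto simp: min_def max_def)
  also have "\<dots> \<le> ennreal (5/4 * (b - a))"
    using w E by (intro ennreal_leI) (auto simp: min_def max_def field_simps)
  finally have U: "emeasure lborel (E \<union> ?F) \<le> ennreal (5/4 * (b - a))" .
  have "ennreal (3/2 * (b - a)) = ennreal (3/4 * (b - a)) + ennreal (3/4 * (b - a))"
    using E by (subst ennreal_plus[symmetric]) (auto simp: field_simps)
  also have "\<dots> \<le> emeasure lborel E + emeasure lborel ?F"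
    using dense F by (intro add_mono) auto
  also have "\<dots> = emeasure lborel (E \<union> ?F) + emeasure lborel (E \<inter> ?F)"
    by (rule emeasure_Un_Int) auto
  also have "\<dots> \<le> ennreal (5/4 * (b - a)) + emeasure lborel (E \<inter> ?F)"
    using U by (rule add_right_mono)
  finally have *: "ennreal (3/2 * (b - a)) \<le> ennreal (5/4 * (b - a)) + emeasure lborel (E \<inter> ?F)" .
  show ?thesis
  proof (cases "emeasure lborel (E \<inter> ?F)")
    case (real z)
    with * E have "ennreal (3/2 * (b - a)) \<le> ennreal (5/4 * (b - a) + z)"
      by (simp add: ennreal_plus)
    then have "3/2 * (b - a) \<le> 5/4 * (b - a) + z"
      using E real by (subst (asm) ennreal_le_iff) auto
    then show ?thesis using real E by (auto intro!: ennreal_leI simp: field_simps)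
  qed simp
qed

lemma minorized_mono:
  assumes "minorized c E \<kappa>" "E' \<subseteq> E"
  shows "minorized c E' \<kappa>"
  unfolding minorized_def
proof
  fix f :: "real \<Rightarrow> ennreal" assume f: "f \<in> borel_measurable borel"
  have "ennreal c * (\<integral>\<^sup>+x. f x * indicator E' x \<partial>lborel) \<le> ennreal c * (\<integral>\<^sup>+x. f x * indicator E x \<partial>lborel)"
    using assms(2) by (intro mult_left_mono nn_integral_mono) (auto split: split_indicator)
  also have "\<dots> \<le> (\<integral>\<^sup>+x. f x \<partial>\<kappa>)" by (rule minorizedD[OF assms(1) f])
  finally show "ennreal c * (\<integral>\<^sup>+x. f x * indicator E' x \<partial>lborel) \<le> (\<integral>\<^sup>+x. f x \<partial>\<kappa>)" .
qed

lemma interval_overlap: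
  fixes \<alpha> \<beta> l k w :: real
  assumes "0 < l" "l \<le> k" "w \<in> {\<alpha> + \<beta> + l / 4 .. \<alpha> + \<beta> + k + 3 * l / 4}"
  shows "ennreal (l / 4) \<le> emeasure lborel ({\<alpha>..\<alpha> + k} \<inter> {x. w - x \<in> {\<beta>..\<beta> + l}})"
proof -
  have "{\<alpha>..\<alpha> + k} \<inter> {x. w - x \<in> {\<beta>..\<beta> + l}} = {max \<alpha> (w - \<beta> - l) .. min (\<alpha> + k) (w - \<beta>)}"
    by auto
  moreover have "max \<alpha> (w - \<beta> - l) + l / 4 \<le> min (\<alpha> + k) (w - \<beta>)"
    using assms by (auto simp: min_def max_def)
  ultimately show ?thesis using assms(1)
    by (simp del: min.bounded_iff max.bounded_iff)
qed

text \<open>Convolving with a fixed minorizing interval of length \<open>l\<close> lengthens a minorizing interval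
  by \<open>l / 2\<close>, at the price of a smaller constant; hence some convolution power minorizes
  Lebesgue measure on an interval of any prescribed length.\<close>
lemma spread_out_minorized:
  assumes \<mu>: "real_distribution \<mu>" and "spread_out \<mu>"
  obtains N c \<alpha> where "0 < c" "minorized c {\<alpha>..\<alpha> + L} (conv_power \<mu> N)"
proof -
  obtain n where "has_nontrivial_ac_component (conv_power \<mu> n)"
    using assms(2) by (auto simp: spread_out_def)
  interpret n: real_distribution "conv_power \<mu> n" by (rule conv_power_prob[OF \<mu>])
  obtain c E r where E: "0 < c" "E \<in> sets borel" "E \<subseteq> {-r..r}" "0 < emeasure lborel E"
    "minorized c E (conv_power \<mu> n)"
    by (rule ac_component_minorized[OF \<open>has_nontrivial_ac_component _\<close> n.events_eq_borel])
  obtain a b where ab: "a < b" "ennreal (3/4 * (b - a)) \<le> emeasure lborel (E \<inter> {a..b})"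
    using exists_dense_interval[OF E(2-4)] .
  define l where "l = (b - a) / 2"
  define \<beta> where "\<beta> = a + b - (b - a) / 4"
  have bl: "\<beta> + l = a + b + (b - a) / 4" by (simp add: \<beta>_def l_def field_simps)
  have l: "0 < l" using ab by (simp add: l_def)
  have "minorized c (E \<inter> {a..b}) (conv_power \<mu> n)" by (rule minorized_mono[OF E(5)]) simp
  then have "minorized (c * c * ((b - a) / 4)) {a + b - (b - a) / 4 .. a + b + (b - a) / 4}
      (conv_power \<mu> n \<star> conv_power \<mu> n)"
    using E(1,2) ab n.finite_measure_axioms
    by (intro minorized_convolution[where E = "E \<inter> {a..b}" and E' = "E \<inter> {a..b}"] self_overlap[of _ a b]) simp_all
  then have base': "minorized (c * c * ((b - a) / 4)) {\<beta> .. \<beta> + l} (conv_power \<mu> (n + n))"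
    unfolding conv_power_add[OF \<mu>] bl by (simp add: \<beta>_def)
  define c' where "c' = c * c * ((b - a) / 4)"
  define N where "N = n + n"
  have c': "0 < c'" using E ab by (simp add: c'_def)
  have base: "minorized c' {\<beta> .. \<beta> + l} (conv_power \<mu> N)" using base' by (simp add: N_def c'_def)
  interpret N: real_distribution "conv_power \<mu> N" by (rule conv_power_prob[OF \<mu>])
  have "\<exists>\<gamma> d. 0 < d \<and> minorized d {\<gamma> .. \<gamma> + (l + real k * (l / 2))} (conv_power \<mu> (Suc k * N))" for k
  proof (induction k)
    case 0
    show ?case using base c' by (intro exI[of _ \<beta>] exI[of _ c']) simp
  next
    case (Suc k)
    then obtain \<gamma> d where d: "0 < d" "minorized d {\<gamma> .. \<gamma> + (l + real k * (l / 2))} (conv_power \<mu> (Suc k * N))"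
      by blast
    interpret k: real_distribution "conv_power \<mu> (Suc k * N)" by (rule conv_power_prob[OF \<mu>])
    have "minorized (d * c' * (l / 4))
      {\<gamma> + \<beta> + l / 4 .. \<gamma> + \<beta> + (l + real k * (l / 2)) + 3 * l / 4}
      (conv_power \<mu> (Suc k * N) \<star> conv_power \<mu> N)"
      using d base c' l k.finite_measure_axioms N.finite_measure_axioms
      by (intro minorized_convolution[where E' = "{\<beta> .. \<beta> + l}" and E = "{\<gamma> .. \<gamma> + (l + real k * (l / 2))}"]
          interval_overlap n.events_eq_borel k.events_eq_borel) (simp_all del: conv_power.simps mult_Suc)
    moreover have "\<gamma> + \<beta> + (l + real k * (l / 2)) + 3 * l / 4 = (\<gamma> + \<beta> + l / 4) + (l + real (Suc k) * (l / 2))"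
      by (simp add: field_simps)
    moreover have "(conv_power \<mu> (Suc k * N) \<star> conv_power \<mu> N) = conv_power \<mu> (Suc (Suc k) * N)"
      unfolding conv_power_add[OF \<mu>, symmetric] by (rule arg_cong[where f = "conv_power \<mu>"]) simp
    ultimately have "minorized (d * c' * (l / 4))
      {\<gamma> + \<beta> + l / 4 .. (\<gamma> + \<beta> + l / 4) + (l + real (Suc k) * (l / 2))} (conv_power \<mu> (Suc (Suc k) * N))"
      by (simp only:)
    moreover have "0 < d * c' * (l / 4)" using d c' l by simp
    ultimately show ?case by blast
  qed note grow = this
  obtain k where k: "L < real k * (l / 2)" using ex_less_of_nat_mult[of "l / 2" L] l by auto
  obtain \<gamma> d where "0 < d" "minorized d {\<gamma> .. \<gamma> + (l + real k * (l / 2))} (conv_power \<mu> (Suc k * N))"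
    using grow by blast
  note gd = this
  have "minorized d {\<gamma> .. \<gamma> + L} (conv_power \<mu> (Suc k * N))"
    by (rule minorized_mono[OF gd(2)]) (use k l in auto)
  then show ?thesis using \<open>0 < d\<close> by (rule that[rotated])
qed

section \<open>Coupling on overlapping intervals\<close>

lemma minorized_integral:
  fixes F :: "real \<Rightarrow> real"
  assumes min: "minorized c J \<kappa>" "0 \<le> c" and J: "J \<in> sets borel" "J \<subseteq> {0..}"
    and F: "F \<in> borel_measurable borel" "\<And>s. 0 \<le> s \<Longrightarrow> 0 \<le> F s"
    and \<kappa>: "sets \<kappa> = sets borel" "AE s in \<kappa>. 0 \<le> s"
    and int: "integrable \<kappa> F" "integrable lborel (\<lambda>s. indicator J s * F s)"
  shows "c * (LINT s|lborel. indicator J s * F s) \<le> (LINT s|\<kappa>. F s)"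
proof -
  have FJ: "0 \<le> indicator J s * F s" for s using F(2) J(2) by (auto split: split_indicator)
  have F\<kappa>: "0 \<le> (LINT s|\<kappa>. F s)"
    by (rule integral_nonneg_AE, rule eventually_mono[OF \<kappa>(2)]) (rule F(2))
  have "ennreal (c * (LINT s|lborel. indicator J s * F s))
      = ennreal c * (\<integral>\<^sup>+s. ennreal (indicator J s * F s) \<partial>lborel)"
    using int(2) FJ min(2) by (subst nn_integral_eq_integral) (auto simp: ennreal_mult integral_nonneg_AE)
  also have "\<dots> = ennreal c * (\<integral>\<^sup>+s. ennreal (F s) * indicator J s \<partial>lborel)"
    by (intro arg_cong2[where f = times] refl nn_integral_cong) (auto split: split_indicator)
  also have "\<dots> \<le> (\<integral>\<^sup>+s. ennreal (F s) \<partial>\<kappa>)"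
    by (rule minorizedD[OF min(1)]) (use F(1) in measurable)
  also have "\<dots> = ennreal (LINT s|\<kappa>. F s)"
    by (rule nn_integral_eq_integral[OF int(1)], rule eventually_mono[OF \<kappa>(2)]) (rule F(2))
  finally show ?thesis using F\<kappa> by simp
qed

text \<open>Since \<open>z + q - f\<close> is nonnegative on the half-line, its integral against \<open>\<kappa>\<close> is at least
  \<open>c\<close> times its integral over the interval.\<close>
lemma minorized_separation:
  fixes f q :: "real \<Rightarrow> real" and z c :: real
  assumes \<kappa>: "prob_space \<kappa>" "sets \<kappa> = sets borel" "AE s in \<kappa>. 0 \<le> s"
    and c: "0 \<le> c" and min: "minorized c {a..a + 1} \<kappa>" "0 \<le> a"
    and int: "integrable \<kappa> f" "integrable \<kappa> q"
    and intJ: "integrable lborel (\<lambda>s. indicator {a..a + 1} s * f s)"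
      "integrable lborel (\<lambda>s. indicator {a..a + 1} s * q s)"
    and q: "\<And>s. 0 \<le> s \<Longrightarrow> 0 \<le> q s" and z: "\<And>s. 0 \<le> s \<Longrightarrow> f s - q s \<le> z"
  shows "c * (z - (LINT s|lborel. indicator {a..a + 1} s * f s)) \<le> z + (LINT s|\<kappa>. q s) - (LINT s|\<kappa>. f s)"
proof -
  interpret prob_space \<kappa> by fact
  let ?J = "\<lambda>g. LINT s|lborel. indicator {a..a + 1} s * g s"
  have meas: "f \<in> borel_measurable borel" "q \<in> borel_measurable borel"
    using int[THEN borel_measurable_integrable] \<kappa>(2) by (simp_all cong: measurable_cong_sets)
  have ind: "integrable lborel (\<lambda>s. indicator {a..a + 1} s * z)" "?J (\<lambda>_. z) = z" by simp_all
  have eq: "(\<lambda>s. indicator {a..a + 1} s * (z + q s - f s))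
    = (\<lambda>s. indicator {a..a + 1} s * z + indicator {a..a + 1} s * q s - indicator {a..a + 1} s * f s)"
    by (auto simp: algebra_simps)
  have "c * ?J (\<lambda>s. z + q s - f s) \<le> (LINT s|\<kappa>. z + q s - f s)"
    using min c \<kappa> int intJ ind z meas
    by (intro minorized_integral) (auto simp: eq algebra_simps simp del: integrable_indicator_iff)
  also have "(LINT s|\<kappa>. z + q s - f s) = z + (LINT s|\<kappa>. q s) - (LINT s|\<kappa>. f s)"
    using int by (simp add: prob_space)
  also have "?J (\<lambda>s. z + q s - f s) = z + ?J q - ?J f"
    unfolding eq using intJ ind
    by (subst Bochner_Integration.integral_diff) (auto simp: Bochner_Integration.integral_add)
  finally have *: "c * (z + ?J q - ?J f) \<le> z + (LINT s|\<kappa>. q s) - (LINT s|\<kappa>. f s)" .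
  have "0 \<le> ?J q"
    using min(2) q by (auto intro!: integral_nonneg_AE split: split_indicator)
  then have "c * (z - ?J f) \<le> c * (z + ?J q - ?J f)" using c by (intro mult_left_mono) auto
  with * show ?thesis by linarith
qed

text \<open>The coupling inequality. Two copies of \<open>\<kappa>\<close> share the mass \<open>c\<close> carried by two unit
  intervals on which \<open>f\<close> and \<open>g\<close> are translates of each other, and that mass contributes nothing
  to the difference of the integrals. On the remaining mass \<open>1 - c\<close> only the assumed bound is
  available. No coupling is constructed: since the bound is separable in the two arguments, a
  single constant \<open>z\<close> separates \<open>f - q1\<close> from \<open>W + q2 + g\<close>, and \<open>minorized_separation\<close> is
  applied on either side of it.\<close>
lemma coupled_difference:
  fixes f g q1 q2 :: "real \<Rightarrow> real" and W c :: real
  assumes \<kappa>: "prob_space \<kappa>" "sets \<kappa> = sets borel" "AE s in \<kappa>. 0 \<le> s"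
    and c: "0 \<le> c"
    and m1: "minorized c {a1..a1 + 1} \<kappa>" "0 \<le> a1"
    and m2: "minorized c {a2..a2 + 1} \<kappa>" "0 \<le> a2"
    and int: "integrable \<kappa> f" "integrable \<kappa> g" "integrable \<kappa> q1" "integrable \<kappa> q2"
    and intJ: "integrable lborel (\<lambda>s. indicator {a1..a1 + 1} s * f s)"
      "integrable lborel (\<lambda>s. indicator {a2..a2 + 1} s * g s)"
      "integrable lborel (\<lambda>s. indicator {a1..a1 + 1} s * q1 s)"
      "integrable lborel (\<lambda>s. indicator {a2..a2 + 1} s * q2 s)"
    and q: "\<And>s. 0 \<le> s \<Longrightarrow> 0 \<le> q1 s" "\<And>s. 0 \<le> s \<Longrightarrow> 0 \<le> q2 s"
    and le: "\<And>s s'. 0 \<le> s \<Longrightarrow> 0 \<le> s' \<Longrightarrow> f s - g s' \<le> W + q1 s + q2 s'"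
    and same: "(LINT s|lborel. indicator {a1..a1 + 1} s * f s) = (LINT s|lborel. indicator {a2..a2 + 1} s * g s)"
  shows "(LINT s|\<kappa>. f s) - (LINT s|\<kappa>. g s) \<le> (1 - c) * W + (LINT s|\<kappa>. q1 s) + (LINT s|\<kappa>. q2 s)"
proof -
  define z where "z = (SUP s\<in>{0..}. f s - q1 s)"
  have bdd: "bdd_above ((\<lambda>s. f s - q1 s) ` {0..})"
    by (rule bdd_aboveI2[where M = "W + q2 0 + g 0"]) (use le[of _ 0] in \<open>auto simp: algebra_simps\<close>)
  have z1: "f s - q1 s \<le> z" if "0 \<le> s" for s
    unfolding z_def using that bdd by (intro cSUP_upper) auto
  have z2: "z \<le> W + q2 s + g s" if "0 \<le> s" for s
    unfolding z_def using le[OF _ that] by (intro cSUP_least) (auto simp: algebra_simps)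
  have A: "c * (z - (LINT s|lborel. indicator {a1..a1 + 1} s * f s)) \<le> z + (LINT s|\<kappa>. q1 s) - (LINT s|\<kappa>. f s)"
    by (rule minorized_separation[OF \<kappa> c m1 int(1,3) intJ(1,3) q(1) z1])
  have "c * ((W - z) - (LINT s|lborel. indicator {a2..a2 + 1} s * - g s))
      \<le> (W - z) + (LINT s|\<kappa>. q2 s) - (LINT s|\<kappa>. - g s)"
    using int(2) intJ(2) z2 by (intro minorized_separation[OF \<kappa> c m2 _ int(4) _ intJ(4) q(2)]) (auto simp: algebra_simps)
  then have B: "c * (W - z + (LINT s|lborel. indicator {a2..a2 + 1} s * g s)) \<le> W - z + (LINT s|\<kappa>. q2 s) + (LINT s|\<kappa>. g s)"
    by simp
  show ?thesis using A B same by (simp add: algebra_simps)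
qed

lemma AE_convolution_nonneg:
  fixes \<kappa> \<kappa>' :: "real measure"
  assumes "finite_measure \<kappa>" "finite_measure \<kappa>'" "sets \<kappa> = sets borel" "sets \<kappa>' = sets borel"
    and nn: "AE s in \<kappa>. 0 \<le> s" "AE s in \<kappa>'. 0 \<le> s"
  shows "AE s in (\<kappa> \<star> \<kappa>'). 0 \<le> s"
proof -
  have "emeasure (\<kappa> \<star> \<kappa>') {..<0} = (\<integral>\<^sup>+u. \<integral>\<^sup>+v. indicator {..<0} (u + v) \<partial>\<kappa>' \<partial>\<kappa>)"
    using assms by (simp add: convolution_emeasure')
  also have "\<dots> = (\<integral>\<^sup>+u. 0 \<partial>\<kappa>)"
  proof (rule nn_integral_cong_AE, rule eventually_mono[OF nn(1)])
    fix u :: real assume u: "0 \<le> u"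
    have "(\<integral>\<^sup>+v. indicator {..<0} (u + v) \<partial>\<kappa>') = (\<integral>\<^sup>+v. 0 \<partial>\<kappa>')"
      by (rule nn_integral_cong_AE, rule eventually_mono[OF nn(2)]) (use u in auto)
    then show "(\<integral>\<^sup>+v. indicator {..<0::real} (u + v) \<partial>\<kappa>') = (0::ennreal)" by simp
  qed
  finally have "{..<0} \<in> null_sets (\<kappa> \<star> \<kappa>')" by (simp add: null_sets_def)
  from AE_not_in[OF this] show ?thesis by (rule eventually_mono) auto
qed

lemma integral_convolution:
  fixes f :: "real \<Rightarrow> real"
  assumes "finite_measure \<kappa>" "finite_measure \<kappa>'" "sets \<kappa> = sets borel" "sets \<kappa>' = sets borel"
    and int: "integrable (\<kappa> \<star> \<kappa>') f"
  shows "(LINT s|(\<kappa> \<star> \<kappa>'). f s) = (LINT u|\<kappa>. LINT v|\<kappa>'. f (u + v))"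
proof -
  interpret \<kappa>: finite_measure \<kappa> by fact
  interpret \<kappa>': finite_measure \<kappa>' by fact
  interpret p: pair_sigma_finite \<kappa> \<kappa>' ..
  note [measurable_cong] = assms(3,4)
  have [measurable]: "f \<in> borel_measurable borel" using borel_measurable_integrable[OF int] by simp
  have "integrable (\<kappa> \<Otimes>\<^sub>M \<kappa>') (\<lambda>(u, v). f (u + v))"
    using int by (simp add: convolution_def integrable_distr_eq case_prod_unfold)
  from p.integral_fst'[OF this] show ?thesis
    by (simp add: convolution_def integral_distr case_prod_unfold)
qed

lemma exp_dominated_integrable_nonneg:
  assumes "real_distribution \<kappa>" "AE s in \<kappa>. 0 \<le> s" "exp_dominated C f"
  shows "integrable \<kappa> (\<lambda>s. f (x + s))"
proof -
  interpret real_distribution \<kappa> by fact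
  note [measurable] = exp_dominated_measurable[OF assms(3)]
  show ?thesis
  proof (rule integrable_const_bound[where B = "C * exp (- x)"])
    show "AE s in \<kappa>. norm (f (x + s)) \<le> C * exp (- x)"
      by (rule eventually_mono[OF assms(2)]) (use exp_dominated_add_le[OF assms(3)] in simp)
  qed measurable
qed

context positive_law
begin

lemma conv_power_distribution: "real_distribution (conv_power \<mu> n)"
  by (rule conv_power_prob) (rule real_distribution_axioms)

lemma AE_conv_power_nonneg: "AE s in conv_power \<mu> n. 0 \<le> s"
proof (induction n)
  case 0
  show ?case unfolding conv_power.simps by (subst AE_return) auto
next
  case (Suc n)
  interpret n: real_distribution "conv_power \<mu> n" by (rule conv_power_distribution)
  have "AE s in \<mu>. 0 \<le> s" by (rule eventually_mono[OF pos]) simp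
  then show ?case using Suc unfolding conv_power.simps
    by (intro AE_convolution_nonneg) (simp_all add: n.finite_measure_axioms finite_measure_axioms)
qed

lemma exp_dominated_integrable_conv_power:
  assumes "exp_dominated C f"
  shows "integrable (conv_power \<mu> n) (\<lambda>s. f (x + s))"
  by (rule exp_dominated_integrable_nonneg[OF conv_power_distribution AE_conv_power_nonneg assms])

text \<open>Iterating \<open>step\<close> is the same as averaging over a convolution power of \<open>\<mu>\<close>; the former is
  suited to the renewal equation, the latter to the minorization.\<close>
lemma step_power_conv_power:
  assumes "exp_dominated C f"
  shows "(step ^^ n) f x = (LINT s|conv_power \<mu> n. f (x + s))"
proof (induction n arbitrary: x)
  case 0
  note [measurable] = exp_dominated_measurable[OF assms]
  show ?case by (simp add: integral_return)
next
  case (Suc n)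
  interpret n: real_distribution "conv_power \<mu> n" by (rule conv_power_distribution)
  have "(step ^^ Suc n) f x = (LINT u|\<mu>. LINT v|conv_power \<mu> n. f (x + (u + v)))"
    by (simp add: step_def Suc add.assoc)
  also have "\<dots> = (LINT s|conv_power \<mu> (Suc n). f (x + s))"
    using exp_dominated_integrable_conv_power[OF assms, of "Suc n" x] unfolding conv_power.simps
    by (intro integral_convolution[symmetric]) (simp_all add: n.finite_measure_axioms finite_measure_axioms)
  finally show ?case .
qed

end

locale square_integrable_law = positive_law +
  assumes integrable_square: "integrable \<mu> (\<lambda>s. s ^ 2)"
begin

lemma integrable_id: "integrable \<mu> (\<lambda>s. s)"
  using integrable_square by (rule square_integrable_imp_integrable[rotated]) simp

definition mean :: real where "mean = (LINT s|\<mu>. s)"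

definition second_moment :: real where "second_moment = (LINT s|\<mu>. s ^ 2)"

lemma mean_pos: "0 < mean"
proof -
  have "(LINT s|\<mu>. 0) < (LINT s|\<mu>. s)"
  proof (rule integral_less_AE_space)
    show "AE s in \<mu>. 0 < s" by (rule pos)
    show "emeasure \<mu> (space \<mu>) \<noteq> 0" by (subst emeasure_space_1) simp
  qed (auto intro: integrable_id)
  then show ?thesis by (simp add: mean_def)
qed

lemma second_moment_nonneg: "0 \<le> second_moment"
  unfolding second_moment_def by (intro integral_nonneg_AE) auto

lemma conv_power_square_integrable: "integrable (conv_power \<mu> n) (\<lambda>s. s ^ 2)"
proof (induction n)
  case 0
  show ?case by (rule integrableI_bounded) (simp_all add: nn_integral_return)
next
  case (Suc n)
  interpret n: real_distribution "conv_power \<mu> n" by (rule conv_power_distribution)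
  interpret p: pair_prob_space \<mu> "conv_power \<mu> n" ..
  have "integrable (\<mu> \<Otimes>\<^sub>M conv_power \<mu> n) (\<lambda>(u, v). (u + v) ^ 2)"
  proof (rule Bochner_Integration.integrable_bound)
    show "integrable (\<mu> \<Otimes>\<^sub>M conv_power \<mu> n) (\<lambda>p. 2 * (fst p) ^ 2 + 2 * (snd p) ^ 2)"
    proof (intro Bochner_Integration.integrable_add integrable_mult_right)
      show "integrable (\<mu> \<Otimes>\<^sub>M conv_power \<mu> n) (\<lambda>p. (fst p) ^ 2)"
        by (rule p.Fubini_integrable) (use integrable_square in auto)
      show "integrable (\<mu> \<Otimes>\<^sub>M conv_power \<mu> n) (\<lambda>p. (snd p) ^ 2)"
        by (rule p.Fubini_integrable) (use Suc in auto)
    qed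
    show "(\<lambda>(u, v). (u + v)\<^sup>2) \<in> borel_measurable (\<mu> \<Otimes>\<^sub>M conv_power \<mu> n)" by measurable
    have "(u + v)\<^sup>2 \<le> 2 * u\<^sup>2 + 2 * v\<^sup>2" for u v :: real
      using sum_squares_bound[of u v] by (simp add: power2_sum)
    then show "AE p in \<mu> \<Otimes>\<^sub>M conv_power \<mu> n. norm (case p of (u, v) \<Rightarrow> (u + v)\<^sup>2) \<le> norm (2 * (fst p)\<^sup>2 + 2 * (snd p)\<^sup>2)"
      by (auto simp: abs_of_nonneg)
  qed
  then show ?case by (simp add: convolution_def integrable_distr_eq case_prod_unfold)
qed

lemma conv_power_integrable_id: "integrable (conv_power \<mu> n) (\<lambda>s. s)"
proof -
  interpret n: real_distribution "conv_power \<mu> n" by (rule conv_power_distribution)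
  show ?thesis
    using conv_power_square_integrable by (rule n.square_integrable_imp_integrable[rotated]) simp
qed

lemma step_power_linear_bound:
  assumes "exp_dominated C f" "\<And>u. 0 \<le> u \<Longrightarrow> \<bar>f u\<bar> \<le> 1 + u" "0 \<le> x"
  shows "\<bar>(step ^^ n) f x\<bar> \<le> 1 + x + real n * mean"
  using assms(3)
proof (induction n arbitrary: x)
  case 0
  then show ?case using assms(2) by simp
next
  case (Suc n)
  have "\<bar>(step ^^ Suc n) f x\<bar> = \<bar>LINT s|\<mu>. (step ^^ n) f (x + s)\<bar>"
    by (simp add: step_def)
  also have "\<dots> \<le> (LINT s|\<mu>. (1 + x + real n * mean) + s)"
  proof (rule abs_integral_le)
    show "integrable \<mu> (\<lambda>s. 1 + x + real n * mean + s)" using integrable_id by simp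
    show "AE s in \<mu>. \<bar>(step ^^ n) f (x + s)\<bar> \<le> 1 + x + real n * mean + s"
    proof (rule eventually_mono[OF pos])
      fix s :: real assume "0 < s"
      then show "\<bar>(step ^^ n) f (x + s)\<bar> \<le> 1 + x + real n * mean + s"
        using Suc.IH[of "x + s"] Suc.prems by simp
    qed
  qed
  also have "\<dots> = 1 + x + real (Suc n) * mean"
    using integrable_id by (simp add: prob_space[simplified] mean_def[symmetric] algebra_simps)
  finally show ?case .
qed

end

section \<open>The oscillation of a potential\<close>

context square_integrable_law
begin

lemma integral_excess_le:
  assumes "0 < d"
  shows "(LINT s|\<mu>. max (s - d) 0) \<le> second_moment / d"
proof -
  have "(LINT s|\<mu>. max (s - d) 0) \<le> (LINT s|\<mu>. s ^ 2 / d)"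
  proof (rule integral_mono)
    show "integrable \<mu> (\<lambda>s. max (s - d) 0)"
      using integrable_id by (intro integrable_max) auto
    show "integrable \<mu> (\<lambda>s. s ^ 2 / d)" using integrable_square by simp
    fix s
    show "max (s - d) 0 \<le> s ^ 2 / d"
    proof (cases "s \<le> d")
      case False
      then have "(s - d) * d \<le> s * s" using assms by (intro mult_mono) auto
      then show ?thesis using assms False by (simp add: field_simps power2_eq_square)
    qed (use assms in simp)
  qed
  then show ?thesis by (simp add: second_moment_def)
qed

text \<open>Drift of a Lyapunov function for two walkers at \<open>x\<close> and \<open>x + d\<close>, the lower one of which
  jumps. The jump lowers \<open>\<bar>q x - q (x + d)\<bar>\<close> by \<open>q (x + s) - q x\<close>, up to twice the overshoot
  beyond \<open>q (x + d)\<close>. The mean excess of \<open>s\<close> over \<open>d\<close> is at most a quarter of the mean jump if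
  \<open>d\<close> is large, so at least half of the decrease is kept: \<open>B * x * mean \<ge> x\<close> from the quadratic
  and \<open>B' * mean / 2\<close> from the linear part of \<open>q\<close>. The latter pays for the growth of \<open>A * min\<close>
  and for the terms \<open>B * s^2\<close>.\<close>
lemma quadratic_drift:
  fixes A B B' x d :: real
  defines "q \<equiv> \<lambda>u. B' * u + B * u ^ 2"
  assumes nn: "0 \<le> A" "0 \<le> B" "0 \<le> B'" "0 \<le> x" and d: "0 < d" "second_moment / d \<le> mean / 4"
    and B: "1 \<le> B * mean" and B': "A * mean + B * second_moment + 2 \<le> B' * mean / 2"
  shows "integrable \<mu> (\<lambda>s. A * min (x + s) (x + d) + \<bar>q (x + s) - q (x + d)\<bar>)" (is ?int)
    and "(LINT s|\<mu>. A * min (x + s) (x + d) + \<bar>q (x + s) - q (x + d)\<bar>)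
      \<le> A * x + \<bar>q x - q (x + d)\<bar> - (2 + x)" (is ?bound)
proof -
  define U where "U s = A * (x + s) + (q (x + d) - q x - B' * s - B * (2 * x * s + s ^ 2)
    + 2 * ((B' + 2 * B * x) * max (s - d) 0 + B * s ^ 2))" for s
  have q_mono: "q u \<le> q v" if "0 \<le> u" "u \<le> v" for u v
    unfolding q_def using that nn by (intro add_mono mult_left_mono power_mono) auto
  have pos_part: "max (q (x + s) - q (x + d)) 0 \<le> (B' + 2 * B * x) * max (s - d) 0 + B * s ^ 2" if s: "0 \<le> s" for s
  proof (cases "s \<le> d")
    case True
    then have "q (x + s) \<le> q (x + d)" using s nn by (intro q_mono) auto
    then show ?thesis using True nn by simp
  next
    case False
    have "q (x + s) - q (x + d) = (B' + 2 * B * x) * (s - d) + B * (s ^ 2 - d ^ 2)"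
      by (simp add: q_def algebra_simps power2_eq_square)
    also have "\<dots> \<le> (B' + 2 * B * x) * (s - d) + B * s ^ 2"
      using nn by (intro add_left_mono mult_left_mono) auto
    finally show ?thesis using False nn by simp
  qed
  have le_U: "A * min (x + s) (x + d) + \<bar>q (x + s) - q (x + d)\<bar> \<le> U s" if s: "0 \<le> s" for s
  proof -
    have qs: "q (x + s) = q x + B' * s + B * (2 * x * s + s ^ 2)"
      by (simp add: q_def algebra_simps power2_eq_square)
    have "\<bar>q (x + s) - q (x + d)\<bar> = q (x + d) - q (x + s) + 2 * max (q (x + s) - q (x + d)) 0"
      by (auto simp: max_def)
    also have "\<dots> \<le> q (x + d) - q (x + s) + 2 * ((B' + 2 * B * x) * max (s - d) 0 + B * s ^ 2)"
      by (intro add_left_mono mult_left_mono pos_part[OF s]) simp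
    finally have "\<bar>q (x + s) - q (x + d)\<bar> \<le> q (x + d) - (q x + B' * s + B * (2 * x * s + s ^ 2))
        + 2 * ((B' + 2 * B * x) * max (s - d) 0 + B * s ^ 2)"
      by (simp only: qs)
    moreover have "A * min (x + s) (x + d) \<le> A * (x + s)" using nn by (intro mult_left_mono) auto
    ultimately show ?thesis unfolding U_def by linarith
  qed
  have imax: "integrable \<mu> (\<lambda>s. max (s - d) 0)"
    using integrable_id by (intro integrable_max) auto
  have U_eq: "U = (\<lambda>s. (A * x + q (x + d) - q x) + (A - B' - 2 * B * x) * s + B * s ^ 2
      + (2 * (B' + 2 * B * x)) * max (s - d) 0)"
    by (rule ext) (simp add: U_def algebra_simps)
  have intU: "integrable \<mu> U"
    unfolding U_eq using integrable_id integrable_square imax by simp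
  show int: ?int
  proof (rule Bochner_Integration.integrable_bound[OF intU])
    show "AE s in \<mu>. norm (A * min (x + s) (x + d) + \<bar>q (x + s) - q (x + d)\<bar>) \<le> norm (U s)"
    proof (rule eventually_mono[OF pos])
      fix s :: real assume "0 < s"
      moreover have "0 \<le> A * min (x + s) (x + d)" using nn d \<open>0 < s\<close> by simp
      ultimately show "norm (A * min (x + s) (x + d) + \<bar>q (x + s) - q (x + d)\<bar>) \<le> norm (U s)"
        using le_U[of s] by simp
    qed
  qed (simp add: q_def)
  have "(LINT s|\<mu>. A * min (x + s) (x + d) + \<bar>q (x + s) - q (x + d)\<bar>) \<le> (LINT s|\<mu>. U s)"
  proof (rule integral_mono_AE[OF int intU])
    show "AE s in \<mu>. A * min (x + s) (x + d) + \<bar>q (x + s) - q (x + d)\<bar> \<le> U s"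
      by (rule eventually_mono[OF pos]) (rule le_U, simp)
  qed
  also have "(LINT s|\<mu>. U s) = (A * x + q (x + d) - q x) + (A - B' - 2 * B * x) * mean
      + B * second_moment + (2 * (B' + 2 * B * x)) * (LINT s|\<mu>. max (s - d) 0)"
    unfolding U_eq using integrable_id integrable_square imax
    by (simp add: mean_def second_moment_def prob_space[simplified])
  also have "\<dots> \<le> (A * x + q (x + d) - q x) + (A - B' - 2 * B * x) * mean
      + B * second_moment + (2 * (B' + 2 * B * x)) * (mean / 4)"
    using nn by (intro add_left_mono mult_left_mono order_trans[OF integral_excess_le[OF d(1)] d(2)]) auto
  also have "\<dots> = A * x + (q (x + d) - q x) + (A * mean + B * second_moment - B' * mean / 2) - x * (B * mean)"
    by (simp add: field_simps)
  also have "\<dots> \<le> A * x + (q (x + d) - q x) + (- 2) - x * 1"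
    using B B' nn by (intro diff_mono add_left_mono mult_left_mono) auto
  also have "q (x + d) - q x = \<bar>q x - q (x + d)\<bar>"
    using q_mono[of x "x + d"] nn d by simp
  finally show ?bound by simp
qed

end

locale spread_law = square_integrable_law +
  assumes spread: "spread_out \<mu>"
begin

text \<open>The left end \<open>\<alpha>\<close> is nonnegative because the convolution powers do not charge the negative
  half-line.\<close>
lemma minorized_unit_intervals:
  obtains N c \<alpha> where "0 < c" "0 \<le> \<alpha>"
    "\<And>a. \<alpha> \<le> a \<Longrightarrow> a \<le> \<alpha> + K \<Longrightarrow> minorized c {a..a + 1} (conv_power \<mu> N)"
proof -
  define L where "L = max K 0 + 1"
  obtain N c \<alpha> where c: "0 < c" and min: "minorized c {\<alpha>..\<alpha> + L} (conv_power \<mu> N)"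
    by (rule spread_out_minorized[OF real_distribution_axioms spread])
  have "0 \<le> \<alpha>"
  proof (rule ccontr)
    assume "\<not> 0 \<le> \<alpha>"
    have "(\<integral>\<^sup>+s. indicator {..<0} s \<partial>conv_power \<mu> N) = (\<integral>\<^sup>+s. 0 \<partial>conv_power \<mu> N)"
      by (rule nn_integral_cong_AE, rule eventually_mono[OF AE_conv_power_nonneg]) auto
    moreover have "ennreal c * (\<integral>\<^sup>+s. indicator {..<0} s * indicator {\<alpha>..\<alpha> + L} s \<partial>lborel)
        \<le> (\<integral>\<^sup>+s. indicator {..<0} s \<partial>conv_power \<mu> N)"
      by (rule minorizedD[OF min]) simp
    ultimately have "(\<integral>\<^sup>+s. indicator {..<0} s * indicator {\<alpha>..\<alpha> + L} s \<partial>lborel) = 0"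
      using c by simp
    moreover have "(\<integral>\<^sup>+s. indicator {\<alpha>..<min 0 (\<alpha> + L)} s \<partial>lborel)
        \<le> (\<integral>\<^sup>+s. indicator {..<0} s * indicator {\<alpha>..\<alpha> + L} s \<partial>lborel)"
      by (intro nn_integral_mono) (auto split: split_indicator)
    ultimately have "emeasure lborel {\<alpha>..<min 0 (\<alpha> + L)} = 0" by simp
    then show False using \<open>\<not> 0 \<le> \<alpha>\<close> by (auto simp: L_def min_def split: if_splits)
  qed
  moreover have "minorized c {a..a + 1} (conv_power \<mu> N)" if "\<alpha> \<le> a" "a \<le> \<alpha> + K" for a
    by (rule minorized_mono[OF min]) (use that in \<open>auto simp: L_def\<close>)
  ultimately show ?thesis using c by (intro that)
qed

end

context spread_law
begin

text \<open>The heart of the renewal part: the bound is uniform in \<open>f\<close>. Let \<open>h\<close> be the potential of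
  \<open>f\<close>. Suppose that \<open>\<bar>h x - h y\<bar> \<le> S + \<Phi> x y\<close> for all \<open>x\<close> and \<open>y\<close>, where \<open>\<Phi>\<close> is a fixed Lyapunov
  function. If \<open>x\<close> and \<open>y\<close> are farther apart than \<open>K\<close>, the renewal equation at the smaller point
  and the drift of \<open>\<Phi>\<close> improve \<open>S\<close> to \<open>S - 1\<close>. If they are closer, \<open>N\<close> steps and the coupling
  inequality improve \<open>S\<close> to \<open>(1 - c) * S\<close>. The supposition holds for some \<open>S\<close>, as \<open>h\<close> is bounded
  on the half-line, and iteration gives it for \<open>S = 0\<close>.\<close>
lemma potential_oscillation:
  "\<exists>R\<ge>0. \<forall>C f x. exp_dominated C f \<longrightarrow> (\<forall>u\<ge>0. \<bar>f u\<bar> \<le> 1 + u) \<longrightarrow> 0 \<le> x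
     \<longrightarrow> \<bar>potential f x - potential f 0\<bar> \<le> R * (1 + x ^ 2)"
proof -
  define K where "K = 4 * second_moment / mean + 1"
  have K: "0 < K" using mean_pos second_moment_nonneg by (simp add: K_def add_nonneg_pos)
  have far: "second_moment / d \<le> mean / 4" if "K \<le> d" for d
  proof -
    have "4 * second_moment / mean \<le> d" using that by (simp add: K_def)
    then show ?thesis using mean_pos K that by (simp add: field_simps)
  qed
  obtain N c \<alpha> where c: "0 < c" and \<alpha>: "0 \<le> \<alpha>"
    and unit: "\<And>a. \<alpha> \<le> a \<Longrightarrow> a \<le> \<alpha> + K \<Longrightarrow> minorized c {a..a + 1} (conv_power \<mu> N)"
    by (rule minorized_unit_intervals[of K]) (rule that)
  define \<kappa> where "\<kappa> = conv_power \<mu> N"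
  interpret \<kappa>: real_distribution \<kappa> unfolding \<kappa>_def by (rule conv_power_distribution)
  have \<kappa>_nonneg: "AE s in \<kappa>. 0 \<le> s" unfolding \<kappa>_def by (rule AE_conv_power_nonneg)
  have \<kappa>_int[simp]: "integrable \<kappa> (\<lambda>s. s)" "integrable \<kappa> (\<lambda>s. s ^ 2)"
    unfolding \<kappa>_def by (rule conv_power_integrable_id conv_power_square_integrable)+
  define Q1 where "Q1 = (LINT s|\<kappa>. s)"
  define Q2 where "Q2 = (LINT s|\<kappa>. s ^ 2)"
  have Q: "0 \<le> Q1" "0 \<le> Q2"
    unfolding Q1_def Q2_def using \<kappa>_nonneg by (auto intro!: integral_nonneg_AE)
  \<comment> \<open>The constants are chosen one after the other, each large in terms of the preceding
    ones: \<open>B\<close> for the drift of the quadratic term, \<open>A\<close> for the terms linear in \<open>x\<close> of the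
    coupling step, \<open>B'\<close> for the drift of the remaining terms, and \<open>A0\<close> for the constant terms
    of the coupling step.\<close>
  define B where "B = 1 / mean"
  define A where "A = (2 * real N + 2 * B * Q1 + 2 * B * (K + Q1)) / c"
  define B' where "B' = 2 * (A * mean + B * second_moment + 2) / mean"
  define A0 where "A0 = (real N * (2 + K + 2 * real N * mean) + (A + B') * Q1 + B * Q2
      + B' * (K + Q1) + B * (2 * K ^ 2 + 2 * Q2)) / c"
  define q where "q u = B' * u + B * u ^ 2" for u
  define \<Phi> where "\<Phi> x y = A0 + A * min x y + \<bar>q x - q y\<bar>" for x y
  have B: "0 \<le> B" "1 \<le> B * mean" using mean_pos by (simp_all add: B_def)
  have A: "0 \<le> A" unfolding A_def using B Q K c by (intro divide_nonneg_pos add_nonneg_nonneg mult_nonneg_nonneg) auto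
  have B': "0 \<le> B'" "A * mean + B * second_moment + 2 \<le> B' * mean / 2"
    unfolding B'_def using mean_pos second_moment_nonneg A B by simp_all
  have A0: "0 \<le> A0" unfolding A0_def using A B B' Q K c mean_pos
    by (intro divide_nonneg_pos add_nonneg_nonneg mult_nonneg_nonneg) auto
  have cA: "c * A = 2 * real N + 2 * B * Q1 + 2 * B * (K + Q1)" using c by (simp add: A_def)
  have cA0: "c * A0 = real N * (2 + K + 2 * real N * mean) + (A + B') * Q1 + B * Q2
      + B' * (K + Q1) + B * (2 * K ^ 2 + 2 * Q2)" using c by (simp add: A0_def)
  have \<Phi>_nonneg: "0 \<le> \<Phi> x y" if "0 \<le> x" "0 \<le> y" for x y
    unfolding \<Phi>_def using A0 A that by simp
  have osc: "\<bar>potential f x - potential f y\<bar> \<le> \<Phi> x y"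
    if f: "exp_dominated C f" and lin: "\<And>u. 0 \<le> u \<Longrightarrow> \<bar>f u\<bar> \<le> 1 + u" and xy: "0 \<le> x" "0 \<le> y" for C f x y
  proof -
    define h where "h = potential f"
    obtain D where h: "exp_dominated D h" using exp_dominated_potential[OF f] h_def by blast
    have [measurable]: "h \<in> borel_measurable borel" by (rule exp_dominated_measurable[OF h])
    define P where "P S \<longleftrightarrow> (\<forall>x\<ge>0. \<forall>y\<ge>0. \<bar>h x - h y\<bar> \<le> S + \<Phi> x y)" for S
    have P_mono: "P S'" if "P S" "S \<le> S'" for S S'
      using that unfolding P_def by (meson add_right_mono order_trans)
    have P_ordered: "P S" if "\<And>x d. 0 \<le> x \<Longrightarrow> 0 \<le> d \<Longrightarrow> \<bar>h x - h (x + d)\<bar> \<le> S + \<Phi> x (x + d)" for S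
      unfolding P_def
    proof (intro allI impI)
      fix x y :: real assume "0 \<le> x" "0 \<le> y"
      then show "\<bar>h x - h y\<bar> \<le> S + \<Phi> x y"
        using that[of x "y - x"] that[of y "x - y"]
        by (cases "x \<le> y") (simp_all add: \<Phi>_def min.commute abs_minus_commute)
    qed
    note h_le = exp_dominated_const_le[OF h]
    have P0: "P (2 * D)"
      unfolding P_def
    proof (intro allI impI)
      fix x y :: real assume "0 \<le> x" "0 \<le> y"
      then show "\<bar>h x - h y\<bar> \<le> 2 * D + \<Phi> x y" using h_le[of x] h_le[of y] \<Phi>_nonneg[of x y] by linarith
    qed
    have step_far: "\<bar>h x - h (x + d)\<bar> \<le> (S - 1) + \<Phi> x (x + d)"
      if S: "P S" and x: "0 \<le> x" and d: "K \<le> d" for S x d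
    proof -
      note ih = exp_dominated_integrable[OF h, of x]
      have "0 < d" using K d by simp
      note drift = quadratic_drift[OF A B(1) B'(1) x \<open>0 < d\<close> far[OF d] B(2) B'(2), folded q_def]
      have "h x - h (x + d) = f x + (LINT s|\<mu>. h (x + s) - h (x + d))"
        using potential_eq[OF f, of x] ih by (simp add: h_def step_def prob_space[simplified])
      then have "\<bar>h x - h (x + d)\<bar> \<le> \<bar>f x\<bar> + (LINT s|\<mu>. \<bar>h (x + s) - h (x + d)\<bar>)"
        using integral_abs_bound[of \<mu> "\<lambda>s. h (x + s) - h (x + d)"] by linarith
      also have "\<dots> \<le> (1 + x) + (LINT s|\<mu>. (S + A0) + (A * min (x + s) (x + d) + \<bar>q (x + s) - q (x + d)\<bar>))"
      proof (intro add_mono lin x integral_mono_AE)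
        show "integrable \<mu> (\<lambda>s. \<bar>h (x + s) - h (x + d)\<bar>)" using ih by simp
        show "integrable \<mu> (\<lambda>s. (S + A0) + (A * min (x + s) (x + d) + \<bar>q (x + s) - q (x + d)\<bar>))"
          using drift(1) by simp
        show "AE s in \<mu>. \<bar>h (x + s) - h (x + d)\<bar> \<le> (S + A0) + (A * min (x + s) (x + d) + \<bar>q (x + s) - q (x + d)\<bar>)"
        proof (rule eventually_mono[OF pos])
          fix s :: real assume "0 < s"
          then have "\<bar>h (x + s) - h (x + d)\<bar> \<le> S + \<Phi> (x + s) (x + d)"
            using S x \<open>0 < d\<close> unfolding P_def by simp
          then show "\<bar>h (x + s) - h (x + d)\<bar> \<le> (S + A0) + (A * min (x + s) (x + d) + \<bar>q (x + s) - q (x + d)\<bar>)"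
            by (simp add: \<Phi>_def)
        qed
      qed
      also have "(LINT s|\<mu>. (S + A0) + (A * min (x + s) (x + d) + \<bar>q (x + s) - q (x + d)\<bar>))
        = (S + A0) + (LINT s|\<mu>. A * min (x + s) (x + d) + \<bar>q (x + s) - q (x + d)\<bar>)"
        using drift(1) by (subst Bochner_Integration.integral_add) (auto simp: prob_space[simplified])
      finally show ?thesis using drift(2) \<open>0 < d\<close> by (simp add: \<Phi>_def)
    qed
    have step_near: "\<bar>h x - h (x + d)\<bar> \<le> (1 - c) * S + \<Phi> x (x + d)"
      if S: "P S" and x: "0 \<le> x" and d: "0 \<le> d" "d \<le> K" for S x d
    proof -
      \<comment> \<open>\<open>W + q1 s + q2 s'\<close> will bound \<open>S + \<Phi> (x + s) (x + d + s')\<close> and separates \<open>s\<close>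
        from \<open>s'\<close>.\<close>
      define W where "W = S + A0 + A * x"
      define q1 where "q1 s = A * s + B' * s + B * (2 * x * s + s ^ 2)" for s
      define q2 where "q2 s = B' * (K + s) + B * (2 * x * (K + s) + (2 * K ^ 2 + 2 * s ^ 2))" for s
      have q_nonneg: "0 \<le> q1 s" "0 \<le> q2 s" if "0 \<le> s" for s
        unfolding q1_def q2_def using A B B' K x that by (auto intro!: add_nonneg_nonneg mult_nonneg_nonneg)
      have pair: "\<bar>h (x + s) - h (x + d + s')\<bar> \<le> W + q1 s + q2 s'" if s: "0 \<le> s" "0 \<le> s'" for s s'
      proof -
        have "\<bar>h (x + s) - h (x + d + s')\<bar> \<le> S + \<Phi> (x + s) (x + d + s')"
          using S x d s unfolding P_def by simp
        moreover have "A * min (x + s) (x + d + s') \<le> A * (x + s)" using A by (intro mult_left_mono) auto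
        moreover have "\<bar>q (x + s) - q (x + d + s')\<bar>
           \<le> B' * s + B * (2 * x * s + s ^ 2) + (B' * (K + s') + B * (2 * x * (K + s') + (2 * K ^ 2 + 2 * s' ^ 2)))"
        proof -
          have e1: "q (x + s) = q x + (B' * s + B * (2 * x * s + s ^ 2))"
            "q (x + d + s') = q x + (B' * (d + s') + B * (2 * x * (d + s') + (d + s') ^ 2))"
            by (simp_all add: q_def algebra_simps power2_eq_square)
          have "(d + s') ^ 2 \<le> (K + s') ^ 2" using d s by (intro power_mono) auto
          also have "\<dots> \<le> 2 * K ^ 2 + 2 * s' ^ 2"
            using sum_squares_bound[of K s'] by (simp add: power2_sum)
          finally have "B' * (d + s') + B * (2 * x * (d + s') + (d + s') ^ 2)
              \<le> B' * (K + s') + B * (2 * x * (K + s') + (2 * K ^ 2 + 2 * s' ^ 2))"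
            using B B' x d by (intro add_mono mult_left_mono) auto
          moreover have "0 \<le> B' * (d + s') + B * (2 * x * (d + s') + (d + s') ^ 2)"
            "0 \<le> B' * s + B * (2 * x * s + s ^ 2)"
            using B B' x d s by (auto intro!: add_nonneg_nonneg mult_nonneg_nonneg)
          ultimately show ?thesis unfolding e1 by linarith
        qed
        ultimately show ?thesis unfolding \<Phi>_def W_def q1_def q2_def by (simp add: algebra_simps)
      qed
      have \<kappa>h: "integrable \<kappa> (\<lambda>s. h (z + s))" for z
        unfolding \<kappa>_def by (rule exp_dominated_integrable_conv_power[OF h])
      have \<kappa>q: "integrable \<kappa> q1" "integrable \<kappa> q2" unfolding q1_def q2_def by simp_all
      have Jh: "integrable lborel (\<lambda>s. indicator {a..a + 1} s * h (z + s))" if "0 \<le> a" "0 \<le> z" for a z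
      proof (rule Bochner_Integration.integrable_bound)
        show "integrable lborel (\<lambda>s. indicator {a..a + 1} s * D)" by simp
        have "\<bar>h (z + s)\<bar> \<le> \<bar>D\<bar>" if "a \<le> s" for s
          using h_le[of "z + s"] that \<open>0 \<le> a\<close> \<open>0 \<le> z\<close> by simp
        then show "AE s in lborel. norm (indicator {a..a + 1} s * h (z + s)) \<le> norm (indicator {a..a + 1} s * D)"
          by (intro AE_I2) (auto split: split_indicator)
      qed measurable
      have Jq: "integrable lborel (\<lambda>s. indicator {a..a + 1} s * q1 s)"
        "integrable lborel (\<lambda>s. indicator {a..a + 1} s * q2 s)" for a
        unfolding q1_def q2_def
        by (auto intro!: borel_integrable_compact continuous_intros simp flip: real_scaleR_def)
      have same: "(LINT s|lborel. indicator {\<alpha> + d..\<alpha> + d + 1} s * h (x + s))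
         = (LINT s|lborel. indicator {\<alpha>..\<alpha> + 1} s * h (x + d + s))"
        by (subst lborel_integral_real_affine[where c = 1 and t = d])
           (auto intro!: Bochner_Integration.integral_cong split: split_indicator simp: algebra_simps)
      have "minorized c {\<alpha> + d..\<alpha> + d + 1} \<kappa>" "minorized c {\<alpha>..\<alpha> + 1} \<kappa>"
        unfolding \<kappa>_def using unit[of "\<alpha> + d"] unit[of \<alpha>] d K by auto
      note m = this
      have ad: "0 \<le> \<alpha> + d" and xd: "0 \<le> x + d" using \<alpha> d x by auto
      have p1: "h (x + s) - h (x + d + s') \<le> W + q1 s + q2 s'"
        and p2: "h (x + d + s') - h (x + s) \<le> W + q2 s' + q1 s" if "0 \<le> s" "0 \<le> s'" for s s'
        using pair[OF that] by (simp_all add: abs_le_iff)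
      have d1: "(LINT s|\<kappa>. h (x + s)) - (LINT s|\<kappa>. h (x + d + s))
         \<le> (1 - c) * W + (LINT s|\<kappa>. q1 s) + (LINT s|\<kappa>. q2 s)"
        by (rule coupled_difference[OF \<kappa>.prob_space_axioms \<kappa>.events_eq_borel \<kappa>_nonneg less_imp_le[OF c]
              m(1) ad m(2) \<alpha> \<kappa>h \<kappa>h \<kappa>q Jh[OF ad x] Jh[OF \<alpha> xd] Jq q_nonneg p1 same])
      have d2: "(LINT s|\<kappa>. h (x + d + s)) - (LINT s|\<kappa>. h (x + s))
         \<le> (1 - c) * W + (LINT s|\<kappa>. q2 s) + (LINT s|\<kappa>. q1 s)"
        by (rule coupled_difference[OF \<kappa>.prob_space_axioms \<kappa>.events_eq_borel \<kappa>_nonneg less_imp_le[OF c]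
              m(2) \<alpha> m(1) ad \<kappa>h \<kappa>h \<kappa>q(2,1) Jh[OF \<alpha> xd] Jh[OF ad x] Jq(2,1) q_nonneg(2,1) p2 same[symmetric]])
      have E1: "(LINT s|\<kappa>. q1 s) = (A + B' + 2 * B * x) * Q1 + B * Q2"
        unfolding q1_def Q1_def Q2_def by (simp add: algebra_simps)
      have E2: "(LINT s|\<kappa>. q2 s) = B' * (K + Q1) + B * (2 * x * (K + Q1) + (2 * K ^ 2 + 2 * Q2))"
        unfolding q2_def Q1_def Q2_def by (simp add: algebra_simps \<kappa>.prob_space[simplified])
      have it: "h z = (\<Sum>i<N. (step ^^ i) f z) + (LINT s|\<kappa>. h (z + s))" for z
        using potential_iterate[OF f, of z N] step_power_conv_power[OF h, of N z]
        by (simp add: h_def \<kappa>_def)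
      have part: "\<bar>\<Sum>i<N. (step ^^ i) f z\<bar> \<le> real N * (1 + z + real N * mean)" if z: "0 \<le> z" for z
      proof -
        have "\<bar>\<Sum>i<N. (step ^^ i) f z\<bar> \<le> (\<Sum>i<N. 1 + z + real N * mean)"
        proof (rule order_trans[OF sum_abs sum_mono])
          fix i assume "i \<in> {..<N}"
          then have "real i * mean \<le> real N * mean" using mean_pos by simp
          then show "\<bar>(step ^^ i) f z\<bar> \<le> 1 + z + real N * mean"
            using step_power_linear_bound[OF f lin z, of i] by linarith
        qed
        then show ?thesis by simp
      qed
      have "real N * (1 + (x + d) + real N * mean) \<le> real N * (1 + (x + K) + real N * mean)"
        using d by (intro mult_left_mono) auto
      then have "\<bar>h x - h (x + d)\<bar> \<le> real N * (1 + x + real N * mean) + real N * (1 + (x + K) + real N * mean)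
         + ((1 - c) * W + (LINT s|\<kappa>. q1 s) + (LINT s|\<kappa>. q2 s))"
        using it[of x] it[of "x + d"] part[of x] part[of "x + d"] d1 d2 x d by linarith
      also have "\<dots> = (1 - c) * S + A0 + A * x
         + ((real N * (2 + K + 2 * real N * mean) + (A + B') * Q1 + B * Q2 + B' * (K + Q1) + B * (2 * K ^ 2 + 2 * Q2)) - c * A0)
         + x * ((2 * real N + 2 * B * Q1 + 2 * B * (K + Q1)) - c * A)"
        unfolding E1 E2 W_def by (simp add: algebra_simps)
      also have "\<dots> = (1 - c) * S + A0 + A * x" unfolding cA cA0 by simp
      also have "\<dots> \<le> (1 - c) * S + \<Phi> x (x + d)" unfolding \<Phi>_def using d by simp
      finally show ?thesis .
    qed
    \<comment> \<open>As \<open>S \<le> 2 * D\<close> throughout, subtracting \<open>1\<close> from \<open>S\<close> is at least as good as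
      multiplying it by \<open>1 - c'\<close>.\<close>
    define c' where "c' = min c (1 / (2 * D + 1))"
    have D: "0 \<le> D" by (rule exp_dominated_nonneg[OF h])
    have c': "0 < c'" "c' \<le> 1" "c' \<le> c" "c' * (2 * D) \<le> 1"
    proof -
      have "c' * (2 * D) \<le> 1 / (2 * D + 1) * (2 * D)" unfolding c'_def using D by (intro mult_right_mono) auto
      also have "\<dots> \<le> 1" using D by simp
      finally show "c' * (2 * D) \<le> 1" .
      have "1 / (2 * D + 1) \<le> 1" using D by simp
      then show "c' \<le> 1" unfolding c'_def by linarith
    qed (use c D in \<open>auto simp: c'_def\<close>)
    have iter: "P ((1 - c') ^ n * (2 * D))" for n
    proof (induction n)
      case (Suc n)
      define S where "S = (1 - c') ^ n * (2 * D)"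
      have S: "0 \<le> S" "S \<le> 2 * D" "P S"
        unfolding S_def using c' D Suc by (auto intro!: mult_left_le_one_le power_le_one)
      have "c' * S \<le> c' * (2 * D)" using S c' by (intro mult_left_mono) auto
      then have "S - 1 \<le> (1 - c') * S" using c'(4) by (simp add: algebra_simps)
      moreover have "(1 - c) * S \<le> (1 - c') * S" using S c' by (intro mult_right_mono) auto
      ultimately have "P ((1 - c') * S)"
        using step_far[OF S(3)] step_near[OF S(3)] by (intro P_ordered) (smt (verit, best))
      then show ?case by (simp add: S_def mult.assoc)
    qed (use P0 in simp)
    have "(\<lambda>n. (1 - c') ^ n * (2 * D) + \<Phi> x y) \<longlonglongrightarrow> 0 * (2 * D) + \<Phi> x y"
      using c' by (intro tendsto_intros LIMSEQ_realpow_zero) auto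
    then have "\<bar>h x - h y\<bar> \<le> 0 * (2 * D) + \<Phi> x y"
      by (rule LIMSEQ_le_const) (use iter xy in \<open>auto simp: P_def\<close>)
    then show ?thesis by (simp add: h_def)
  qed
  show ?thesis
  proof (intro exI[of _ "A0 + B' + B"] conjI allI impI)
    show "0 \<le> A0 + B' + B" using A0 B B' by simp
    fix C f and x :: real
    assume f: "exp_dominated C f" and lin: "\<forall>u\<ge>0. \<bar>f u\<bar> \<le> 1 + u" and x: "0 \<le> x"
    have "\<bar>potential f x - potential f 0\<bar> \<le> \<Phi> x 0" by (rule osc[OF f _ x]) (use lin in auto)
    also have "\<dots> = A0 * 1 + B' * x + B * x ^ 2"
      using B B' x by (simp add: \<Phi>_def q_def)
    also have "\<dots> \<le> A0 * (1 + x ^ 2) + B' * (1 + x ^ 2) + B * (1 + x ^ 2)"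
    proof (intro add_mono mult_left_mono)
      have "0 \<le> (x - 1) ^ 2" by simp
      then show "x \<le> 1 + x ^ 2" using x by (simp add: power2_diff)
    qed (use A0 B B' in auto)
    finally show "\<bar>potential f x - potential f 0\<bar> \<le> (A0 + B' + B) * (1 + x ^ 2)"
      by (simp add: algebra_simps)
  qed
qed

end

section \<open>The intensity measure of the perturbed random walk\<close>

lemma continuous_right_measure_atMost:
  fixes N :: "real measure"
  assumes [simp]: "sets N = sets borel" and fin: "\<And>t. emeasure N {..t} < \<infinity>"
  shows "continuous (at_right a) (\<lambda>t. measure N {..t})"
  unfolding continuous_within
proof (rule tendsto_at_right_sequentially[where b="a + 1"])
  fix f :: "nat \<Rightarrow> real" and x assume f: "decseq f" "f \<longlonglongrightarrow> a"
  then have "(\<lambda>n. measure N {..f n}) \<longlonglongrightarrow> measure N (\<Inter>i. {..f i})"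
    using \<open>decseq f\<close> fin unfolding decseq_def by (intro Lim_measure_decseq) (auto simp: decseq_def less_top)
  also have "(\<Inter>i. {..f i}) = {..a}"
    using decseq_ge[OF f] by (auto intro: order_trans LIMSEQ_le_const[OF f(2)])
  finally show "(\<lambda>n. measure N {..f n}) \<longlonglongrightarrow> measure N {..a}" .
qed simp

lemma interval_measure_atMost:
  fixes N :: "real measure"
  assumes sets[simp]: "sets N = sets borel" and fin: "\<And>t. emeasure N {..t} < \<infinity>"
  shows "interval_measure (\<lambda>t. measure N {..t}) = N"
proof -
  let ?F = "\<lambda>t. measure N {..t}"
  have mono: "?F x \<le> ?F y" if "x \<le> y" for x y
    using that fin by (intro measure_mono_fmeasurable) (auto simp: fmeasurable_def)
  have Ioc: "emeasure N {a<..b} = ennreal (?F b - ?F a)" if "a \<le> b" for a b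
  proof -
    have fin': "emeasure N {a<..b} < \<infinity>"
      by (rule le_less_trans[OF emeasure_mono fin[of b]]) auto
    have "measure N {..b} = measure N {..a} + measure N {a<..b}"
      using that fin[of a] fin' by (subst measure_Union[symmetric]) (auto intro!: arg_cong[where f="measure N"])
    then show ?thesis using fin' by (simp add: emeasure_eq_ennreal_measure)
  qed
  have eq: "emeasure (interval_measure ?F) {a<..b} = emeasure N {a<..b}" for a b
  proof (cases "a \<le> b")
    case True
    then show ?thesis
      by (subst emeasure_interval_measure_Ioc[OF _ mono continuous_right_measure_atMost[OF sets fin]])
         (auto simp: Ioc)
  qed simp
  show ?thesis
  proof (rule measure_eqI_generator_eq[where \<Omega> = UNIV and E = "range (\<lambda>(a, b). {a<..b::real})"
        and A = "\<lambda>i. {- real i<..real i}"])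
    show "Int_stable (range (\<lambda>(a, b). {a<..b::real}))"
    proof (rule Int_stableI, safe)
      fix a b c d :: real
      have "{a<..b} \<inter> {c<..d} = (\<lambda>(a, b). {a<..b}) (max a c, min b d)" by auto
      then show "{a<..b} \<inter> {c<..d} \<in> range (\<lambda>(a, b). {a<..b})" by (metis rangeI)
    qed
    show "emeasure (interval_measure ?F) (A) = emeasure N A" if "A \<in> range (\<lambda>(a, b). {a<..b::real})" for A
      using that eq by auto
    show "sets (interval_measure ?F) = sigma_sets UNIV (range (\<lambda>(a, b). {a<..b::real}))"
      by (simp add: borel_sigma_sets_Ioc[THEN arg_cong[where f = sets]])
    show "sets N = sigma_sets UNIV (range (\<lambda>(a, b). {a<..b::real}))"
      by (simp add: borel_sigma_sets_Ioc[THEN arg_cong[where f = sets]])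
    show "range (\<lambda>(a, b). {a<..b::real}) \<subseteq> Pow UNIV" by simp
    show "range (\<lambda>i::nat. {- real i<..real i}) \<subseteq> range (\<lambda>(a, b). {a<..b})" by auto
    show "(\<Union>i. {- real i<..real i}) = UNIV" by (rule UN_Ioc_eq_UNIV)
    show "emeasure (interval_measure ?F) {- real i<..real i} \<noteq> \<infinity>" for i
      unfolding eq by (subst Ioc) auto
  qed
qed

text \<open>The setting of the theorem, with the laws \<open>\<mu>\<close> and \<open>\<nu>\<close> of \<open>\<xi>\<close> and \<open>\<eta>\<close> in place of the
  random variables.\<close>
locale renewal_setting = spread_law \<mu> + walk: prob_space M
  for \<mu> and M :: "'a measure" +
  fixes X Y :: "nat \<Rightarrow> 'a \<Rightarrow> real" and \<nu> :: "real measure"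
  assumes indep: "walk.indep_vars (\<lambda>_. borel) (\<lambda>i \<omega>. (X i \<omega>, Y i \<omega>)) {1..}"
    and X_law: "\<And>i. 1 \<le> i \<Longrightarrow> distr M borel (X i) = \<mu>"
    and Y_law: "\<And>i. 1 \<le> i \<Longrightarrow> distr M borel (Y i) = \<nu>"
    and \<nu>_pos: "AE y in \<nu>. 0 < y"
    and \<nu>_square: "integrable \<nu> (\<lambda>y. y ^ 2)"
    and \<mu>_cube: "integrable \<mu> (\<lambda>s. s ^ 3)"
begin

lemma measurable_XY[measurable]:
  assumes "1 \<le> i"
  shows "X i \<in> borel_measurable M" "Y i \<in> borel_measurable M"
proof -
  have "(\<lambda>\<omega>. (X i \<omega>, Y i \<omega>)) \<in> M \<rightarrow>\<^sub>M borel"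
    using indep assms by (auto simp: walk.indep_vars_def)
  then have "(\<lambda>\<omega>. (X i \<omega>, Y i \<omega>)) \<in> M \<rightarrow>\<^sub>M borel \<Otimes>\<^sub>M borel" by (simp add: borel_prod)
  from measurable_compose[OF this measurable_fst] measurable_compose[OF this measurable_snd]
  show "X i \<in> borel_measurable M" "Y i \<in> borel_measurable M" by simp_all
qed

sublocale \<nu>: real_distribution \<nu>
proof -
  have "real_distribution (distr M borel (Y 1))"
    by (rule walk.real_distribution_distr) (simp add: measurable_XY)
  then show "real_distribution \<nu>" by (simp only: Y_law[OF order_refl])
qed

lemma measurable_walk[measurable]: "walk X n \<in> borel_measurable M"
  unfolding walk_def[abs_def] by (rule borel_measurable_sum) (auto intro: measurable_XY)

lemma measurable_perturbed_walk[measurable]: "perturbed_walk X Y (Suc n) \<in> borel_measurable M"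
  unfolding perturbed_walk_def[abs_def] using measurable_XY(2)[of "Suc n"] by simp

lemma indep_walk_next:
  "walk.indep_var borel (X (Suc n)) borel (walk X n)"
  "walk.indep_var borel (Y (Suc n)) borel (walk X n)"
proof -
  \<comment> \<open>\<open>Z\<close> selects the second component at the last index and the first one before it,
    which makes the summands of the perturbed walk a single independent family.\<close>
  define Z where "Z = (\<lambda>k (p::real\<times>real). if k = Suc n then snd p else fst p)"
  have f: "fst \<in> (borel :: (real \<times> real) measure) \<rightarrow>\<^sub>M (borel :: real measure)"
      "snd \<in> (borel :: (real \<times> real) measure) \<rightarrow>\<^sub>M (borel :: real measure)"
    using measurable_fst[of "borel :: real measure" "borel :: real measure"]
      measurable_snd[of "borel :: real measure" "borel :: real measure"] by (simp_all add: borel_prod)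
  have ind: "walk.indep_vars (\<lambda>_. borel) (\<lambda>i \<omega>. (X i \<omega>, Y i \<omega>)) (insert (Suc n) {1..n})"
    by (rule walk.indep_vars_subset[OF indep]) auto
  have "walk.indep_vars (\<lambda>_. borel) (\<lambda>i \<omega>. fst (X i \<omega>, Y i \<omega>)) (insert (Suc n) {1..n})"
    by (rule walk.indep_vars_compose2[OF ind]) (rule f)
  then have "walk.indep_vars (\<lambda>_. borel) X (insert (Suc n) {1..n})" by simp
  from walk.indep_vars_sum[OF _ _ this]
  show "walk.indep_var borel (X (Suc n)) borel (walk X n)" by (simp add: walk_def[abs_def])
  have "walk.indep_vars (\<lambda>_. borel) (\<lambda>i \<omega>. Z i (X i \<omega>, Y i \<omega>)) (insert (Suc n) {1..n})"
    by (rule walk.indep_vars_compose2[OF ind]) (use f in \<open>auto simp: Z_def\<close>)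
  from walk.indep_vars_sum[OF _ _ this]
  have "walk.indep_var borel (\<lambda>\<omega>. Z (Suc n) (X (Suc n) \<omega>, Y (Suc n) \<omega>)) borel
      (\<lambda>\<omega>. \<Sum>i = 1..n. Z i (X i \<omega>, Y i \<omega>))" by simp
  moreover have "(\<lambda>\<omega>. \<Sum>i = 1..n. Z i (X i \<omega>, Y i \<omega>)) = walk X n"
    by (auto simp: walk_def Z_def intro!: sum.cong)
  ultimately show "walk.indep_var borel (Y (Suc n)) borel (walk X n)" by (simp add: Z_def)
qed

lemma walk_law: "distr M borel (walk X n) = conv_power \<mu> n"
proof (induction n)
  case 0
  have "distr M borel (walk X 0) = distr M borel (\<lambda>_. 0)" by (simp add: walk_def[abs_def])
  also have "\<dots> = return borel 0" by (rule walk.distr_const) simp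
  finally show ?case by simp
next
  case (Suc n)
  have "distr M borel (walk X (Suc n)) = distr M borel (\<lambda>\<omega>. X (Suc n) \<omega> + walk X n \<omega>)"
    by (simp add: walk_def[abs_def] add.commute)
  also have "\<dots> = (distr M borel (X (Suc n)) \<star> distr M borel (walk X n))"
    by (rule walk.sum_indep_random_variable[OF indep_walk_next(1)]) (simp_all add: measurable_XY)
  finally show ?case using Suc X_law[of "Suc n"] by simp
qed

lemma perturbed_walk_law: "distr M borel (perturbed_walk X Y (Suc n)) = (\<nu> \<star> conv_power \<mu> n)"
proof -
  have "distr M borel (perturbed_walk X Y (Suc n)) = distr M borel (\<lambda>\<omega>. Y (Suc n) \<omega> + walk X n \<omega>)"
    by (simp add: perturbed_walk_def[abs_def] add.commute)
  also have "\<dots> = (distr M borel (Y (Suc n)) \<star> distr M borel (walk X n))"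
    by (rule walk.sum_indep_random_variable[OF indep_walk_next(2)]) (simp_all add: measurable_XY)
  finally show ?thesis using walk_law Y_law[of "Suc n"] by simp
qed

lemma \<nu>_nonneg: "AE y in \<nu>. 0 \<le> y"
  by (rule eventually_mono[OF \<nu>_pos]) simp

lemma AE_perturbed_walk_nonneg: "AE z in (\<nu> \<star> conv_power \<mu> n). 0 \<le> z"
proof -
  interpret n: real_distribution "conv_power \<mu> n" by (rule conv_power_distribution)
  show ?thesis
    by (intro AE_convolution_nonneg AE_conv_power_nonneg \<nu>_nonneg)
       (simp_all add: n.finite_measure_axioms \<nu>.finite_measure_axioms)
qed

lemma exp_dominated_integrable_\<nu>:
  assumes "exp_dominated C f"
  shows "integrable \<nu> f"
  using exp_dominated_integrable_nonneg[OF \<nu>.real_distribution_axioms \<nu>_nonneg assms, of 0] by simp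

lemma exp_dominated_integral_\<nu>_le:
  assumes "exp_dominated C f"
  shows "\<bar>LINT y|\<nu>. f y\<bar> \<le> C"
proof -
  have "\<bar>LINT y|\<nu>. f y\<bar> \<le> (LINT y|\<nu>. C)"
    by (rule abs_integral_le, simp, rule eventually_mono[OF \<nu>_nonneg]) (rule exp_dominated_const_le[OF assms])
  then show ?thesis by (simp add: \<nu>.prob_space[simplified])
qed

lemma perturbed_walk_expectation:
  assumes f: "exp_dominated C f"
  shows "integrable M (\<lambda>\<omega>. f (perturbed_walk X Y (Suc n) \<omega>))"
    and "(LINT \<omega>|M. f (perturbed_walk X Y (Suc n) \<omega>)) = (LINT y|\<nu>. (step ^^ n) f y)"
proof -
  note [measurable] = exp_dominated_measurable[OF f]
  interpret n: real_distribution "conv_power \<mu> n" by (rule conv_power_distribution)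
  have "real_distribution (\<nu> \<star> conv_power \<mu> n)"
    unfolding perturbed_walk_law[symmetric] by (rule walk.real_distribution_distr) measurable
  from exp_dominated_integrable_nonneg[OF this AE_perturbed_walk_nonneg f, of 0]
  have int: "integrable (\<nu> \<star> conv_power \<mu> n) f" by simp
  then have "integrable (distr M borel (perturbed_walk X Y (Suc n))) f"
    by (simp add: perturbed_walk_law)
  then show "integrable M (\<lambda>\<omega>. f (perturbed_walk X Y (Suc n) \<omega>))"
    by (simp add: integrable_distr_eq)
  have "(LINT \<omega>|M. f (perturbed_walk X Y (Suc n) \<omega>)) = (LINT z|distr M borel (perturbed_walk X Y (Suc n)). f z)"
    by (simp add: integral_distr)
  also have "\<dots> = (LINT y|\<nu>. LINT s|conv_power \<mu> n. f (y + s))"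
    unfolding perturbed_walk_law using int
    by (intro integral_convolution) (simp_all add: n.finite_measure_axioms \<nu>.finite_measure_axioms)
  also have "\<dots> = (LINT y|\<nu>. (step ^^ n) f y)"
    by (simp add: step_power_conv_power[OF f])
  finally show "(LINT \<omega>|M. f (perturbed_walk X Y (Suc n) \<omega>)) = (LINT y|\<nu>. (step ^^ n) f y)" .
qed

text \<open>With counting measure on the indices the sum over the points becomes an integral over a
  product space, to which Fubini applies.\<close>
definition intensity :: "real measure" where
  "intensity = distr (count_space UNIV \<Otimes>\<^sub>M M) borel (\<lambda>(n, \<omega>). perturbed_walk X Y (Suc n) \<omega>)"

lemma sets_intensity[simp, measurable_cong]: "sets intensity = sets borel"
  by (simp add: intensity_def)

lemma measurable_point[measurable]:
  "(\<lambda>(n, \<omega>). perturbed_walk X Y (Suc n) \<omega>) \<in> (count_space UNIV \<Otimes>\<^sub>M M) \<rightarrow>\<^sub>M borel"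
  by (rule measurable_pair_measure_countable1) auto

lemma nn_integral_intensity:
  assumes [measurable]: "f \<in> borel_measurable borel"
  shows "(\<integral>\<^sup>+x. f x \<partial>intensity) = (\<Sum>n. \<integral>\<^sup>+\<omega>. f (perturbed_walk X Y (Suc n) \<omega>) \<partial>M)"
proof -
  have m: "(\<lambda>p. f (case p of (n, \<omega>) \<Rightarrow> perturbed_walk X Y (Suc n) \<omega>)) \<in> borel_measurable (count_space UNIV \<Otimes>\<^sub>M M)"
    by measurable
  have "(\<integral>\<^sup>+x. f x \<partial>intensity)
    = (\<integral>\<^sup>+p. f (case p of (n, \<omega>) \<Rightarrow> perturbed_walk X Y (Suc n) \<omega>) \<partial>(count_space UNIV \<Otimes>\<^sub>M M))"
    unfolding intensity_def by (rule nn_integral_distr) measurable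
  also have "\<dots> = (\<integral>\<^sup>+n. \<integral>\<^sup>+\<omega>. f (perturbed_walk X Y (Suc n) \<omega>) \<partial>M \<partial>count_space UNIV)"
    using walk.nn_integral_fst[OF m] by simp
  finally show ?thesis by (simp add: nn_integral_count_space_nat)
qed

text \<open>The \<open>n\<close>-th point is distributed as \<open>\<eta>\<close> plus an independent sum of \<open>n\<close> copies of \<open>\<xi>\<close>, so
  its expected \<open>f\<close>-value is the \<open>\<nu>\<close>-integral of \<open>(step ^^ n) f\<close>.\<close>
lemma integral_intensity:
  assumes f: "exp_dominated C f"
  shows "integrable intensity f" "(LINT x|intensity. f x) = (LINT y|\<nu>. potential f y)"
proof -
  note [measurable] = exp_dominated_measurable[OF f]
  interpret c: sigma_finite_measure "count_space (UNIV :: nat set)"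
    by (rule sigma_finite_measure_count_space)
  interpret p: pair_sigma_finite "count_space (UNIV :: nat set)" M ..
  have df: "exp_dominated (C * rho ^ n) ((step ^^ n) f)" for n by (rule exp_dominated_step_power[OF f])
  have abs_f: "exp_dominated C (\<lambda>x. \<bar>f x\<bar>)" using f by (simp add: exp_dominated_def)
  have int: "integrable (count_space UNIV \<Otimes>\<^sub>M M) (\<lambda>(n, \<omega>). f (perturbed_walk X Y (Suc n) \<omega>))"
  proof (rule p.Fubini_integrable)
    show "(\<lambda>(n, \<omega>). f (perturbed_walk X Y (Suc n) \<omega>)) \<in> borel_measurable (count_space UNIV \<Otimes>\<^sub>M M)"
      by (rule measurable_pair_measure_countable1) auto
    show "AE n in count_space UNIV. integrable M (\<lambda>\<omega>. case (n, \<omega>) of (n, \<omega>) \<Rightarrow> f (perturbed_walk X Y (Suc n) \<omega>))"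
      using perturbed_walk_expectation(1)[OF f] by simp
    have "(LINT \<omega>|M. \<bar>f (perturbed_walk X Y (Suc n) \<omega>)\<bar>) \<le> C * rho ^ n" for n
      using perturbed_walk_expectation(2)[OF abs_f, of n]
        exp_dominated_integral_\<nu>_le[OF exp_dominated_step_power[OF abs_f, of n]] by linarith
    then have "summable (\<lambda>n. LINT \<omega>|M. \<bar>f (perturbed_walk X Y (Suc n) \<omega>)\<bar>)"
      by (intro summable_comparison_test'[OF summable_rho[of C], of 0]) auto
    then show "integrable (count_space UNIV) (\<lambda>n. LINT \<omega>|M. norm (case (n, \<omega>) of (n, \<omega>) \<Rightarrow> f (perturbed_walk X Y (Suc n) \<omega>)))"
      by (simp add: integrable_count_space_nat_iff)
  qed
  show "integrable intensity f"
    unfolding intensity_def using int by (subst integrable_distr_eq) (auto simp: case_prod_unfold)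
  have "(LINT x|intensity. f x) = (LINT p|(count_space UNIV \<Otimes>\<^sub>M M). (case p of (n, \<omega>) \<Rightarrow> f (perturbed_walk X Y (Suc n) \<omega>)))"
    unfolding intensity_def by (subst integral_distr) (auto simp: case_prod_unfold)
  also have "\<dots> = (LINT n|count_space UNIV. LINT \<omega>|M. f (perturbed_walk X Y (Suc n) \<omega>))"
    using p.integral_fst'[OF int] by simp
  also have "\<dots> = (\<Sum>n. LINT \<omega>|M. f (perturbed_walk X Y (Suc n) \<omega>))"
    using p.integrable_fst'[OF int] by (intro integral_count_space_nat) simp
  also have "\<dots> = (\<Sum>n. LINT y|\<nu>. (step ^^ n) f y)"
    by (simp add: perturbed_walk_expectation(2)[OF f])
  also have "\<dots> = (LINT y|\<nu>. potential f y)"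
    unfolding potential_def
  proof (rule integral_suminf[symmetric])
    show "integrable \<nu> ((step ^^ n) f)" for n by (rule exp_dominated_integrable_\<nu>[OF df])
    show "AE y in \<nu>. summable (\<lambda>n. norm ((step ^^ n) f y))"
      using summable_potential[OF f] by simp
    show "summable (\<lambda>n. LINT y|\<nu>. norm ((step ^^ n) f y))"
    proof (rule summable_comparison_test'[OF summable_rho[of C], of 0])
      fix n
      have "exp_dominated (C * rho ^ n) (\<lambda>y. \<bar>(step ^^ n) f y\<bar>)" using df[of n] by (simp add: exp_dominated_def)
      from exp_dominated_integral_\<nu>_le[OF this]
      show "norm (LINT y|\<nu>. norm ((step ^^ n) f y)) \<le> C * rho ^ n" by simp
    qed
  qed
  finally show "(LINT x|intensity. f x) = (LINT y|\<nu>. potential f y)" .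
qed

lemma AE_intensity_nonneg: "AE x in intensity. 0 \<le> x"
proof -
  have "(\<integral>\<^sup>+\<omega>. indicator {..<0} (perturbed_walk X Y (Suc n) \<omega>) \<partial>M) = (0::ennreal)" for n
  proof -
    have "(\<integral>\<^sup>+\<omega>. indicator {..<0} (perturbed_walk X Y (Suc n) \<omega>) \<partial>M)
       = (\<integral>\<^sup>+z. indicator {..<0} z \<partial>(\<nu> \<star> conv_power \<mu> n))"
      unfolding perturbed_walk_law[symmetric] by (rule nn_integral_distr[symmetric]) auto
    also have "\<dots> = (\<integral>\<^sup>+z. 0 \<partial>(\<nu> \<star> conv_power \<mu> n))"
      by (rule nn_integral_cong_AE, rule eventually_mono[OF AE_perturbed_walk_nonneg]) auto
    finally show ?thesis by simp
  qed
  then have "(\<integral>\<^sup>+x. indicator {..<0} x \<partial>intensity) = 0"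
    by (subst nn_integral_intensity) auto
  then have "{..<0} \<in> null_sets intensity" by (simp add: null_sets_def)
  from AE_not_in[OF this] show ?thesis by (rule eventually_mono) auto
qed

lemma intensity_atMost_finite: "emeasure intensity {..t} < \<infinity>"
proof -
  have d: "exp_dominated (exp t) (indicator {0..t})"
    by (auto simp: exp_dominated_def exp_add[symmetric] split: split_indicator)
  have "emeasure intensity {..t} = emeasure intensity {0..t}"
    using AE_intensity_nonneg by (intro emeasure_eq_AE) auto
  also have "\<dots> = (\<integral>\<^sup>+x. ennreal (norm (indicator {0..t} x :: real)) \<partial>intensity)"
    by (simp add: ennreal_indicator)
  also have "\<dots> < \<infinity>" using integral_intensity(1)[OF d] by (simp only: integrable_iff_bounded)
  finally show ?thesis .
qed

definition V :: "real \<Rightarrow> real" where "V t = measure intensity {..t}"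

lemma V_neg: "t < 0 \<Longrightarrow> V t = 0"
proof -
  assume "t < 0"
  then have "emeasure intensity {..t} = emeasure intensity {}"
    using AE_intensity_nonneg by (intro emeasure_eq_AE) auto
  then show "V t = 0" by (simp add: V_def measure_def)
qed

lemma V_eq_mean_counting: "mean_counting M X Y = V"
proof
  fix t
  show "mean_counting M X Y t = V t"
  proof (cases "t < 0")
    case False
    have "(\<integral>\<^sup>+\<omega>. counting X Y t \<omega> \<partial>M) = (\<Sum>n. \<integral>\<^sup>+\<omega>. indicator {..t} (perturbed_walk X Y (Suc n) \<omega>) \<partial>M)"
      unfolding counting_def by (rule nn_integral_suminf) simp
    also have "\<dots> = emeasure intensity {..t}"
      using nn_integral_intensity[of "indicator {..t}"] by simp
    finally show ?thesis using False by (simp add: mean_counting_def V_def measure_def)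
  qed (simp add: mean_counting_def V_neg)
qed

lemma interval_measure_V: "interval_measure V = intensity"
  unfolding V_def[abs_def] by (rule interval_measure_atMost[OF sets_intensity intensity_atMost_finite])

lemma V_mono: "s \<le> t \<Longrightarrow> V s \<le> V t"
  unfolding V_def using intensity_atMost_finite
  by (intro measure_mono_fmeasurable) (auto simp: fmeasurable_def)

end

section \<open>The deviation from Lebesgue measure\<close>

text \<open>A common dominating measure for the Radon-Nikodym derivatives below.\<close>
lemma sum_of_measures:
  fixes A B :: "real measure"
  assumes [simp]: "sets A = sets borel" "sets B = sets borel"
  obtains Q :: "real measure" where "sets Q = sets borel"
    "\<And>S. S \<in> sets borel \<Longrightarrow> emeasure Q S = emeasure A S + emeasure B S"
proof -
  define f where "f S = emeasure A S + emeasure B S" for S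
  define Q where "Q = measure_of UNIV (sets borel) f"
  have sets: "sets Q = sets borel"
    unfolding Q_def by (simp add: sets_measure_of_conv sets.sigma_sets_eq[of borel, simplified])
  have "emeasure Q S = f S" if S: "S \<in> sets borel" for S
    unfolding Q_def
  proof (rule emeasure_measure_of_sigma)
    show "sigma_algebra UNIV (sets (borel :: real measure))"
      using sets.sigma_algebra_axioms[of "borel :: real measure"] by simp
    show "positive (sets borel) f" by (simp add: positive_def f_def)
    show "countably_additive (sets borel) f"
    proof (rule countably_additiveI)
      fix F :: "nat \<Rightarrow> real set" assume F: "range F \<subseteq> sets borel" "disjoint_family F"
      show "(\<Sum>i. f (F i)) = f (\<Union>i. F i)"
        unfolding f_def using F
        by (subst suminf_add[symmetric]) (auto simp: suminf_emeasure)
    qed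
  qed (rule S)
  then show ?thesis using sets by (intro that[of Q]) (auto simp: f_def)
qed

lemma sigma_finite_atMost:
  fixes Q :: "real measure"
  assumes "sets Q = sets borel" "\<And>t. emeasure Q {..t} < \<infinity>"
  shows "sigma_finite_measure Q"
proof
  show "\<exists>A. countable A \<and> A \<subseteq> sets Q \<and> \<Union> A = space Q \<and> (\<forall>a\<in>A. emeasure Q a \<noteq> \<infinity>)"
  proof (intro exI[of _ "range (\<lambda>n::nat. {..real n})"] conjI ballI)
    have "space Q = UNIV" using sets_eq_imp_space_eq[OF assms(1)] by simp
    then show "\<Union> (range (\<lambda>n::nat. {..real n})) = space Q"
      using real_arch_simple by auto
    show "emeasure Q a \<noteq> \<infinity>" if "a \<in> range (\<lambda>n::nat. {..real n})" for a
      using that assms(2) by (auto simp: less_top)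
  qed (use assms in auto)
qed

context renewal_setting
begin

text \<open>Let \<open>h\<close> be the potential of \<open>f\<close>. The first integral is \<open>E h \<eta>\<close> and the second is the
  average of \<open>h\<close> under the stationary delay law, whose density is proportional to the tail of
  \<open>\<mu>\<close>. Both differ from \<open>h 0\<close> by at most the integral of \<open>R * (1 + x^2)\<close>: for the first law this
  takes the second moment of \<open>\<nu>\<close>, for the other one the third moment of \<open>\<mu>\<close>.\<close>
lemma intensity_test_bound:
  "\<exists>K\<ge>0. \<forall>C f. exp_dominated C f \<longrightarrow> (\<forall>u\<ge>0. \<bar>f u\<bar> \<le> 1 + u) \<longrightarrow>
     \<bar>(LINT x|intensity. f x) - (LINT y|lborel. indicator {0..} y * f y) / mean\<bar> \<le> K"
proof -
  obtain R where R: "0 \<le> R" and osc: "\<And>C f x. \<lbrakk>exp_dominated C f; \<forall>u\<ge>0. \<bar>f u\<bar> \<le> 1 + u; 0 \<le> x\<rbrakk>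
       \<Longrightarrow> \<bar>potential f x - potential f 0\<bar> \<le> R * (1 + x ^ 2)"
    using potential_oscillation by blast
  define K where "K = (LINT y|\<nu>. R * (1 + y ^ 2)) + (LINT s|\<mu>. R * (s + s ^ 3)) / mean"
  have \<nu>1: "integrable \<nu> (\<lambda>y. R * (1 + y ^ 2))" using \<nu>_square by simp
  have \<mu>1: "integrable \<mu> (\<lambda>s. R * (s + s ^ 3))" using \<mu>_cube integrable_id by simp
  show ?thesis
  proof (intro exI[of _ K] conjI allI impI)
    have "0 \<le> (LINT s|\<mu>. R * (s + s ^ 3))"
      by (rule integral_nonneg_AE, rule eventually_mono[OF pos]) (use R in simp)
    moreover have "0 \<le> (LINT y|\<nu>. R * (1 + y ^ 2))"
      using R by (intro integral_nonneg_AE) (simp add: add_nonneg_nonneg)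
    ultimately show "0 \<le> K" using mean_pos by (simp add: K_def)
    fix C f assume f: "exp_dominated C f" and lin: "\<forall>u\<ge>0. \<bar>f u\<bar> \<le> 1 + u"
    define h where "h = potential f"
    obtain D where h: "exp_dominated D h" using exp_dominated_potential[OF f] h_def by blast
    note [measurable] = exp_dominated_measurable[OF h]
    have h_osc: "\<bar>h y - h 0\<bar> \<le> R * (1 + y ^ 2)" if "0 \<le> y" for y
      unfolding h_def by (rule osc[OF f lin that])
    have b1: "\<bar>(LINT y|\<nu>. h y) - h 0\<bar> \<le> (LINT y|\<nu>. R * (1 + y ^ 2))"
    proof -
      have "(LINT y|\<nu>. h y) - h 0 = (LINT y|\<nu>. h y - h 0)"
        using exp_dominated_integrable_\<nu>[OF h] by (simp add: \<nu>.prob_space[simplified])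
      also have "\<bar>\<dots>\<bar> \<le> (LINT y|\<nu>. R * (1 + y ^ 2))"
        by (rule abs_integral_le[OF \<nu>1], rule eventually_mono[OF \<nu>_nonneg]) (rule h_osc)
      finally show ?thesis .
    qed
    define I where "I s = (LINT y|lborel. indicator {0..s} y * h y)" for s
    have [measurable]: "I \<in> borel_measurable borel" unfolding I_def[abs_def] by measurable
    have ih: "integrable lborel (\<lambda>y. indicator {0..s} y * h y)" for s
      by (rule exp_dominated_integrable_half_line[OF h]) auto
    have I_dev: "\<bar>I s - s * h 0\<bar> \<le> R * (s + s ^ 3)" if s: "0 < s" for s
    proof -
      have ic: "integrable lborel (\<lambda>y. indicator {0..s} y * (w::real))" for w
        using s by (intro integrable_mult_left integrable_real_indicator) auto
      have "I s - s * h 0 = (LINT y|lborel. indicator {0..s} y * h y - indicator {0..s} y * h 0)"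
        unfolding I_def using ih[of s] ic[of "h 0"] s by (subst Bochner_Integration.integral_diff) auto
      also have "\<bar>\<dots>\<bar> \<le> (LINT y|lborel. indicator {0..s} y * (R * (1 + s ^ 2)))"
      proof (rule abs_integral_le[OF ic], rule AE_I2)
        fix y
        have "\<bar>h y - h 0\<bar> \<le> R * (1 + s ^ 2)" if "0 \<le> y" "y \<le> s"
        proof -
          have "R * (1 + y ^ 2) \<le> R * (1 + s ^ 2)"
            using R that by (intro mult_left_mono add_left_mono power_mono) auto
          then show ?thesis using h_osc[OF that(1)] by linarith
        qed
        then show "\<bar>indicator {0..s} y * h y - indicator {0..s} y * h 0\<bar> \<le> indicator {0..s} y * (R * (1 + s ^ 2))"
          by (auto split: split_indicator)
      qed
      also have "\<dots> = R * (s + s ^ 3)" using s by (simp add: algebra_simps power3_eq_cube power2_eq_square)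
      finally show ?thesis .
    qed
    have int_dev: "integrable \<mu> (\<lambda>s. I s - s * h 0)"
    proof (rule Bochner_Integration.integrable_bound[OF \<mu>1])
      show "AE s in \<mu>. norm (I s - s * h 0) \<le> norm (R * (s + s ^ 3))"
        by (rule eventually_mono[OF pos]) (use I_dev in \<open>auto intro: order_trans[OF _ abs_ge_self]\<close>)
    qed measurable
    have b2: "\<bar>(LINT s|\<mu>. I s) - mean * h 0\<bar> \<le> (LINT s|\<mu>. R * (s + s ^ 3))"
    proof -
      have "(LINT s|\<mu>. I s) = (LINT s|\<mu>. (I s - s * h 0) + s * h 0)" by simp
      also have "\<dots> = (LINT s|\<mu>. I s - s * h 0) + mean * h 0"
        unfolding mean_def using int_dev integrable_id
        by (subst Bochner_Integration.integral_add) auto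
      finally have "\<bar>(LINT s|\<mu>. I s) - mean * h 0\<bar> = \<bar>LINT s|\<mu>. I s - s * h 0\<bar>" by simp
      also have "\<dots> \<le> (LINT s|\<mu>. R * (s + s ^ 3))"
        by (rule abs_integral_le[OF \<mu>1], rule eventually_mono[OF pos]) (rule I_dev)
      finally show ?thesis .
    qed
    have "(LINT x|intensity. f x) - (LINT y|lborel. indicator {0..} y * f y) / mean
        = ((LINT y|\<nu>. h y) - h 0) - ((LINT s|\<mu>. I s) - mean * h 0) / mean"
      using mean_pos by (simp add: integral_intensity(2)[OF f] integral_potential[OF f] h_def I_def diff_divide_distrib)
    moreover have "\<bar>((LINT s|\<mu>. I s) - mean * h 0) / mean\<bar> \<le> (LINT s|\<mu>. R * (s + s ^ 3)) / mean"
      using b2 mean_pos by (simp add: abs_divide divide_right_mono)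
    ultimately show "\<bar>(LINT x|intensity. f x) - (LINT y|lborel. indicator {0..} y * f y) / mean\<bar> \<le> K"
      unfolding K_def using b1 by linarith
  qed
qed

text \<open>The Jordan decomposition of the intensity minus Lebesgue measure over the mean. Relative
  to the sum of the two measures they have densities \<open>d1\<close> and \<open>d2\<close>. The weighted total variation
  on \<open>[0,n]\<close> is the value at the test function \<open>(1 + x) * sgn (d1 - d2)\<close>, so
  \<open>intensity_test_bound\<close> bounds it uniformly in \<open>n\<close>.\<close>
lemma signed_deviation:
  obtains P N :: "real measure" where "finite_borel_measure P" "finite_borel_measure N"
    "AE x in P. 0 \<le> x" "AE x in N. 0 \<le> x" "integrable P (\<lambda>x. x)" "integrable N (\<lambda>x. x)"
    "\<And>C f. exp_dominated C f \<Longrightarrow>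
      (LINT x|intensity. f x) - (LINT y|lborel. indicator {0..} y * f y) / mean = (LINT x|P. f x) - (LINT x|N. f x)"
proof -
  obtain K where K: "0 \<le> K" and test: "\<And>C f. \<lbrakk>exp_dominated C f; \<forall>u\<ge>0. \<bar>f u\<bar> \<le> 1 + u\<rbrakk> \<Longrightarrow>
     \<bar>(LINT x|intensity. f x) - (LINT y|lborel. indicator {0..} y * f y) / mean\<bar> \<le> K"
    using intensity_test_bound by blast
  define L where "L = density lborel (\<lambda>x::real. ennreal (indicator {0..} x / mean))"
  have sL[simp, measurable_cong]: "sets L = sets borel" by (simp add: L_def)
  have L_fin: "emeasure L {..t} < \<infinity>" for t
  proof -
    have "emeasure L {..t} = (\<integral>\<^sup>+x. ennreal (indicator {0..} x / mean) * indicator {..t} x \<partial>lborel)"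
      unfolding L_def by (rule emeasure_density) auto
    also have "\<dots> \<le> (\<integral>\<^sup>+x. ennreal (1 / mean) * indicator {0..t} x \<partial>lborel)"
      by (intro nn_integral_mono) (auto split: split_indicator)
    also have "\<dots> < \<infinity>" by (cases "0 \<le> t") (auto simp: nn_integral_cmult ennreal_mult_less_top)
    finally show ?thesis .
  qed
  obtain Q :: "real measure" where Qs[simp, measurable_cong]: "sets Q = sets borel"
    and Q: "\<And>S. S \<in> sets borel \<Longrightarrow> emeasure Q S = emeasure intensity S + emeasure L S"
    by (rule sum_of_measures[OF sets_intensity sL]) (rule that)
  have Q_fin: "emeasure Q {..t} < \<infinity>" for t
    using Q[of "{..t}"] intensity_atMost_finite[of t] L_fin[of t] by simp
  interpret Q: sigma_finite_measure Q by (rule sigma_finite_atMost[OF Qs Q_fin])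
  have dens: "\<exists>d\<in>borel_measurable borel. (\<forall>x. 0 \<le> d x) \<and> density Q (\<lambda>x. ennreal (d x)) = A"
    if A: "sets A = sets borel" "\<And>t. emeasure A {..t} < \<infinity>" "\<And>S. S \<in> sets borel \<Longrightarrow> emeasure A S \<le> emeasure Q S" for A
  proof -
    have ac: "absolutely_continuous Q A"
      unfolding absolutely_continuous_def
    proof
      fix S assume "S \<in> null_sets Q"
      then have "S \<in> sets borel" "emeasure Q S = 0" by (auto simp: null_sets_def)
      then show "S \<in> null_sets A" using A(3)[of S] A(1) by (auto simp: null_sets_def)
    qed
    have sA: "sets A = sets Q" using A(1) by simp
    have fin: "AE x in Q. RN_deriv Q A x \<noteq> \<infinity>"
      using Q.RN_deriv_finite[OF sigma_finite_atMost[OF A(1,2)] ac sA] .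
    have "density Q (\<lambda>x. ennreal (enn2real (RN_deriv Q A x))) = density Q (RN_deriv Q A)"
      by (rule density_cong) (use fin in \<open>auto elim!: AE_mp simp: less_top\<close>)
    also have "\<dots> = A" by (rule Q.density_RN_deriv[OF ac sA])
    finally have "density Q (\<lambda>x. ennreal (enn2real (RN_deriv Q A x))) = A" .
    moreover have "RN_deriv Q A \<in> borel_measurable borel" using borel_measurable_RN_deriv[of Q A] by simp
    ultimately show ?thesis by (intro bexI[of _ "\<lambda>x. enn2real (RN_deriv Q A x)"]) auto
  qed
  obtain d1 where d1[measurable]: "d1 \<in> borel_measurable borel" and d1n: "\<And>x. 0 \<le> d1 x"
    and int_d1: "density Q (\<lambda>x. ennreal (d1 x)) = intensity"
    using dens[of intensity] Q intensity_atMost_finite by auto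
  obtain d2 where d2[measurable]: "d2 \<in> borel_measurable borel" and d2n: "\<And>x. 0 \<le> d2 x"
    and int_d2: "density Q (\<lambda>x. ennreal (d2 x)) = L"
    using dens[of L] Q L_fin by auto
  define wp where "wp x = indicator {0..} x * max (d1 x - d2 x) 0" for x
  define wn where "wn x = indicator {0..} x * max (d2 x - d1 x) 0" for x
  have [measurable]: "wp \<in> borel_measurable borel" "wn \<in> borel_measurable borel"
    unfolding wp_def[abs_def] wn_def[abs_def] by measurable
  have wn0: "0 \<le> wp x" "0 \<le> wn x" for x by (simp_all add: wp_def wn_def)
  define P where "P = density Q (\<lambda>x. ennreal (wp x))"
  define N where "N = density Q (\<lambda>x. ennreal (wn x))"
  have sPN[simp, measurable_cong]: "sets P = sets borel" "sets N = sets borel" by (simp_all add: P_def N_def)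
  have i1: "integrable Q (\<lambda>x. d1 x * f x) \<and> (LINT x|Q. d1 x * f x) = (LINT x|intensity. f x)"
    if f: "exp_dominated C f" for C f
  proof -
    note [measurable] = exp_dominated_measurable[OF f]
    show ?thesis
      using integral_intensity(1)[OF f] density_real[of f Q d1] d1n by (simp add: int_d1)
  qed
  have i2: "integrable Q (\<lambda>x. d2 x * f x) \<and> (LINT x|Q. d2 x * f x) = (LINT y|lborel. indicator {0..} y * f y) / mean"
    if f: "exp_dominated C f" for C f
  proof -
    note [measurable] = exp_dominated_measurable[OF f]
    have e: "(\<lambda>x. indicator {0..} x / mean * f x) = (\<lambda>x. (indicator {0..} x * f x) / mean)" by auto
    have "integrable lborel (\<lambda>x. (indicator {0..} x * f x) / mean)"
      using exp_dominated_integrable_half_line[OF f, of "{0..}"] by simp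
    then show ?thesis
      using density_real[of f Q d2] density_real[of f lborel "\<lambda>x. indicator {0..} x / mean"] d2n mean_pos
      unfolding int_d2 L_def[symmetric] e by simp
  qed
  have total: "(\<integral>\<^sup>+x. ennreal ((1 + x) * (wp x + wn x)) \<partial>Q) \<le> ennreal K"
  proof -
    have part: "(\<integral>\<^sup>+x. ennreal ((1 + x) * (wp x + wn x)) * indicator {..real n} x \<partial>Q) \<le> ennreal K" for n :: nat
    proof -
      define f where "f x = indicator {0..real n} x * ((1 + x) * sgn (d1 x - d2 x))" for x
      have [measurable]: "f \<in> borel_measurable borel" unfolding f_def[abs_def] by measurable
      have "\<bar>f u\<bar> \<le> (1 + real n) * exp (real n) * exp (- u)" for u
      proof (cases "u \<in> {0..real n}")
        case True
        have "(1 + u) * \<bar>sgn (d1 u - d2 u)\<bar> \<le> (1 + u) * 1" using True by (intro mult_left_mono) (auto simp: sgn_if)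
        also have "\<dots> \<le> (1 + real n) * exp (real n - u)" using True by (intro mult_mono) auto
        also have "\<dots> = (1 + real n) * exp (real n) * exp (- u)" by (simp add: exp_diff exp_minus divide_inverse)
        also have "(1 + u) * \<bar>sgn (d1 u - d2 u)\<bar> = \<bar>f u\<bar>" using True by (simp add: f_def abs_mult del: abs_sgn)
        finally show ?thesis .
      qed (simp add: f_def)
      then have f: "exp_dominated ((1 + real n) * exp (real n)) f" by (simp add: exp_dominated_def)
      have lin: "\<forall>u\<ge>0. \<bar>f u\<bar> \<le> 1 + u"
        by (auto simp: f_def abs_mult sgn_if split: split_indicator)
      have eq: "d1 x * f x - d2 x * f x = (1 + x) * (wp x + wn x) * indicator {..real n} x" for x
        by (auto simp: f_def wp_def wn_def sgn_if max_def algebra_simps split: split_indicator)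
      have "integrable Q (\<lambda>x. d1 x * f x - d2 x * f x)" using i1[OF f] i2[OF f] by simp
      then have int: "integrable Q (\<lambda>x. (1 + x) * (wp x + wn x) * indicator {..real n} x)" by (simp only: eq)
      have nn: "0 \<le> (1 + x) * (wp x + wn x) * indicator {..real n} x" for x
        by (auto simp: wp_def wn_def split: split_indicator)
      have "(LINT x|Q. (1 + x) * (wp x + wn x) * indicator {..real n} x) = (LINT x|Q. d1 x * f x - d2 x * f x)"
        by (simp only: eq)
      also have "\<dots> = (LINT x|intensity. f x) - (LINT y|lborel. indicator {0..} y * f y) / mean"
        using i1[OF f] i2[OF f] by simp
      also have "\<dots> \<le> K" using test[OF f lin] by (simp add: abs_le_iff)
      finally have "(LINT x|Q. (1 + x) * (wp x + wn x) * indicator {..real n} x) \<le> K" .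
      moreover have "(\<integral>\<^sup>+x. ennreal ((1 + x) * (wp x + wn x)) * indicator {..real n} x \<partial>Q)
          = ennreal (LINT x|Q. (1 + x) * (wp x + wn x) * indicator {..real n} x)"
      proof -
        have "(\<integral>\<^sup>+x. ennreal ((1 + x) * (wp x + wn x)) * indicator {..real n} x \<partial>Q)
          = (\<integral>\<^sup>+x. ennreal ((1 + x) * (wp x + wn x) * indicator {..real n} x) \<partial>Q)"
          by (intro nn_integral_cong) (auto split: split_indicator)
        also have "\<dots> = ennreal (LINT x|Q. (1 + x) * (wp x + wn x) * indicator {..real n} x)"
          by (rule nn_integral_eq_integral[OF int]) (use nn in simp)
        finally show ?thesis .
      qed
      ultimately show ?thesis by (simp add: ennreal_leI)
    qed
    have "(\<integral>\<^sup>+x. ennreal ((1 + x) * (wp x + wn x)) \<partial>Q)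
       = (\<integral>\<^sup>+x. (SUP n::nat. ennreal ((1 + x) * (wp x + wn x)) * indicator {..real n} x) \<partial>Q)"
    proof (rule nn_integral_cong)
      fix x
      obtain n :: nat where "x \<le> real n" using real_arch_simple by blast
      then show "ennreal ((1 + x) * (wp x + wn x)) = (SUP n::nat. ennreal ((1 + x) * (wp x + wn x)) * indicator {..real n} x)"
        by (intro antisym SUP_upper2[of n] SUP_least) (auto split: split_indicator)
    qed
    also have "\<dots> = (SUP n::nat. \<integral>\<^sup>+x. ennreal ((1 + x) * (wp x + wn x)) * indicator {..real n} x \<partial>Q)"
      by (rule nn_integral_monotone_convergence_SUP)
         (auto simp: incseq_def le_fun_def split: split_indicator)
    also have "\<dots> \<le> ennreal K" by (rule SUP_least) (rule part)
    finally show ?thesis .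
  qed
  have bnd: "(\<integral>\<^sup>+x. ennreal (w x) * ennreal (1 + x) \<partial>Q) < \<infinity>"
    if w: "\<And>x. 0 \<le> w x" "\<And>x. w x \<le> wp x + wn x" "\<And>x. x < 0 \<Longrightarrow> w x = 0" for w
  proof -
    have "(\<integral>\<^sup>+x. ennreal (w x) * ennreal (1 + x) \<partial>Q) \<le> (\<integral>\<^sup>+x. ennreal ((1 + x) * (wp x + wn x)) \<partial>Q)"
    proof (rule nn_integral_mono)
      fix x
      show "ennreal (w x) * ennreal (1 + x) \<le> ennreal ((1 + x) * (wp x + wn x))"
      proof (cases "0 \<le> x")
        case True
        then have "ennreal (w x) * ennreal (1 + x) = ennreal ((1 + x) * w x)"
          using w(1) by (simp add: ennreal_mult mult.commute)
        also have "\<dots> \<le> ennreal ((1 + x) * (wp x + wn x))"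
          using True w by (intro ennreal_leI mult_left_mono) auto
        finally show ?thesis .
      qed (use w in auto)
    qed
    also have "\<dots> \<le> ennreal K" by (rule total)
    finally show ?thesis by (simp add: le_less_trans)
  qed
  have wbp: "wp x \<le> wp x + wn x" "x < 0 \<Longrightarrow> wp x = 0" and wbn: "wn x \<le> wp x + wn x" "x < 0 \<Longrightarrow> wn x = 0" for x
    using wn0[of x] by (auto simp: wp_def wn_def)
  have AEP: "AE x in density Q (\<lambda>x. ennreal (w x)). 0 \<le> x"
    if [measurable]: "w \<in> borel_measurable borel" and w: "\<And>x. x < 0 \<Longrightarrow> w x = 0" for w
  proof (subst AE_density)
    show "AE x in Q. 0 < ennreal (w x) \<longrightarrow> 0 \<le> x"
      using w by (intro AE_I2) (metis ennreal_0 less_irrefl not_le)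
  qed measurable
  have fin1: "(\<integral>\<^sup>+x. ennreal (1 + x) \<partial>density Q (\<lambda>x. ennreal (w x))) < \<infinity>"
    if [measurable]: "w \<in> borel_measurable borel" and w: "\<And>x. 0 \<le> w x" "\<And>x. w x \<le> wp x + wn x" "\<And>x. x < 0 \<Longrightarrow> w x = 0" for w
    using bnd[OF w] by (subst nn_integral_density) auto
  have props: "finite_borel_measure R \<and> integrable R (\<lambda>x. x)"
    if R: "sets R = sets borel" "AE x in R. 0 \<le> x" "(\<integral>\<^sup>+x. ennreal (1 + x) \<partial>R) < \<infinity>" for R :: "real measure"
  proof
    have [simp]: "space R = UNIV" using sets_eq_imp_space_eq[OF R(1)] by simp
    note [measurable_cong] = R(1)
    have "emeasure R UNIV = (\<integral>\<^sup>+x. 1 \<partial>R)" by simp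
    also have "\<dots> \<le> (\<integral>\<^sup>+x. ennreal (1 + x) \<partial>R)"
      by (rule nn_integral_mono_AE, rule eventually_mono[OF R(2)]) simp
    finally have "emeasure R UNIV < \<infinity>" using R(3) by simp
    then show "finite_borel_measure R"
      using R(1) by (auto simp: finite_borel_measure_def finite_borel_measure_axioms_def intro!: finite_measureI)
    show "integrable R (\<lambda>x. x)"
    proof (rule integrableI_bounded)
      have "(\<integral>\<^sup>+x. ennreal (norm x) \<partial>R) \<le> (\<integral>\<^sup>+x. ennreal (1 + x) \<partial>R)"
        by (rule nn_integral_mono_AE, rule eventually_mono[OF R(2)]) (auto intro!: ennreal_leI)
      then show "(\<integral>\<^sup>+x. ennreal (norm x) \<partial>R) < \<infinity>" using R(3) by simp
    qed (use R(1) in simp)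
  qed
  have AE_PN: "AE x in P. 0 \<le> x" "AE x in N. 0 \<le> x"
    unfolding P_def N_def by (rule AEP; simp add: wbp wbn)+
  have pP: "finite_borel_measure P \<and> integrable P (\<lambda>x. x)"
    by (rule props[OF sPN(1) AE_PN(1)]) (unfold P_def, rule fin1, simp_all add: wn0 wbp)
  have pN: "finite_borel_measure N \<and> integrable N (\<lambda>x. x)"
    by (rule props[OF sPN(2) AE_PN(2)]) (unfold N_def, rule fin1, simp_all add: wn0 wbn)
  interpret P: finite_borel_measure P using pP by simp
  interpret N: finite_borel_measure N using pN by simp
  show ?thesis
  proof (rule that[of P N])
    fix C f assume f0: "exp_dominated C f"
    note [measurable] = exp_dominated_measurable[OF f0]
    define g where "g x = indicator {0..} x * f x" for x
    have f: "exp_dominated C g"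
      unfolding exp_dominated_def g_def[abs_def]
    proof (intro conjI allI)
      fix u
      have "\<bar>f u\<bar> \<le> C * exp (- u)" using f0 by (simp add: exp_dominated_def)
      then show "\<bar>indicator {0..} u * f u\<bar> \<le> C * exp (- u)"
        using exp_dominated_nonneg[OF f0] by (auto split: split_indicator)
    qed measurable
    note [measurable] = exp_dominated_measurable[OF f]
    have gb: "\<bar>g x\<bar> \<le> C" for x
      using exp_dominated_const_le[OF f, of x] exp_dominated_nonneg[OF f] by (cases "0 \<le> x") (simp_all add: g_def)
    have iP: "integrable P g" by (rule P.integrable_const_bound[where B = C]) (use gb in auto)
    have iN: "integrable N g" by (rule N.integrable_const_bound[where B = C]) (use gb in auto)
    have iPQ: "integrable Q (\<lambda>x. wp x * g x)" "(LINT x|P. g x) = (LINT x|Q. wp x * g x)"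
      using iP density_real[of g Q wp] wn0 unfolding P_def by simp_all
    have iNQ: "integrable Q (\<lambda>x. wn x * g x)" "(LINT x|N. g x) = (LINT x|Q. wn x * g x)"
      using iN density_real[of g Q wn] wn0 unfolding N_def by simp_all
    have "(LINT x|intensity. f x) = (LINT x|intensity. g x)"
    proof (rule integral_cong_AE)
      show "AE x in intensity. f x = g x"
        by (rule eventually_mono[OF AE_intensity_nonneg]) (simp add: g_def)
    qed measurable
    moreover have "(LINT x|P. f x) = (LINT x|P. g x)"
    proof (rule integral_cong_AE)
      show "AE x in P. f x = g x" by (rule eventually_mono[OF AE_PN(1)]) (simp add: g_def)
    qed measurable
    moreover have "(LINT x|N. f x) = (LINT x|N. g x)"
    proof (rule integral_cong_AE)
      show "AE x in N. f x = g x" by (rule eventually_mono[OF AE_PN(2)]) (simp add: g_def)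
    qed measurable
    moreover have "(LINT y|lborel. indicator {0..} y * f y) = (LINT y|lborel. indicator {0..} y * g y)"
      by (intro Bochner_Integration.integral_cong) (auto simp: g_def split: split_indicator)
    moreover have "(LINT x|intensity. g x) - (LINT y|lborel. indicator {0..} y * g y) / mean
        = (LINT x|Q. d1 x * g x - d2 x * g x)"
      using i1[OF f] i2[OF f] by simp
    moreover have "(LINT x|Q. d1 x * g x - d2 x * g x) = (LINT x|Q. wp x * g x - wn x * g x)"
      by (intro Bochner_Integration.integral_cong)
         (auto simp: wp_def wn_def g_def max_def algebra_simps split: split_indicator)
    moreover have "(LINT x|Q. wp x * g x - wn x * g x) = (LINT x|P. g x) - (LINT x|N. g x)"
      using iPQ iNQ by simp
    ultimately show "(LINT x|intensity. f x) - (LINT y|lborel. indicator {0..} y * f y) / mean = (LINT x|P. f x) - (LINT x|N. f x)"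
      by simp
  qed (use pP pN AE_PN in auto)
qed

end

section \<open>The limit constant\<close>

text \<open>By Fubini the integral of the tail of a measure is its first moment.\<close>
lemma integrable_tail:
  fixes R :: "real measure"
  assumes "finite_borel_measure R" "integrable R (\<lambda>x. x)"
  shows "integrable lborel (\<lambda>t. indicator {0..} t * measure R {t<..})"
proof -
  interpret R: finite_borel_measure R by fact
  interpret p: pair_sigma_finite R lborel ..
  note [measurable_cong] = R.M_is_borel
  have sp: "space R = UNIV" by (rule R.borel_UNIV)
  have inner: "integrable lborel (\<lambda>t. if 0 \<le> t \<and> t < x then 1 else (0 :: real))
      \<and> (LINT t|lborel. (if 0 \<le> t \<and> t < x then 1 else (0 :: real))) = max x 0" for x :: real
  proof -
    have "(\<lambda>t. if 0 \<le> t \<and> t < x then 1 else (0 :: real)) = indicator {0..<x}" by (auto split: split_indicator)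
    then show ?thesis by (cases "0 \<le> x") (auto simp: max_def)
  qed
  have "integrable (R \<Otimes>\<^sub>M lborel) (\<lambda>(x, t). if 0 \<le> t \<and> t < x then 1 else (0 :: real))"
  proof (rule p.Fubini_integrable)
    show "integrable R (\<lambda>x. LINT t|lborel. norm (case (x, t) of (x, t) \<Rightarrow> (if 0 \<le> t \<and> t < x then 1 else (0 :: real))))"
      using assms(2) inner by (simp add: if_distrib[of abs] cong: if_cong)
  qed (use inner in auto)
  from p.integrable_snd[OF this]
  have "integrable lborel (\<lambda>t. LINT x|R. (if 0 \<le> t \<and> t < x then 1 else (0 :: real)))" by simp
  also have "(\<lambda>t. LINT x|R. (if 0 \<le> t \<and> t < x then 1 else (0 :: real))) = (\<lambda>t. indicator {0..} t * measure R {t<..})"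
  proof
    fix t :: real
    have "(\<lambda>x. if 0 \<le> t \<and> t < x then 1 else (0 :: real)) = (\<lambda>x. indicator {0..} t * indicator {t<..} x)"
      by (auto split: split_indicator)
    then show "(LINT x|R. (if 0 \<le> t \<and> t < x then 1 else (0 :: real))) = indicator {0..} t * measure R {t<..}"
      by (simp add: sp)
  qed
  finally show ?thesis .
qed

text \<open>The decomposition just obtained, held fixed so that its total masses and tails can be
  named.\<close>
locale renewal_deviation = renewal_setting +
  fixes P N :: "real measure"
  assumes P: "finite_borel_measure P" and N: "finite_borel_measure N"
    and P_nonneg: "AE x in P. 0 \<le> x" and N_nonneg: "AE x in N. 0 \<le> x"
    and P_mean: "integrable P (\<lambda>x. x)" and N_mean: "integrable N (\<lambda>x. x)"
    and deviation: "\<And>C f. exp_dominated C f \<Longrightarrow>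
      (LINT x|intensity. f x) - (LINT y|lborel. indicator {0..} y * f y) / mean = (LINT x|P. f x) - (LINT x|N. f x)"
begin

sublocale P: finite_borel_measure P by (rule P)
sublocale N: finite_borel_measure N by (rule N)

definition gamma :: real where "gamma = measure P UNIV - measure N UNIV"

definition tail :: "real \<Rightarrow> real" where
  "tail t = indicator {0..} t * measure P {t<..} + indicator {0..} t * measure N {t<..}"

lemma integrable_tail_sum: "integrable lborel tail"
  unfolding tail_def[abs_def]
  by (intro Bochner_Integration.integrable_add integrable_tail P N P_mean N_mean)

lemma exp_dominated_bounded_support:
  assumes [measurable]: "f \<in> borel_measurable borel"
    and "\<And>y. y < 0 \<Longrightarrow> f y = 0" "\<And>y. T < y \<Longrightarrow> f y = 0" "\<And>y. \<bar>f y\<bar> \<le> K"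
  shows "exp_dominated (K * exp T) f"
  unfolding exp_dominated_def
proof (intro conjI allI)
  fix u
  have K: "0 \<le> K" using assms(4)[of 0] by linarith
  show "\<bar>f u\<bar> \<le> K * exp T * exp (- u)"
  proof (cases "u \<le> T")
    case True
    then have "K * 1 \<le> K * exp (T - u)" using K by (intro mult_left_mono) auto
    moreover have "K * exp (T - u) = K * exp T * exp (- u)" by (simp add: exp_diff exp_minus divide_inverse)
    ultimately show ?thesis using assms(4)[of u] by linarith
  qed (use assms(3) K in simp)
qed measurable

lemma measure_nonneg_part:
  assumes R: "finite_borel_measure R" "AE x in R. 0 \<le> x"
  shows "measure R {0..} = measure R UNIV" "0 \<le> t \<Longrightarrow> measure R UNIV = measure R {0..t} + measure R {t<..}"
proof -
  interpret R: finite_borel_measure R by fact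
  show 1: "measure R {0..} = measure R UNIV"
    using R(2) by (intro R.finite_measure_eq_AE) auto
  assume "0 \<le> t"
  have "measure R {0..} = measure R ({0..t} \<union> {t<..})"
    using \<open>0 \<le> t\<close> by (intro arg_cong[where f = "measure R"]) auto
  also have "\<dots> = measure R {0..t} + measure R {t<..}"
    by (rule R.finite_measure_Union) auto
  finally show "measure R UNIV = measure R {0..t} + measure R {t<..}" using 1 by simp
qed

lemma V_atLeastAtMost: "V t = measure intensity {0..t}"
  unfolding V_def measure_def using AE_intensity_nonneg
  by (intro arg_cong[where f = enn2real] emeasure_eq_AE) auto

lemma V_deviation:
  assumes "0 \<le> t"
  shows "V t - t / mean = measure P {0..t} - measure N {0..t}"
proof -
  have e: "exp_dominated (1 * exp t) (indicator {0..t})"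
    by (rule exp_dominated_bounded_support) (auto split: split_indicator)
  have "(LINT y|lborel. indicator {0..} y * (indicator {0..t} y :: real)) = t"
  proof -
    have "(LINT y|lborel. indicator {0..} y * (indicator {0..t} y :: real)) = (LINT y|lborel. indicator {0..t} y)"
      by (intro Bochner_Integration.integral_cong) (auto split: split_indicator)
    then show ?thesis using assms by simp
  qed
  moreover have "space intensity = UNIV" using sets_eq_imp_space_eq[OF sets_intensity] by simp
  ultimately show ?thesis
    using deviation[OF e] by (simp add: V_atLeastAtMost P.borel_UNIV N.borel_UNIV)
qed

lemma V_tail:
  assumes "0 \<le> t"
  shows "\<bar>V t - t / mean - gamma\<bar> \<le> tail t"
proof -
  have "tail t = measure P {t<..} + measure N {t<..}" using assms by (simp add: tail_def)
  moreover have "V t - t / mean - gamma = measure N {t<..} - measure P {t<..}"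
    using V_deviation[OF assms] measure_nonneg_part(2)[OF P P_nonneg assms]
      measure_nonneg_part(2)[OF N N_nonneg assms] unfolding gamma_def by linarith
  moreover have "0 \<le> measure P {t<..}" "0 \<le> measure N {t<..}" by simp_all
  ultimately show ?thesis by linarith
qed

lemma has_LS_total_mass_V: "has_LS_total_mass (\<lambda>y. V y - y / mean) gamma"
  unfolding has_LS_total_mass_def
  using P N V_deviation measure_nonneg_part(1)[OF P P_nonneg] measure_nonneg_part(1)[OF N N_nonneg]
  by (intro exI[of _ P] exI[of _ N]) (auto simp: gamma_def)

lemma tendsto_V: "((\<lambda>t. V t - t / mean) \<longlongrightarrow> gamma) at_top"
proof -
  have cdf: "measure R {0..t} = cdf R t" if "finite_borel_measure R" "AE x in R. 0 \<le> x" for R t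
  proof -
    interpret R: finite_borel_measure R by fact
    show ?thesis unfolding cdf_def using that(2) by (intro R.finite_measure_eq_AE) auto
  qed
  have "((\<lambda>t. cdf P t - cdf N t) \<longlongrightarrow> gamma) at_top"
    unfolding gamma_def using P.cdf_lim_at_top N.cdf_lim_at_top
    by (intro tendsto_diff) (simp_all add: P.borel_UNIV N.borel_UNIV)
  moreover have "eventually (\<lambda>t. cdf P t - cdf N t = V t - t / mean) at_top"
    using eventually_ge_at_top[of 0]
    by eventually_elim (simp add: V_deviation cdf[OF P P_nonneg] cdf[OF N N_nonneg])
  ultimately show ?thesis by (rule Lim_transform_eventually)
qed

definition mass :: real where "mass = measure P UNIV + measure N UNIV"

lemma deviation_bound:
  assumes f: "f \<in> borel_measurable borel" "\<And>y. y < 0 \<Longrightarrow> f y = 0" "\<And>y. T < y \<Longrightarrow> f y = 0" "\<And>y. \<bar>f y\<bar> \<le> K"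
  shows "\<bar>(LINT x|intensity. f x) - (LINT y|lborel. indicator {0..} y * f y) / mean\<bar> \<le> mass * K"
proof -
  note [measurable] = f(1)
  have b: "\<bar>LINT x|R. f x\<bar> \<le> measure R UNIV * K" if "finite_borel_measure R" for R
  proof -
    interpret R: finite_borel_measure R by fact
    note [measurable_cong] = R.M_is_borel
    have "\<bar>LINT x|R. f x\<bar> \<le> (LINT x|R. K)" by (rule abs_integral_le) (use f(4) in simp_all)
    then show ?thesis by (simp add: R.borel_UNIV)
  qed
  show ?thesis
    using deviation[OF exp_dominated_bounded_support[OF f]] b[OF P] b[OF N]
    by (simp add: mass_def distrib_right)
qed

text \<open>Test the deviation with the function \<open>f\<close> whose potential is \<open>(T - x)\<^sup>+\<close>, that is with \<open>f x
  = E min \<xi> (T - x)\<^sup>+\<close>. As \<open>T\<close> tends to infinity \<open>f\<close> increases to the constant \<open>mean\<close>, so that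
  its integral against the deviation tends to \<open>mean * gamma\<close>. On the other hand the two
  integrals of \<open>f\<close> are explicit, and after cancellation of \<open>T\<close> they leave \<open>E (\<xi>^2 / 2) / mean -
  E \<eta>\<close> in the limit.\<close>
lemma gamma_eq: "gamma = second_moment / (2 * mean ^ 2) - (LINT y|\<nu>. y) / mean"
proof -
  define h where "h T x = max (T - x) 0" for T x :: real
  define f where "f T x = h T x - step (h T) x" for T x
  have h_dom: "exp_dominated (exp T) (h T)" for T
    unfolding exp_dominated_def h_def[abs_def]
  proof (intro conjI allI)
    fix u
    have "T - u \<le> exp (T - u)" using exp_ge_add_one_self[of "T - u"] by linarith
    then show "\<bar>max (T - u) 0\<bar> \<le> exp T * exp (- u)" by (simp add: exp_diff exp_minus field_simps)
  qed measurable
  have f_dom: "exp_dominated (exp T + exp T * rho) (f T)" for T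
    unfolding f_def[abs_def] by (rule exp_dominated_diff[OF h_dom exp_dominated_step[OF h_dom]])
  have pot: "potential (f T) = h T" for T
    unfolding f_def[abs_def] by (rule potential_unique[OF h_dom])
  note \<nu>1 = \<nu>.square_integrable_imp_integrable[OF _ \<nu>_square]
  have int_\<nu>: "integrable \<nu> (\<lambda>y. y)" by (rule \<nu>1) simp
  \<comment> \<open>The integral of \<open>h T\<close> over \<open>[0,s]\<close> is \<open>s * T - J T s\<close>.\<close>
  define J where "J T s = (LINT y|lborel. indicator {0..s} y * min y T)" for T s :: real
  have [measurable]: "J T \<in> borel_measurable borel" for T unfolding J_def[abs_def] by measurable
  have sq: "has_bochner_integral lborel (\<lambda>y. indicator {0..s} y * y) (s ^ 2 / 2)" if "0 \<le> s" for s :: real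
  proof -
    have "has_bochner_integral lborel (\<lambda>y. y * indicator {0..s} y) (s ^ 2 / 2 - 0 ^ 2 / 2)"
      using that by (intro has_bochner_integral_FTC_Icc_real) (auto intro!: derivative_eq_intros)
    then show ?thesis by (simp add: mult.commute)
  qed
  have ind_min: "integrable lborel (\<lambda>y. indicator {0..s} y * min y T)" for s T :: real
  proof (rule Bochner_Integration.integrable_bound)
    show "integrable lborel (\<lambda>y. indicator {0..s} y * (\<bar>s\<bar> + \<bar>T\<bar>))"
      by (cases "0 \<le> s") auto
    show "AE y in lborel. norm (indicator {0..s} y * min y T) \<le> norm (indicator {0..s} y * (\<bar>s\<bar> + \<bar>T\<bar>))"
      by (auto split: split_indicator)
  qed measurable
  have J_bound: "\<bar>J T s\<bar> \<le> s ^ 2" if "0 \<le> T" "0 \<le> s" for T s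
  proof -
    have "0 \<le> J T s" unfolding J_def
      using that by (intro integral_nonneg_AE AE_I2) (auto split: split_indicator)
    moreover have "J T s \<le> (LINT y|lborel. indicator {0..s} y * y)"
      unfolding J_def using ind_min sq[OF that(2)]
      by (intro integral_mono) (auto split: split_indicator simp: has_bochner_integral_iff)
    moreover have "(LINT y|lborel. indicator {0..s} y * y) = s ^ 2 / 2"
      using sq[OF that(2)] by (rule has_bochner_integral_integral_eq)
    ultimately show ?thesis using zero_le_power2[of s] by linarith
  qed
  have J_eq: "J T s = s ^ 2 / 2" if "0 \<le> s" "s \<le> T" for T s
  proof -
    have "J T s = (LINT y|lborel. indicator {0..s} y * y)"
      unfolding J_def using that by (intro Bochner_Integration.integral_cong) (auto split: split_indicator)
    then show ?thesis using has_bochner_integral_integral_eq[OF sq[OF that(1)]] by simp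
  qed
  have J_int: "integrable \<mu> (J T)" if "0 \<le> T" for T
  proof (rule Bochner_Integration.integrable_bound[OF integrable_square])
    show "AE s in \<mu>. norm (J T s) \<le> norm (s ^ 2)"
      by (rule eventually_mono[OF pos]) (use J_bound[OF that] in simp)
  qed measurable
  have lhs: "(LINT x|intensity. f T x) - (LINT y|lborel. indicator {0..} y * f T y) / mean
      = (LINT s|\<mu>. J T s) / mean - (LINT y|\<nu>. min y T)" if T: "0 \<le> T" for T
  proof -
    have "(LINT x|intensity. f T x) = (LINT y|\<nu>. h T y)"
      using integral_intensity(2)[OF f_dom] by (simp add: pot)
    also have "\<dots> = (LINT y|\<nu>. T - min y T)"
      by (intro Bochner_Integration.integral_cong) (auto simp: h_def min_def max_def)
    also have "\<dots> = T - (LINT y|\<nu>. min y T)"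
      using int_\<nu> by (subst Bochner_Integration.integral_diff) (auto simp: \<nu>.prob_space[simplified])
    finally have 1: "(LINT x|intensity. f T x) = T - (LINT y|\<nu>. min y T)" .
    have "(LINT y|lborel. indicator {0..} y * f T y) = (LINT s|\<mu>. LINT y|lborel. indicator {0..s} y * h T y)"
      using integral_potential[OF f_dom] by (simp add: pot)
    also have "\<dots> = (LINT s|\<mu>. s * T - J T s)"
    proof (rule integral_cong_AE)
      show "AE s in \<mu>. (LINT y|lborel. indicator {0..s} y * h T y) = s * T - J T s"
      proof (rule eventually_mono[OF pos])
        fix s :: real assume s: "0 < s"
        have ic: "integrable lborel (\<lambda>y. indicator {0..s} y * T)"
          using s by (intro integrable_mult_left integrable_real_indicator) auto
        have "(LINT y|lborel. indicator {0..s} y * h T y) = (LINT y|lborel. indicator {0..s} y * T - indicator {0..s} y * min y T)"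
          by (intro Bochner_Integration.integral_cong) (auto simp: h_def min_def max_def split: split_indicator)
        also have "\<dots> = s * T - J T s"
          unfolding J_def using ic ind_min s by (subst Bochner_Integration.integral_diff) auto
        finally show "(LINT y|lborel. indicator {0..s} y * h T y) = s * T - J T s" .
      qed
      have "h T \<in> borel_measurable borel" by (rule exp_dominated_measurable[OF h_dom])
      then show "(\<lambda>s. LINT y|lborel. indicator {0..s} y * h T y) \<in> borel_measurable \<mu>" by measurable
    qed measurable
    also have "\<dots> = mean * T - (LINT s|\<mu>. J T s)"
      using J_int[OF T] integrable_id by (subst Bochner_Integration.integral_diff) (auto simp: mean_def)
    finally show ?thesis unfolding 1 using mean_pos by (simp add: diff_divide_distrib)
  qed
  have f_eq: "f T x = (LINT s|\<mu>. h T x - h T (x + s))" for T x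
    unfolding f_def step_def using exp_dominated_integrable[OF h_dom]
    by (subst Bochner_Integration.integral_diff) (auto simp: prob_space[simplified])
  have hd: "0 \<le> h T x - h T (x + s)" "h T x - h T (x + s) \<le> s" if "0 < s" for T x s
    using that by (auto simp: h_def)
  have f_bound: "\<bar>f T x\<bar> \<le> mean" for T x
  proof -
    have "0 \<le> f T x" unfolding f_eq
      by (rule integral_nonneg_AE, rule eventually_mono[OF pos]) (rule hd)
    moreover have "f T x \<le> mean" unfolding f_eq mean_def
    proof (rule integral_mono_AE)
      show "integrable \<mu> (\<lambda>s. h T x - h T (x + s))" using exp_dominated_integrable[OF h_dom] by simp
      show "AE s in \<mu>. h T x - h T (x + s) \<le> s" by (rule eventually_mono[OF pos]) (rule hd)
    qed (rule integrable_id)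
    ultimately show ?thesis by simp
  qed
  have f_lim: "(\<lambda>n. f (real n) x) \<longlonglongrightarrow> mean" for x
    unfolding f_eq mean_def
  proof (rule integral_dominated_convergence[where w = "\<lambda>s. \<bar>s\<bar>"])
    show "integrable \<mu> (\<lambda>s. \<bar>s\<bar>)" using integrable_id by simp
    show "AE s in \<mu>. (\<lambda>n. h (real n) x - h (real n) (x + s)) \<longlonglongrightarrow> s"
    proof (rule eventually_mono[OF pos])
      fix s :: real assume "0 < s"
      have "eventually (\<lambda>n. h (real n) x - h (real n) (x + s) = s) sequentially"
        using eventually_ge_at_top[of "nat \<lceil>x + s\<rceil>"]
      proof eventually_elim
        case (elim n)
        then have "x + s \<le> real n" by linarith
        then show ?case using \<open>0 < s\<close> by (simp add: h_def)
      qed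
      then show "(\<lambda>n. h (real n) x - h (real n) (x + s)) \<longlonglongrightarrow> s"
        by (rule tendsto_eventually)
    qed
    show "AE s in \<mu>. norm (h (real n) x - h (real n) (x + s)) \<le> \<bar>s\<bar>" for n
    proof (rule eventually_mono[OF pos])
      fix s :: real assume "0 < s"
      then show "norm (h (real n) x - h (real n) (x + s)) \<le> \<bar>s\<bar>"
        using hd[of s "real n" x] by simp
    qed
    have [measurable]: "h T \<in> borel_measurable borel" for T by (rule exp_dominated_measurable[OF h_dom])
    show "(\<lambda>s. h (real n) x - h (real n) (x + s)) \<in> borel_measurable \<mu>" for n by measurable
  qed simp
  have R_lim: "(\<lambda>n. LINT x|R. f (real n) x) \<longlonglongrightarrow> mean * measure R UNIV" if "finite_borel_measure R" for R
  proof -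
    interpret R: finite_borel_measure R by fact
    note [measurable_cong] = R.M_is_borel
    have "(\<lambda>n. LINT x|R. f (real n) x) \<longlonglongrightarrow> (LINT x|R. mean)"
    proof (rule integral_dominated_convergence[where w = "\<lambda>s. mean"])
      show "f (real n) \<in> borel_measurable R" for n
        using exp_dominated_measurable[OF f_dom] by simp
      show "AE x in R. (\<lambda>n. f (real n) x) \<longlonglongrightarrow> mean" by (intro AE_I2 f_lim)
      show "AE x in R. norm (f (real n) x) \<le> mean" for n by (intro AE_I2) (use f_bound in simp)
    qed simp_all
    then show ?thesis by (simp add: R.borel_UNIV mult.commute)
  qed
  have right: "(\<lambda>n. (LINT x|P. f (real n) x) - (LINT x|N. f (real n) x)) \<longlonglongrightarrow> mean * gamma"
    unfolding gamma_def right_diff_distrib by (rule tendsto_diff[OF R_lim[OF P] R_lim[OF N]])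
  have J_lim: "(\<lambda>n. LINT s|\<mu>. J (real n) s) \<longlonglongrightarrow> (LINT s|\<mu>. s ^ 2 / 2)"
  proof (rule integral_dominated_convergence[where w = "\<lambda>s. s ^ 2"])
    show "AE s in \<mu>. (\<lambda>n. J (real n) s) \<longlonglongrightarrow> s ^ 2 / 2"
    proof (rule eventually_mono[OF pos])
      fix s :: real assume "0 < s"
      have "eventually (\<lambda>n. J (real n) s = s ^ 2 / 2) sequentially"
        using eventually_ge_at_top[of "nat \<lceil>s\<rceil>"]
      proof eventually_elim
        case (elim n)
        then have "s \<le> real n" by linarith
        then show ?case using \<open>0 < s\<close> by (intro J_eq) auto
      qed
      then show "(\<lambda>n. J (real n) s) \<longlonglongrightarrow> s ^ 2 / 2" by (rule tendsto_eventually)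
    qed
    show "AE s in \<mu>. norm (J (real n) s) \<le> s ^ 2" for n
    proof (rule eventually_mono[OF pos])
      fix s :: real assume "0 < s"
      then show "norm (J (real n) s) \<le> s ^ 2" using J_bound[of "real n" s] by simp
    qed
    show "integrable \<mu> (\<lambda>s. s ^ 2)" by (rule integrable_square)
  qed measurable
  have min_lim: "(\<lambda>n. LINT y|\<nu>. min y (real n)) \<longlonglongrightarrow> (LINT y|\<nu>. y)"
  proof (rule integral_dominated_convergence[where w = "\<lambda>y. \<bar>y\<bar>"])
    show "AE y in \<nu>. (\<lambda>n. min y (real n)) \<longlonglongrightarrow> y"
    proof (rule AE_I2)
      fix y
      have "eventually (\<lambda>n. min y (real n) = y) sequentially"
        using eventually_ge_at_top[of "nat \<lceil>y\<rceil>"]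
      proof eventually_elim
        case (elim n)
        then have "y \<le> real n" by linarith
        then show ?case by simp
      qed
      then show "(\<lambda>n. min y (real n)) \<longlonglongrightarrow> y" by (rule tendsto_eventually)
    qed
    show "integrable \<nu> (\<lambda>y. \<bar>y\<bar>)" using int_\<nu> by simp
    show "AE y in \<nu>. norm (min y (real n)) \<le> \<bar>y\<bar>" for n
      by (intro AE_I2) (simp add: min_def)
  qed measurable
  have "(\<lambda>n. (LINT s|\<mu>. J (real n) s) / mean - (LINT y|\<nu>. min y (real n)))
      \<longlonglongrightarrow> (LINT s|\<mu>. s ^ 2 / 2) / mean - (LINT y|\<nu>. y)"
    using mean_pos by (intro tendsto_intros J_lim min_lim) simp
  moreover have "(LINT s|\<mu>. J (real n) s) / mean - (LINT y|\<nu>. min y (real n))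
      = (LINT x|P. f (real n) x) - (LINT x|N. f (real n) x)" for n
    using lhs[of "real n"] deviation[OF f_dom, of "real n"] by simp
  ultimately have "(\<lambda>n. (LINT x|P. f (real n) x) - (LINT x|N. f (real n) x))
      \<longlonglongrightarrow> (LINT s|\<mu>. s ^ 2 / 2) / mean - (LINT y|\<nu>. y)" by simp
  from LIMSEQ_unique[OF right this]
  have "mean * gamma = second_moment / (2 * mean) - (LINT y|\<nu>. y)"
    by (simp add: second_moment_def)
  then have "gamma = (second_moment / (2 * mean) - (LINT y|\<nu>. y)) / mean"
    using mean_pos by (simp add: eq_divide_eq mult.commute)
  then show ?thesis by (simp add: diff_divide_distrib power2_eq_square)
qed

end

section \<open>Convolution on half-lines\<close>

text \<open>Functions and measures that live on some half-line, not necessarily on \<open>[0,\<infinity>)\<close>: the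
  measure \<open>model\<close> below starts at a negative point if the limit constant is positive.
  Convolutions then involve bounded ranges only, so that Fubini applies and the convolution
  operators commute.\<close>
definition half_line_function :: "(real \<Rightarrow> real) \<Rightarrow> bool" where
  "half_line_function f \<longleftrightarrow> f \<in> borel_measurable borel \<and> (\<exists>c. \<forall>s<c. f s = 0) \<and> (\<forall>T. \<exists>K. \<forall>s\<le>T. \<bar>f s\<bar> \<le> K)"

definition half_line_measure :: "real measure \<Rightarrow> bool" where
  "half_line_measure \<kappa> \<longleftrightarrow> sets \<kappa> = sets borel \<and> (\<exists>c. AE y in \<kappa>. c \<le> y) \<and> (\<forall>t. emeasure \<kappa> {..t} < \<infinity>)"

definition conv :: "real measure \<Rightarrow> (real \<Rightarrow> real) \<Rightarrow> real \<Rightarrow> real" where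
  "conv \<kappa> f t = (LINT y|\<kappa>. f (t - y))"

lemma half_line_function_measurable: "half_line_function f \<Longrightarrow> f \<in> borel_measurable borel"
  by (simp add: half_line_function_def)

lemma half_line_function_bound:
  assumes "half_line_function f"
  obtains K where "0 \<le> K" "\<And>s. s \<le> T \<Longrightarrow> \<bar>f s\<bar> \<le> K"
proof -
  obtain K where K: "\<And>s. s \<le> T \<Longrightarrow> \<bar>f s\<bar> \<le> K"
    using assms unfolding half_line_function_def by blast
  have "0 \<le> K" using K[of T] by linarith
  then show ?thesis using K by (rule that)
qed

lemma half_line_function_diff:
  assumes f: "half_line_function f" and g: "half_line_function g"
  shows "half_line_function (\<lambda>t. f t - g t)"
  unfolding half_line_function_def
proof (intro conjI allI)
  show "(\<lambda>t. f t - g t) \<in> borel_measurable borel"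
    using f g by (auto simp: half_line_function_def)
  obtain c d where "\<forall>s<c. f s = 0" "\<forall>s<d. g s = 0"
    using f g by (auto simp: half_line_function_def)
  then show "\<exists>c. \<forall>s<c. f s - g s = 0" by (intro exI[of _ "min c d"]) auto
  fix T
  obtain K where K: "\<And>s. s \<le> T \<Longrightarrow> \<bar>f s\<bar> \<le> K" using half_line_function_bound[OF f, of T] by blast
  obtain L where L: "\<And>s. s \<le> T \<Longrightarrow> \<bar>g s\<bar> \<le> L" using half_line_function_bound[OF g, of T] by blast
  have "\<bar>f s - g s\<bar> \<le> K + L" if "s \<le> T" for s using K[OF that] L[OF that] by linarith
  then show "\<exists>K. \<forall>s\<le>T. \<bar>f s - g s\<bar> \<le> K" by blast
qed

lemma half_line_measure_sigma_finite: "half_line_measure \<kappa> \<Longrightarrow> sigma_finite_measure \<kappa>"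
  by (rule sigma_finite_atMost) (auto simp: half_line_measure_def)

lemma half_line_indicator:
  assumes "half_line_measure \<kappa>"
  shows "integrable \<kappa> (\<lambda>y. indicator {..s} y * (K::real))"
proof -
  have "integrable \<kappa> (indicator {..s} :: real \<Rightarrow> real)"
    using assms by (intro integrable_real_indicator) (auto simp: half_line_measure_def)
  then show ?thesis by simp
qed

lemma conv_integrable:
  assumes f: "half_line_function f" and \<kappa>: "half_line_measure \<kappa>"
  shows "integrable \<kappa> (\<lambda>y. f (t - y))"
proof -
  obtain c where c: "\<And>s. s < c \<Longrightarrow> f s = 0" using f by (auto simp: half_line_function_def)
  obtain d where d: "AE y in \<kappa>. d \<le> y" using \<kappa> by (auto simp: half_line_measure_def)
  obtain K where K: "0 \<le> K" "\<And>s. s \<le> t - d \<Longrightarrow> \<bar>f s\<bar> \<le> K" using half_line_function_bound[OF f, of "t - d"] by blast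
  note [measurable] = half_line_function_measurable[OF f]
  have sets[measurable_cong]: "sets \<kappa> = sets borel" using \<kappa> by (simp add: half_line_measure_def)
  show ?thesis
  proof (rule Bochner_Integration.integrable_bound[OF half_line_indicator[OF \<kappa>, of "t - c" K]])
    show "AE y in \<kappa>. norm (f (t - y)) \<le> norm (indicator {..t - c} y * K)"
    proof (rule eventually_mono[OF d])
      fix y assume "d \<le> y"
      then have "\<bar>f (t - y)\<bar> \<le> K" by (intro K) simp
      moreover have "f (t - y) = 0" if "\<not> y \<le> t - c" using that by (intro c) simp
      ultimately show "norm (f (t - y)) \<le> norm (indicator {..t - c} y * K)"
        using K(1) by (auto split: split_indicator)
    qed
  qed measurable
qed

lemma conv_vanishes:
  assumes c: "\<And>s. s < c \<Longrightarrow> f s = 0" and d: "AE y in \<kappa>. d \<le> y" and t: "t < c + d"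
  shows "conv \<kappa> f t = 0"
  unfolding conv_def
  by (rule integral_eq_zero_AE, rule eventually_mono[OF d], rule c) (use t in simp)

lemma conv_le:
  assumes f: "half_line_function f" and \<kappa>: "half_line_measure \<kappa>"
    and c: "\<And>s. s < c \<Longrightarrow> f s = 0" and d: "AE y in \<kappa>. d \<le> y"
    and K: "\<And>s. s \<le> T - d \<Longrightarrow> \<bar>f s\<bar> \<le> K" and t: "t \<le> T"
  shows "\<bar>conv \<kappa> f t\<bar> \<le> measure \<kappa> {..T - c} * K"
proof -
  have [simp]: "space \<kappa> = UNIV" using \<kappa> sets_eq_imp_space_eq[of \<kappa> borel] by (simp add: half_line_measure_def)
  have K0: "0 \<le> K" using K[of "T - d"] by simp
  have "\<bar>conv \<kappa> f t\<bar> \<le> (LINT y|\<kappa>. indicator {..T - c} y * K)"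
    unfolding conv_def
  proof (rule abs_integral_le[OF half_line_indicator[OF \<kappa>]])
    show "AE y in \<kappa>. \<bar>f (t - y)\<bar> \<le> indicator {..T - c} y * K"
    proof (rule eventually_mono[OF d])
      fix y assume "d \<le> y"
      then have "\<bar>f (t - y)\<bar> \<le> K" using t by (intro K) simp
      moreover have "f (t - y) = 0" if "\<not> y \<le> T - c" using that t by (intro c) simp
      ultimately show "\<bar>f (t - y)\<bar> \<le> indicator {..T - c} y * K"
        using K0 by (auto split: split_indicator)
    qed
  qed
  then show ?thesis by simp
qed

lemma half_line_function_conv:
  assumes f: "half_line_function f" and \<kappa>: "half_line_measure \<kappa>"
  shows "half_line_function (conv \<kappa> f)"
  unfolding half_line_function_def
proof (intro conjI allI)
  note [measurable] = half_line_function_measurable[OF f]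
  have sets[measurable_cong]: "sets \<kappa> = sets borel" using \<kappa> by (simp add: half_line_measure_def)
  interpret \<kappa>: sigma_finite_measure \<kappa> by (rule half_line_measure_sigma_finite[OF \<kappa>])
  show "conv \<kappa> f \<in> borel_measurable borel" unfolding conv_def[abs_def] by measurable
  obtain c where c: "\<And>s. s < c \<Longrightarrow> f s = 0" using f by (auto simp: half_line_function_def)
  obtain d where d: "AE y in \<kappa>. d \<le> y" using \<kappa> by (auto simp: half_line_measure_def)
  show "\<exists>c. \<forall>s<c. conv \<kappa> f s = 0" using conv_vanishes[of c f d \<kappa>] c d by blast
  fix T
  obtain K where K: "\<And>s. s \<le> T - d \<Longrightarrow> \<bar>f s\<bar> \<le> K" using half_line_function_bound[OF f, of "T - d"] by blast
  show "\<exists>K. \<forall>s\<le>T. \<bar>conv \<kappa> f s\<bar> \<le> K" using conv_le[OF f \<kappa> c d K] by blast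
qed

lemma conv_diff:
  assumes "half_line_function f" "half_line_function g" "half_line_measure \<kappa>"
  shows "conv \<kappa> (\<lambda>t. f t - g t) t = conv \<kappa> f t - conv \<kappa> g t"
  unfolding conv_def by (intro Bochner_Integration.integral_diff conv_integrable assms)

lemma conv_sum:
  assumes "\<And>k. k \<in> I \<Longrightarrow> half_line_function (f k)" "half_line_measure \<kappa>"
  shows "conv \<kappa> (\<lambda>t. \<Sum>k\<in>I. c k * f k t) t = (\<Sum>k\<in>I. c k * conv \<kappa> (f k) t)"
  unfolding conv_def using assms
  by (subst Bochner_Integration.integral_sum) (auto intro!: integrable_mult_right conv_integrable)

lemma double_conv_integrable:
  assumes f: "half_line_function f" and \<kappa>: "half_line_measure \<kappa>" and \<theta>: "half_line_measure \<theta>"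
  shows "integrable (\<kappa> \<Otimes>\<^sub>M \<theta>) (\<lambda>(y, z). f (t - y - z))"
proof -
  interpret \<kappa>: sigma_finite_measure \<kappa> by (rule half_line_measure_sigma_finite[OF \<kappa>])
  interpret \<theta>: sigma_finite_measure \<theta> by (rule half_line_measure_sigma_finite[OF \<theta>])
  interpret p: pair_sigma_finite \<kappa> \<theta> ..
  note [measurable] = half_line_function_measurable[OF f]
  have sets[measurable_cong]: "sets \<kappa> = sets borel" "sets \<theta> = sets borel"
    using \<kappa> \<theta> by (simp_all add: half_line_measure_def)
  have abs_f: "half_line_function (\<lambda>t. \<bar>f t\<bar>)"
    using f by (auto simp: half_line_function_def)
  show ?thesis
  proof (rule p.Fubini_integrable)
    show "AE y in \<kappa>. integrable \<theta> (\<lambda>z. case (y, z) of (y, z) \<Rightarrow> f (t - y - z))"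
      using conv_integrable[OF f \<theta>] by simp
    show "integrable \<kappa> (\<lambda>y. LINT z|\<theta>. norm (case (y, z) of (y, z) \<Rightarrow> f (t - y - z)))"
      using conv_integrable[OF half_line_function_conv[OF abs_f \<theta>] \<kappa>, of t] by (simp add: conv_def)
  qed measurable
qed

lemma conv_commute:
  assumes f: "half_line_function f" and \<kappa>: "half_line_measure \<kappa>" and \<theta>: "half_line_measure \<theta>"
  shows "conv \<kappa> (conv \<theta> f) t = conv \<theta> (conv \<kappa> f) t"
proof -
  interpret \<kappa>: sigma_finite_measure \<kappa> by (rule half_line_measure_sigma_finite[OF \<kappa>])
  interpret \<theta>: sigma_finite_measure \<theta> by (rule half_line_measure_sigma_finite[OF \<theta>])
  interpret p: pair_sigma_finite \<kappa> \<theta> ..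
  have "conv \<kappa> (conv \<theta> f) t = (LINT y|\<kappa>. LINT z|\<theta>. f (t - y - z))" by (simp add: conv_def)
  also have "\<dots> = (LINT z|\<theta>. LINT y|\<kappa>. f (t - y - z))"
    by (rule p.Fubini_integral[OF double_conv_integrable[OF assms], symmetric])
  also have "\<dots> = conv \<theta> (conv \<kappa> f) t" by (simp add: conv_def algebra_simps)
  finally show ?thesis .
qed

section \<open>Expansion of the convolution powers\<close>

context renewal_deviation
begin

text \<open>The shift for which \<open>(t + offset) / mean\<close> has the same asymptotics as \<open>V t\<close> up to \<open>o(1)\<close>.\<close>
definition offset :: real where "offset = mean * gamma"

text \<open>The measure with distribution function \<open>(t + offset)\<^sup>+ / mean\<close>. Its convolution powers are
  explicit and already show the asymptotics of the theorem, so it absorbs the constant \<open>gamma\<close>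
  whatever its sign.\<close>
definition model :: "real measure" where
  "model = density lborel (\<lambda>y::real. ennreal (indicator {- offset..} y / mean))"

lemma sets_model[simp, measurable_cong]: "sets model = sets borel" by (simp add: model_def)

lemma integral_model:
  assumes [measurable]: "f \<in> borel_measurable borel"
  shows "(LINT y|model. f y) = (LINT y|lborel. indicator {- offset..} y * f y) / mean"
  unfolding model_def using mean_pos
  by (subst density_real(2)) (auto simp: integral_divide_zero[symmetric] simp del: integral_divide_zero
      intro!: Bochner_Integration.integral_cong)

lemma emeasure_model: "emeasure model {..t} = ennreal (max (t + offset) 0 / mean)"
proof -
  have "emeasure model {..t} = (\<integral>\<^sup>+y. ennreal (indicator {- offset..} y / mean) * indicator {..t} y \<partial>lborel)"
    unfolding model_def by (rule emeasure_density) auto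
  also have "\<dots> = (\<integral>\<^sup>+y. ennreal (1 / mean) * indicator {- offset..t} y \<partial>lborel)"
    by (intro nn_integral_cong) (auto split: split_indicator)
  also have "\<dots> = ennreal (1 / mean) * emeasure lborel {- offset..t}"
    by (simp add: nn_integral_cmult)
  also have "\<dots> = ennreal (max (t + offset) 0 / mean)"
    using mean_pos by (cases "- offset \<le> t") (auto simp: ennreal_mult[symmetric] max_def)
  finally show ?thesis .
qed

lemma half_line_model: "half_line_measure model"
  unfolding half_line_measure_def
proof (intro conjI exI allI)
  show "AE y in model. - offset \<le> y"
    unfolding model_def by (subst AE_density) (auto simp: indicator_def)
qed (simp_all add: emeasure_model)

lemma half_line_intensity: "half_line_measure intensity"
  unfolding half_line_measure_def using AE_intensity_nonneg intensity_atMost_finite by auto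

abbreviation "W \<equiv> conv intensity"
abbreviation "A \<equiv> conv model"

definition D :: "(real \<Rightarrow> real) \<Rightarrow> real \<Rightarrow> real" where "D f t = W f t - A f t"

lemma half_line_W: "half_line_function f \<Longrightarrow> half_line_function (W f)"
  by (rule half_line_function_conv[OF _ half_line_intensity])

lemma half_line_A: "half_line_function f \<Longrightarrow> half_line_function (A f)"
  by (rule half_line_function_conv[OF _ half_line_model])

lemma half_line_D: "half_line_function f \<Longrightarrow> half_line_function (D f)"
  unfolding D_def[abs_def] by (intro half_line_function_diff half_line_W half_line_A)

lemma half_line_A_power: "half_line_function f \<Longrightarrow> half_line_function ((A ^^ n) f)"
  by (induction n) (auto intro: half_line_A)

lemma half_line_D_power: "half_line_function f \<Longrightarrow> half_line_function ((D ^^ n) f)"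
  by (induction n) (auto intro: half_line_D)

lemma A_D_commute:
  assumes f: "half_line_function f"
  shows "A (D f) = D (A f)"
proof
  fix t
  show "A (D f) t = D (A f) t"
    unfolding D_def[abs_def]
    using conv_diff[OF half_line_W[OF f] half_line_A[OF f] half_line_model, of t]
      conv_commute[OF f half_line_model half_line_intensity, of t] by simp
qed

lemma A_D_power_commute:
  assumes f: "half_line_function f"
  shows "A ((D ^^ k) f) = (D ^^ k) (A f)"
proof (induction k)
  case (Suc k)
  show ?case using A_D_commute[OF half_line_D_power[OF f, of k]] Suc by simp
qed simp

lemma A_power_D_commute:
  assumes f: "half_line_function f"
  shows "(A ^^ k) (D f) = D ((A ^^ k) f)"
proof (induction k)
  case (Suc k)
  show ?case using A_D_commute[OF half_line_A_power[OF f, of k]] Suc by simp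
qed simp

text \<open>The binomial theorem for the commuting operators \<open>A\<close> and \<open>D\<close>, whose sum is \<open>W\<close>.\<close>
lemma W_power_expansion:
  assumes f: "half_line_function f"
  shows "(W ^^ n) f t = (\<Sum>k\<le>n. real (n choose k) * (D ^^ k) ((A ^^ (n - k)) f) t)"
proof (induction n arbitrary: t)
  case (Suc n)
  define Y where "Y k l = (D ^^ k) ((A ^^ l) f) t" for k l
  have "(W ^^ n) f = (\<lambda>t. \<Sum>k\<le>n. real (n choose k) * (D ^^ k) ((A ^^ (n - k)) f) t)"
    by (rule ext) (rule Suc)
  then have "(W ^^ Suc n) f t = W (\<lambda>t. \<Sum>k\<le>n. real (n choose k) * (D ^^ k) ((A ^^ (n - k)) f) t) t"
    by simp
  also have "\<dots> = (\<Sum>k\<le>n. real (n choose k) * W ((D ^^ k) ((A ^^ (n - k)) f)) t)"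
    by (rule conv_sum[OF half_line_D_power[OF half_line_A_power[OF f]] half_line_intensity])
  also have "\<dots> = (\<Sum>k\<le>n. real (n choose k) * (Y k (Suc n - k) + Y (Suc k) (n - k)))"
  proof (rule sum.cong[OF refl])
    fix k assume "k \<in> {..n}"
    let ?g = "(D ^^ k) ((A ^^ (n - k)) f)"
    have "W ?g t = A ?g t + D ?g t" by (simp add: D_def)
    also have "A ?g = (D ^^ k) ((A ^^ (Suc n - k)) f)"
      using A_D_power_commute[OF half_line_A_power[OF f, of "n - k"], of k] \<open>k \<in> {..n}\<close>
      by (simp add: Suc_diff_le)
    finally show "real (n choose k) * W ?g t = real (n choose k) * (Y k (Suc n - k) + Y (Suc k) (n - k))"
      by (simp add: Y_def)
  qed
  also have "\<dots> = (\<Sum>k\<le>Suc n. real (Suc n choose k) * Y k (Suc n - k))"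
  proof -
    have "(\<Sum>k\<le>Suc n. real (Suc n choose k) * Y k (Suc n - k))
        = Y 0 (Suc n) + (\<Sum>k\<le>n. real (Suc n choose Suc k) * Y (Suc k) (n - k))"
      by (subst sum.atMost_Suc_shift) simp
    also have "\<dots> = Y 0 (Suc n) + (\<Sum>k\<le>n. real (n choose Suc k) * Y (Suc k) (n - k))
        + (\<Sum>k\<le>n. real (n choose k) * Y (Suc k) (n - k))"
      by (simp add: sum.distrib[symmetric] algebra_simps)
    also have "Y 0 (Suc n) + (\<Sum>k\<le>n. real (n choose Suc k) * Y (Suc k) (n - k))
        = (\<Sum>k\<le>Suc n. real (n choose k) * Y k (Suc n - k))"
      by (subst sum.atMost_Suc_shift) simp
    also have "\<dots> = (\<Sum>k\<le>n. real (n choose k) * Y k (Suc n - k))" by simp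
    finally show ?thesis by (simp add: sum.distrib distrib_left)
  qed
  finally show ?case by (simp add: Y_def)
qed simp

lemma D_A_power:
  assumes f: "half_line_function f"
  shows "(D ^^ k) ((A ^^ k) f) = ((\<lambda>g. D (A g)) ^^ k) f"
  using f
proof (induction k arbitrary: f)
  case (Suc k)
  have "((\<lambda>g. D (A g)) ^^ Suc k) f = ((\<lambda>g. D (A g)) ^^ k) (D (A f))"
    by (simp only: funpow_Suc_right o_apply)
  also have "\<dots> = (D ^^ k) ((A ^^ k) (D (A f)))"
    by (rule Suc.IH[symmetric]) (intro half_line_D half_line_A Suc.prems)
  also have "(A ^^ k) (D (A f)) = D ((A ^^ Suc k) f)"
    using A_power_D_commute[OF half_line_A[OF Suc.prems], of k] by (simp only: funpow_Suc_right o_apply)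
  also have "(D ^^ k) (D ((A ^^ Suc k) f)) = (D ^^ Suc k) ((A ^^ Suc k) f)" by (simp only: funpow_Suc_right o_apply)
  finally show ?case by (rule sym)
qed simp

text \<open>How far beyond \<open>t\<close> the argument of \<open>f\<close> can reach in \<open>A f t\<close>, because of the mass of
  \<open>model\<close> on the negative half-line.\<close>
definition lead :: real where "lead = max offset 0"

text \<open>The intensity differs from Lebesgue measure over the mean by a measure of finite total
  variation, and that from \<open>model\<close> by Lebesgue measure on an interval of length \<open>\<bar>offset\<bar>\<close>.\<close>
lemma D_bound:
  assumes f: "half_line_function f" and K: "\<And>s. s \<le> t + lead \<Longrightarrow> \<bar>f s\<bar> \<le> K"
  shows "\<bar>D f t\<bar> \<le> (mass + \<bar>gamma\<bar>) * K"
proof -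
  note [measurable] = half_line_function_measurable[OF f]
  obtain c where c: "\<And>s. s < c \<Longrightarrow> f s = 0" using f by (auto simp: half_line_function_def)
  have K0: "0 \<le> K" using K[of "t + lead"] by simp
  define g where "g y = indicator {0..} y * f (t - y)" for y
  have g1: "\<bar>(LINT y|intensity. g y) - (LINT y|lborel. indicator {0..} y * g y) / mean\<bar> \<le> mass * K"
  proof (rule deviation_bound[where T = "t - c"])
    show "g \<in> borel_measurable borel" unfolding g_def[abs_def] by measurable
    show "g y = 0" if "t - c < y" for y using that c[of "t - y"] by (simp add: g_def)
    have "0 \<le> lead" by (simp add: lead_def)
    then show "\<bar>g y\<bar> \<le> K" for y using K[of "t - y"] K0 by (auto simp: g_def split: split_indicator)
  qed (simp add: g_def)
  have g2: "(LINT y|intensity. g y) = W f t"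
    unfolding conv_def
  proof (rule integral_cong_AE)
    show "AE y in intensity. g y = f (t - y)"
      by (rule eventually_mono[OF AE_intensity_nonneg]) (simp add: g_def)
  qed (simp_all add: g_def)
  have fi: "integrable lborel (\<lambda>y. indicator S y * f (t - y))" if S: "S \<in> sets borel" "S \<subseteq> {- \<bar>offset\<bar>..}" for S
  proof -
    obtain L where L: "0 \<le> L" "\<And>s. s \<le> t + \<bar>offset\<bar> \<Longrightarrow> \<bar>f s\<bar> \<le> L"
      using half_line_function_bound[OF f, of "t + \<bar>offset\<bar>"] by blast
    show ?thesis
    proof (rule Bochner_Integration.integrable_bound)
      show "integrable lborel (\<lambda>y. indicator {- \<bar>offset\<bar>..t - c} y * L)"
        by (cases "- \<bar>offset\<bar> \<le> t - c") auto
      show "AE y in lborel. norm (indicator S y * f (t - y)) \<le> norm (indicator {- \<bar>offset\<bar>..t - c} y * L)"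
      proof (rule AE_I2)
        fix y
        show "norm (indicator S y * f (t - y)) \<le> norm (indicator {- \<bar>offset\<bar>..t - c} y * L)"
          using L(2)[of "t - y"] c[of "t - y"] S(2) L(1) by (auto split: split_indicator)
      qed
      show "(\<lambda>y. indicator S y * f (t - y)) \<in> borel_measurable lborel" using S(1) by measurable
    qed
  qed
  have "A f t = (LINT y|lborel. indicator {- offset..} y * f (t - y)) / mean"
    unfolding conv_def by (rule integral_model) measurable
  moreover have "(LINT y|lborel. indicator {0..} y * g y) = (LINT y|lborel. indicator {0..} y * f (t - y))"
    by (intro Bochner_Integration.integral_cong) (auto simp: g_def split: split_indicator)
  moreover have "\<bar>(LINT y|lborel. indicator {0..} y * f (t - y)) - (LINT y|lborel. indicator {- offset..} y * f (t - y))\<bar> \<le> \<bar>offset\<bar> * K"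
  proof -
    have "(LINT y|lborel. indicator {0..} y * f (t - y)) - (LINT y|lborel. indicator {- offset..} y * f (t - y))
       = (LINT y|lborel. indicator {0..} y * f (t - y) - indicator {- offset..} y * f (t - y))"
      by (rule Bochner_Integration.integral_diff[symmetric]) (rule fi; auto)+
    also have "\<bar>\<dots>\<bar> \<le> (LINT y|lborel. indicator {min 0 (- offset)..max 0 (- offset)} y * K)"
    proof (rule abs_integral_le, rule_tac [2] AE_I2)
      show "integrable lborel (\<lambda>y. indicator {min 0 (- offset)..max 0 (- offset)} y * K)"
        by (intro integrable_mult_left integrable_real_indicator) (auto simp: emeasure_lborel_Icc_eq)
      fix y
      show "\<bar>indicator {0..} y * f (t - y) - indicator {- offset..} y * f (t - y)\<bar>
          \<le> indicator {min 0 (- offset)..max 0 (- offset)} y * K"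
        using K[of "t - y"] K0 by (auto simp: lead_def split: split_indicator)
    qed
    also have "\<dots> = \<bar>offset\<bar> * K" by (cases "0 \<le> offset") (auto simp: min_def max_def)
    finally show ?thesis .
  qed
  ultimately have "\<bar>(LINT y|lborel. indicator {0..} y * g y) / mean - A f t\<bar> \<le> \<bar>offset\<bar> * K / mean"
    using mean_pos by (simp add: diff_divide_distrib[symmetric] abs_divide divide_right_mono)
  also have "\<bar>offset\<bar> * K / mean = \<bar>gamma\<bar> * K" using mean_pos by (simp add: offset_def abs_mult)
  finally show ?thesis using g1 unfolding g2 D_def by (simp add: distrib_right)
qed

lemma D_power_bound:
  assumes f: "half_line_function f" and K: "\<And>s. s \<le> t + real k * lead \<Longrightarrow> \<bar>f s\<bar> \<le> K"
  shows "\<bar>(D ^^ k) f t\<bar> \<le> (mass + \<bar>gamma\<bar>) ^ k * K"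
  using K
proof (induction k arbitrary: t)
  case (Suc k)
  have "\<bar>D ((D ^^ k) f) t\<bar> \<le> (mass + \<bar>gamma\<bar>) * ((mass + \<bar>gamma\<bar>) ^ k * K)"
  proof (rule D_bound[OF half_line_D_power[OF f]])
    fix s assume "s \<le> t + lead"
    then show "\<bar>(D ^^ k) f s\<bar> \<le> (mass + \<bar>gamma\<bar>) ^ k * K"
      by (intro Suc.IH Suc.prems) (simp add: algebra_simps)
  qed
  then show ?case by simp
qed simp

end

context renewal_deviation
begin

text \<open>Since \<open>model\<close> is Lebesgue measure up to a factor and a cut-off, convolving a measure with
  it gives, up to that factor, a shift of the distribution function of the measure.\<close>
lemma conv_A_kernel:
  assumes f: "half_line_function f" and \<kappa>: "half_line_measure \<kappa>"
  shows "conv \<kappa> (A f) t = (LINT u|lborel. f u * measure \<kappa> {..t + offset - u}) / mean"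
    and "integrable lborel (\<lambda>u. f u * measure \<kappa> {..t + offset - u})"
proof -
  interpret \<kappa>: sigma_finite_measure \<kappa> by (rule half_line_measure_sigma_finite[OF \<kappa>])
  interpret p: pair_sigma_finite \<kappa> lborel ..
  note [measurable] = half_line_function_measurable[OF f]
  have sets[measurable_cong]: "sets \<kappa> = sets borel" using \<kappa> by (simp add: half_line_measure_def)
  have sp: "space \<kappa> = UNIV" using sets_eq_imp_space_eq[OF sets] by simp
  have A_eq: "A g (t - y) = (LINT u|lborel. g u * indicator {..t + offset - u} y) / mean"
    if [measurable]: "g \<in> borel_measurable borel" for g y
  proof -
    have "A g (t - y) = (LINT z|lborel. indicator {- offset..} z * g (t - y - z)) / mean"
      unfolding conv_def by (rule integral_model) measurable
    also have "(LINT z|lborel. indicator {- offset..} z * g (t - y - z))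
       = (LINT u|lborel. g u * indicator {..t + offset - u} y)"
      by (subst lborel_integral_real_affine[where c = "-1" and t = "t - y"])
         (auto intro!: Bochner_Integration.integral_cong split: split_indicator simp: algebra_simps)
    finally show ?thesis .
  qed
  have abs_f: "half_line_function (\<lambda>t. \<bar>f t\<bar>)" using f by (auto simp: half_line_function_def)
  have int: "integrable (\<kappa> \<Otimes>\<^sub>M lborel) (\<lambda>(y, u). f u * indicator {..t + offset - u} y)"
  proof (rule p.Fubini_integrable)
    have "(\<lambda>(y, u). if y \<le> t + offset - u then f u else 0) \<in> borel_measurable (\<kappa> \<Otimes>\<^sub>M lborel)" by measurable
    also have "(\<lambda>(y, u). if y \<le> t + offset - u then f u else 0) = (\<lambda>(y, u). f u * indicator {..t + offset - u} y)"
      by (auto split: split_indicator)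
    finally show "(\<lambda>(y, u). f u * indicator {..t + offset - u} y) \<in> borel_measurable (\<kappa> \<Otimes>\<^sub>M lborel)" .
    obtain c where c: "\<And>s. s < c \<Longrightarrow> f s = 0" using f by (auto simp: half_line_function_def)
    show "AE y in \<kappa>. integrable lborel (\<lambda>u. case (y, u) of (y, u) \<Rightarrow> f u * indicator {..t + offset - u} y)"
    proof (rule AE_I2)
      fix y
      obtain K where K: "0 \<le> K" "\<And>s. s \<le> t + offset - y \<Longrightarrow> \<bar>f s\<bar> \<le> K"
        using half_line_function_bound[OF f, of "t + offset - y"] by blast
      show "integrable lborel (\<lambda>u. case (y, u) of (y, u) \<Rightarrow> f u * indicator {..t + offset - u} y)"
      proof (rule Bochner_Integration.integrable_bound)
        show "integrable lborel (\<lambda>u. indicator {c..t + offset - y} u * K)"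
          by (intro integrable_mult_left integrable_real_indicator) (auto simp: emeasure_lborel_Icc_eq)
        have "(\<lambda>u. if y \<le> t + offset - u then f u else 0) \<in> borel_measurable lborel" by measurable
        also have "(\<lambda>u. if y \<le> t + offset - u then f u else 0) = (\<lambda>u. f u * indicator {..t + offset - u} y)"
          by (auto split: split_indicator)
        finally show "(\<lambda>u. case (y, u) of (y, u) \<Rightarrow> f u * indicator {..t + offset - u} y) \<in> borel_measurable lborel" by simp
        have "norm (f u * indicator {..t + offset - u} y) \<le> norm (indicator {c..t + offset - y} u * K)" for u
          using K c[of u] by (auto split: split_indicator)
        then show "AE u in lborel. norm (case (y, u) of (y, u) \<Rightarrow> f u * indicator {..t + offset - u} y)
           \<le> norm (indicator {c..t + offset - y} u * K)" by simp
      qed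
    qed
    have "integrable \<kappa> (\<lambda>y. mean * A (\<lambda>t. \<bar>f t\<bar>) (t - y))"
      by (intro integrable_mult_right conv_integrable[OF half_line_A[OF abs_f] \<kappa>])
    then show "integrable \<kappa> (\<lambda>y. LINT u|lborel. norm (case (y, u) of (y, u) \<Rightarrow> f u * indicator {..t + offset - u} y))"
      using mean_pos A_eq[of "\<lambda>t. \<bar>f t\<bar>"] by (simp add: abs_mult)
  qed
  have m: "(LINT y|\<kappa>. f u * indicator {..t + offset - u} y) = f u * measure \<kappa> {..t + offset - u}" for u
    by (simp add: sp)
  have "conv \<kappa> (A f) t = (LINT y|\<kappa>. LINT u|lborel. f u * indicator {..t + offset - u} y) / mean"
    unfolding conv_def[of \<kappa>] by (simp add: A_eq)
  also have "(LINT y|\<kappa>. LINT u|lborel. f u * indicator {..t + offset - u} y)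
    = (LINT u|lborel. LINT y|\<kappa>. f u * indicator {..t + offset - u} y)"
    by (rule p.Fubini_integral[OF int, symmetric])
  finally show "conv \<kappa> (A f) t = (LINT u|lborel. f u * measure \<kappa> {..t + offset - u}) / mean"
    by (simp only: m)
  show "integrable lborel (\<lambda>u. f u * measure \<kappa> {..t + offset - u})"
    using p.integrable_snd[OF int] by (simp only: m split)
qed

text \<open>The kernel of the operator that maps \<open>f\<close> to \<open>D (A f)\<close>, up to a shift and a factor.\<close>
definition remainder :: "real \<Rightarrow> real" where
  "remainder s = V s - max (s + offset) 0 / mean"

lemma remainder_vanishes: "s < - lead \<Longrightarrow> remainder s = 0"
  unfolding remainder_def lead_def by (subst V_neg) auto

text \<open>To the left of a bounded interval the remainder is zero; to the right it is \<open>V s - s /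
  mean - gamma\<close>, which is dominated by the tail of the deviation. This is where its first moment
  is needed.\<close>
lemma integrable_remainder: "integrable lborel remainder"
proof (rule Bochner_Integration.integrable_bound)
  show "integrable lborel (\<lambda>s. tail s + indicator {- \<bar>offset\<bar>..\<bar>offset\<bar>} s * (\<bar>offset\<bar> / mean))"
    by (intro Bochner_Integration.integrable_add integrable_tail_sum integrable_mult_left integrable_real_indicator) auto
  have "V \<in> borel_measurable borel" by (rule borel_measurable_mono) (simp add: mono_def V_mono)
  then show "remainder \<in> borel_measurable lborel" unfolding remainder_def[abs_def] by measurable
  have "\<bar>remainder s\<bar> \<le> tail s + indicator {- \<bar>offset\<bar>..\<bar>offset\<bar>} s * (\<bar>offset\<bar> / mean)" for s
  proof (cases "0 \<le> s")
    case True
    have g: "offset / mean = gamma" using mean_pos by (simp add: offset_def)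
    have "max (s + offset) 0 = (s + offset) + max (- s - offset) 0" by (simp add: max_def)
    then have "max (s + offset) 0 / mean = (s + offset) / mean + max (- s - offset) 0 / mean"
      by (simp only: add_divide_distrib)
    then have eq: "remainder s = (V s - s / mean - gamma) - max (- s - offset) 0 / mean"
      unfolding remainder_def g[symmetric] by (simp add: add_divide_distrib)
    have "max (- s - offset) 0 \<le> indicator {- \<bar>offset\<bar>..\<bar>offset\<bar>} s * \<bar>offset\<bar>"
      using True by (auto split: split_indicator)
    then have "max (- s - offset) 0 / mean \<le> (indicator {- \<bar>offset\<bar>..\<bar>offset\<bar>} s * \<bar>offset\<bar>) / mean"
      using mean_pos by (intro divide_right_mono) auto
    moreover have "0 \<le> max (- s - offset) 0 / mean" using mean_pos by simp
    ultimately show ?thesis using V_tail[OF True] unfolding eq times_divide_eq_right by linarith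
  next
    case False
    have "max (s + offset) 0 \<le> indicator {- \<bar>offset\<bar>..\<bar>offset\<bar>} s * \<bar>offset\<bar>"
      using False by (auto split: split_indicator)
    then have "max (s + offset) 0 / mean \<le> (indicator {- \<bar>offset\<bar>..\<bar>offset\<bar>} s * \<bar>offset\<bar>) / mean"
      using mean_pos by (intro divide_right_mono) auto
    moreover have "0 \<le> max (s + offset) 0 / mean" using mean_pos by simp
    ultimately show ?thesis using False mean_pos by (simp add: remainder_def V_neg tail_def)
  qed
  then show "AE s in lborel. norm (remainder s)
     \<le> norm (tail s + indicator {- \<bar>offset\<bar>..\<bar>offset\<bar>} s * (\<bar>offset\<bar> / mean))"
    by (intro AE_I2) (metis abs_ge_self order_trans real_norm_def)
qed

definition remainder_norm :: real where
  "remainder_norm = (LINT s|lborel. \<bar>remainder s\<bar>) / mean"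

lemma remainder_norm_nonneg: "0 \<le> remainder_norm"
  unfolding remainder_norm_def using mean_pos by (intro divide_nonneg_pos integral_nonneg_AE) auto

text \<open>While \<open>D\<close> alone is merely bounded, one factor \<open>A\<close> smooths it to convolution with an
  integrable function. Pairing each of the \<open>k\<close> factors \<open>D\<close> with one \<open>A\<close> leaves \<open>A^(n - 2 * k)\<close>
  of the \<open>A^n\<close> in the main term, so that each pair gains a factor of order \<open>(n / t)^2\<close>.\<close>
lemma D_A_bound:
  assumes f: "half_line_function f" and K: "\<And>s. s \<le> t + 2 * lead \<Longrightarrow> \<bar>f s\<bar> \<le> K"
  shows "\<bar>D (A f) t\<bar> \<le> remainder_norm * K"
proof -
  have K0: "0 \<le> K" using K[of "t + 2 * lead"] by simp
  have model: "measure model {..s} = max (s + offset) 0 / mean" for s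
    using mean_pos by (simp add: measure_def emeasure_model)
  have "D (A f) t = (LINT u|lborel. f u * V (t + offset - u)) / mean - (LINT u|lborel. f u * measure model {..t + offset - u}) / mean"
    unfolding D_def V_def using conv_A_kernel(1)[OF f half_line_intensity] conv_A_kernel(1)[OF f half_line_model] by simp
  also have "\<dots> = (LINT u|lborel. f u * V (t + offset - u) - f u * measure model {..t + offset - u}) / mean"
    using conv_A_kernel(2)[OF f half_line_intensity] conv_A_kernel(2)[OF f half_line_model]
    by (subst Bochner_Integration.integral_diff) (auto simp: V_def diff_divide_distrib)
  also have "\<dots> = (LINT u|lborel. f u * remainder (t + offset - u)) / mean"
    by (simp add: remainder_def model right_diff_distrib)
  finally have eq: "D (A f) t = (LINT u|lborel. f u * remainder (t + offset - u)) / mean" .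
  have ir: "integrable lborel (\<lambda>u. \<bar>remainder (t + offset - u)\<bar> * K)"
    using lborel_integrable_real_affine[OF integrable_remainder, of "-1" "t + offset"] by simp
  have "\<bar>LINT u|lborel. f u * remainder (t + offset - u)\<bar> \<le> (LINT u|lborel. \<bar>remainder (t + offset - u)\<bar> * K)"
  proof (rule abs_integral_le[OF ir], rule AE_I2)
    fix u
    show "\<bar>f u * remainder (t + offset - u)\<bar> \<le> \<bar>remainder (t + offset - u)\<bar> * K"
    proof (cases "u \<le> t + 2 * lead")
      case True
      then have "\<bar>f u\<bar> * \<bar>remainder (t + offset - u)\<bar> \<le> K * \<bar>remainder (t + offset - u)\<bar>"
        by (intro mult_right_mono K) auto
      then show ?thesis by (simp add: abs_mult mult.commute)
    next
      case False
      have "remainder (t + offset - u) = 0"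
        using False by (intro remainder_vanishes) (simp add: lead_def max_def split: if_splits)
      then show ?thesis by simp
    qed
  qed
  also have "\<dots> = (LINT u|lborel. \<bar>remainder (t + offset - u)\<bar>) * K" by simp
  also have "(LINT u|lborel. \<bar>remainder (t + offset - u)\<bar>) = (LINT s|lborel. \<bar>remainder s\<bar>)"
    by (subst (2) lborel_integral_real_affine[where c = "-1" and t = "t + offset"]) auto
  finally have "\<bar>LINT u|lborel. f u * remainder (t + offset - u)\<bar> / mean \<le> (LINT s|lborel. \<bar>remainder s\<bar>) * K / mean"
    using mean_pos by (intro divide_right_mono) auto
  then show ?thesis unfolding eq remainder_norm_def using mean_pos by (simp add: abs_divide)
qed

lemma half_line_DA_power: "half_line_function f \<Longrightarrow> half_line_function (((\<lambda>g. D (A g)) ^^ n) f)"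
  by (induction n) (auto intro: half_line_A half_line_D)

lemma DA_power_bound:
  assumes f: "half_line_function f" and K: "\<And>s. s \<le> t + 2 * real k * lead \<Longrightarrow> \<bar>f s\<bar> \<le> K"
  shows "\<bar>((\<lambda>g. D (A g)) ^^ k) f t\<bar> \<le> remainder_norm ^ k * K"
  using K
proof (induction k arbitrary: t)
  case (Suc k)
  have "\<bar>D (A (((\<lambda>g. D (A g)) ^^ k) f)) t\<bar> \<le> remainder_norm * (remainder_norm ^ k * K)"
  proof (rule D_A_bound[OF half_line_DA_power[OF f]])
    fix s assume "s \<le> t + 2 * lead"
    then show "\<bar>((\<lambda>g. D (A g)) ^^ k) f s\<bar> \<le> remainder_norm ^ k * K"
      by (intro Suc.IH Suc.prems) (simp add: algebra_simps)
  qed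
  then show ?case by simp
qed simp

definition heaviside :: "real \<Rightarrow> real" where "heaviside = indicator {0..}"

lemma half_line_heaviside: "half_line_function heaviside"
  unfolding half_line_function_def heaviside_def
proof (intro conjI allI)
  show "\<exists>c. \<forall>s<c. indicator {0..} (s::real) = (0::real)" by (intro exI[of _ 0] allI impI) (simp add: indicator_def)
  show "\<exists>K. \<forall>s\<le>T. \<bar>indicator {0..} s :: real\<bar> \<le> K" for T :: real by (intro exI[of _ 1]) (auto split: split_indicator)
qed simp

definition main_term :: "nat \<Rightarrow> real \<Rightarrow> real" where
  "main_term n t = (if 0 \<le> t + real n * offset then (t + real n * offset) ^ n / (mean ^ n * fact n) else 0)"

lemma main_term_nonneg: "0 \<le> main_term n t"
  using mean_pos by (simp add: main_term_def)

lemma main_term_mono: "s \<le> t \<Longrightarrow> main_term n s \<le> main_term n t"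
  using mean_pos by (auto simp: main_term_def intro!: divide_right_mono power_mono)

lemma A_power_heaviside: "(A ^^ n) heaviside = main_term n"
proof (induction n)
  case 0
  show ?case by (auto simp: heaviside_def main_term_def fun_eq_iff split: split_indicator)
next
  case (Suc n)
  show ?case
  proof
    fix t
    have hl: "half_line_function (main_term n)"
      using half_line_A_power[OF half_line_heaviside, of n] Suc by simp
    have [measurable]: "main_term n \<in> borel_measurable borel" by (rule half_line_function_measurable[OF hl])
    let ?T = "t + real n * offset"
    have "(A ^^ Suc n) heaviside t = A (main_term n) t" using Suc by simp
    also have "\<dots> = (LINT y|lborel. indicator {- offset..} y * main_term n (t - y)) / mean"
      unfolding conv_def by (rule integral_model) measurable
    also have "(LINT y|lborel. indicator {- offset..} y * main_term n (t - y))
       = (LINT y|lborel. (?T - y) ^ n * indicator {- offset..?T} y) / (mean ^ n * fact n)"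
      unfolding integral_divide_zero[symmetric]
      by (intro Bochner_Integration.integral_cong)
         (auto simp: main_term_def algebra_simps split: split_indicator)
    also have "(LINT y|lborel. (?T - y) ^ n * indicator {- offset..?T} y)
       = (if 0 \<le> ?T + offset then (?T + offset) ^ Suc n / real (Suc n) else 0)"
    proof (cases "0 \<le> ?T + offset")
      case True
      have "has_bochner_integral lborel (\<lambda>y. (?T - y) ^ n * indicator {- offset..?T} y)
        (- ((?T - ?T) ^ Suc n / real (Suc n)) - - ((?T - (- offset)) ^ Suc n / real (Suc n)))"
        using True
        by (intro has_bochner_integral_FTC_Icc_real[where F = "\<lambda>y. - ((?T - y) ^ Suc n / real (Suc n))"])
           (auto intro!: derivative_eq_intros continuous_intros simp del: power_Suc of_nat_Suc)
      from has_bochner_integral_integral_eq[OF this] show ?thesis using True by simp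
    qed simp
    also have "\<dots> / (mean ^ n * fact n) / mean = main_term (Suc n) t"
      by (auto simp: main_term_def algebra_simps)
    finally show "(A ^^ Suc n) heaviside t = main_term (Suc n) t" .
  qed
qed

lemma LS_power_neg: "t < 0 \<Longrightarrow> LS_power V (Suc n) t = 0"
  by (induction n) (auto simp: V_neg set_lebesgue_integral_def)

lemma LS_power_eq_W_power: "LS_power V n = (W ^^ n) heaviside"
proof (induction n)
  case 0
  show ?case by (simp add: heaviside_def)
next
  case (Suc n)
  have "LS_power V (Suc n) t = W (LS_power V n) t" for t
  proof (cases n)
    case 0
    have "W (LS_power V 0) t = (LINT y|intensity. indicator {..t} y)"
      unfolding conv_def by (intro Bochner_Integration.integral_cong) (auto split: split_indicator)
    also have "\<dots> = V t"
      using sets_eq_imp_space_eq[OF sets_intensity] by (simp add: V_def)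
    finally show ?thesis using 0 by simp
  next
    case (Suc k)
    have hl: "half_line_function (LS_power V (Suc k))"
      unfolding Suc[symmetric] Suc.IH
      by (induction n) (auto intro: half_line_heaviside half_line_W)
    note [measurable] = half_line_function_measurable[OF hl]
    have "LS_power V (Suc (Suc k)) t = (LINT y|intensity. indicator {0..t} y * LS_power V (Suc k) (t - y))"
      by (simp add: interval_measure_V set_lebesgue_integral_def)
    also have "\<dots> = (LINT y|intensity. LS_power V (Suc k) (t - y))"
    proof (rule integral_cong_AE)
      show "AE y in intensity. indicator {0..t} y * LS_power V (Suc k) (t - y) = LS_power V (Suc k) (t - y)"
        by (rule eventually_mono[OF AE_intensity_nonneg]) (use LS_power_neg in \<open>auto split: split_indicator\<close>)
    qed measurable
    finally show ?thesis by (simp add: Suc conv_def)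
  qed
  then show ?case using Suc by (simp add: fun_eq_iff)
qed

text \<open>As long as there are enough factors \<open>A\<close>, each \<open>D\<close> is paired with one of them. In the
  remaining terms there are not enough of them: all \<open>n - k\<close> are paired, and the other \<open>2 * k -
  n\<close> factors \<open>D\<close> are estimated by their norm.\<close>
lemma LS_power_deviation:
  "\<bar>LS_power V n t - main_term n t\<bar> \<le> (\<Sum>k=1..n. real (n choose k) *
     (if 2 * k \<le> n then remainder_norm ^ k * main_term (n - 2 * k) (t + 2 * real k * lead)
      else (mass + \<bar>gamma\<bar>) ^ (2 * k - n) * remainder_norm ^ (n - k)))"
proof -
  let ?b = "\<lambda>k. if 2 * k \<le> n then remainder_norm ^ k * main_term (n - 2 * k) (t + 2 * real k * lead)
      else (mass + \<bar>gamma\<bar>) ^ (2 * k - n) * remainder_norm ^ (n - k)"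
  note h = half_line_heaviside
  have "LS_power V n t = (\<Sum>k\<le>n. real (n choose k) * (D ^^ k) ((A ^^ (n - k)) heaviside) t)"
    by (simp add: LS_power_eq_W_power W_power_expansion[OF h])
  also have "{..n} = insert 0 {1..n}" by auto
  also have "(\<Sum>k\<in>insert 0 {1..n}. real (n choose k) * (D ^^ k) ((A ^^ (n - k)) heaviside) t)
     = main_term n t + (\<Sum>k=1..n. real (n choose k) * (D ^^ k) ((A ^^ (n - k)) heaviside) t)"
    by (subst sum.insert) (auto simp: A_power_heaviside)
  finally have "\<bar>LS_power V n t - main_term n t\<bar> = \<bar>\<Sum>k=1..n. real (n choose k) * (D ^^ k) ((A ^^ (n - k)) heaviside) t\<bar>"
    by simp
  also have "\<dots> \<le> (\<Sum>k=1..n. \<bar>real (n choose k) * (D ^^ k) ((A ^^ (n - k)) heaviside) t\<bar>)" by (rule sum_abs)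
  also have "\<dots> \<le> (\<Sum>k=1..n. real (n choose k) * ?b k)"
  proof (rule sum_mono)
    fix k assume k: "k \<in> {1..n}"
    have "\<bar>(D ^^ k) ((A ^^ (n - k)) heaviside) t\<bar> \<le> ?b k"
    proof (cases "2 * k \<le> n")
      case True
      then have nk: "n - k = k + (n - 2 * k)" by simp
      have "(D ^^ k) ((A ^^ (n - k)) heaviside) = ((\<lambda>g. D (A g)) ^^ k) (main_term (n - 2 * k))"
        unfolding nk funpow_add o_apply
        using D_A_power[OF half_line_A_power[OF h], of k "n - 2 * k"] by (simp add: A_power_heaviside)
      moreover have "\<bar>((\<lambda>g. D (A g)) ^^ k) (main_term (n - 2 * k)) t\<bar>
          \<le> remainder_norm ^ k * main_term (n - 2 * k) (t + 2 * real k * lead)"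
      proof (rule DA_power_bound)
        show "half_line_function (main_term (n - 2 * k))"
          using half_line_A_power[OF h, of "n - 2 * k"] by (simp add: A_power_heaviside)
        show "\<bar>main_term (n - 2 * k) s\<bar> \<le> main_term (n - 2 * k) (t + 2 * real k * lead)"
          if "s \<le> t + 2 * real k * lead" for s
          using main_term_mono[OF that] main_term_nonneg by simp
      qed
      ultimately show ?thesis using True by simp
    next
      case False
      then have nk: "k = (2 * k - n) + (n - k)" using k by auto
      have "(D ^^ k) ((A ^^ (n - k)) heaviside) = (D ^^ (2 * k - n)) ((D ^^ (n - k)) ((A ^^ (n - k)) heaviside))"
        by (subst nk) (simp only: funpow_add o_apply)
      also have "\<dots> = (D ^^ (2 * k - n)) (((\<lambda>g. D (A g)) ^^ (n - k)) heaviside)"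
        by (simp only: D_A_power[OF h])
      finally have eq: "(D ^^ k) ((A ^^ (n - k)) heaviside) = (D ^^ (2 * k - n)) (((\<lambda>g. D (A g)) ^^ (n - k)) heaviside)" .
      have "\<bar>((\<lambda>g. D (A g)) ^^ (n - k)) heaviside s\<bar> \<le> remainder_norm ^ (n - k) * 1" for s
        by (rule DA_power_bound[OF h]) (auto simp: heaviside_def split: split_indicator)
      then have "\<bar>(D ^^ (2 * k - n)) (((\<lambda>g. D (A g)) ^^ (n - k)) heaviside) t\<bar>
          \<le> (mass + \<bar>gamma\<bar>) ^ (2 * k - n) * remainder_norm ^ (n - k)"
        by (intro D_power_bound half_line_DA_power[OF h]) simp
      then show ?thesis using False by (simp add: eq)
    qed
    then show "\<bar>real (n choose k) * (D ^^ k) ((A ^^ (n - k)) heaviside) t\<bar> \<le> real (n choose k) * ?b k"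
      by (simp only: abs_mult abs_of_nat) (intro mult_left_mono, auto)
  qed
  finally show ?thesis .
qed

end

section \<open>Estimation of the expansion\<close>

text \<open>The term with \<open>2 * k \<le> n\<close> relative to the main term. Here \<open>n choose k\<close> is at most \<open>n^k /
  k!\<close>, and lowering the power by \<open>2 * k\<close> changes it by at most \<open>(m * n / \<tau>)^(2 * k)\<close>; together
  this is \<open>(m^2 * n^3 / \<tau>^2)^k / k!\<close>. Displacing the argument by \<open>2 * k * e\<close> costs at most the
  exponential factor.\<close>
lemma near_term_ratio:
  fixes m \<tau> e R :: real
  assumes pos: "0 < m" "0 < \<tau>" "0 \<le> e" "0 \<le> R" and k: "2 * k \<le> n"
  shows "real (n choose k) * (R ^ k * ((\<tau> + 2 * real k * e) ^ (n - 2 * k) / (m ^ (n - 2 * k) * fact (n - 2 * k))))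
    \<le> \<tau> ^ n / (m ^ n * fact n) * ((R * m\<^sup>2 * real n ^ 3 / \<tau>\<^sup>2 * exp (2 * e * real n / \<tau>)) ^ k / fact k)"
proof -
  let ?E = "exp (2 * e * real n / \<tau>)"
  have "real ((n choose k) * fact k) \<le> real (n ^ k)" by (intro of_nat_mono binomial_fact_pow)
  then have c: "real (n choose k) \<le> real n ^ k / fact k" by (simp add: field_simps)
  have "fact n div fact (n - 2 * k) \<le> n ^ (2 * k)" by (rule fact_div_fact_le_pow[OF k])
  then have "real (fact n div fact (n - 2 * k)) \<le> real (n ^ (2 * k))" by (rule of_nat_mono)
  moreover have "real (fact n div fact (n - 2 * k)) = fact n / fact (n - 2 * k)"
    by (subst real_of_nat_div) (auto simp: fact_dvd)
  ultimately have "fact n / fact (n - 2 * k) \<le> real n ^ (2 * k)" by simp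
  then have f: "1 / fact (n - 2 * k) \<le> real n ^ (2 * k) / (fact n :: real)" by (simp add: field_simps)
  have "\<tau> + 2 * real k * e = \<tau> * (1 + 2 * real k * e / \<tau>)" using pos by (simp add: field_simps)
  then have "(\<tau> + 2 * real k * e) ^ (n - 2 * k) = \<tau> ^ (n - 2 * k) * (1 + 2 * real k * e / \<tau>) ^ (n - 2 * k)"
    by (simp add: power_mult_distrib)
  also have "\<dots> \<le> \<tau> ^ (n - 2 * k) * exp (2 * real k * e / \<tau>) ^ (n - 2 * k)"
    using pos by (intro mult_left_mono power_mono) (auto intro!: exp_ge_add_one_self add_nonneg_nonneg)
  also have "\<dots> \<le> \<tau> ^ (n - 2 * k) * exp (2 * real k * e / \<tau>) ^ n"
    using pos by (intro mult_left_mono power_increasing) auto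
  also have "exp (2 * real k * e / \<tau>) ^ n = ?E ^ k"
    by (simp add: exp_of_nat_mult[symmetric] mult_ac)
  finally have p: "(\<tau> + 2 * real k * e) ^ (n - 2 * k) \<le> \<tau> ^ (n - 2 * k) * ?E ^ k" .
  have "real (n choose k) * (R ^ k * ((\<tau> + 2 * real k * e) ^ (n - 2 * k) / (m ^ (n - 2 * k) * fact (n - 2 * k))))
     = real (n choose k) * (R ^ k / m ^ (n - 2 * k) * ((\<tau> + 2 * real k * e) ^ (n - 2 * k) * (1 / fact (n - 2 * k))))"
    by simp
  also have "\<dots> \<le> (real n ^ k / fact k) * (R ^ k / m ^ (n - 2 * k) * ((\<tau> ^ (n - 2 * k) * ?E ^ k) * (real n ^ (2 * k) / fact n)))"
    using pos c f p by (intro mult_mono mult_left_mono mult_nonneg_nonneg zero_le_power) auto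
  also have "\<dots> = \<tau> ^ n / (m ^ n * fact n) * ((R * m\<^sup>2 * real n ^ 3 / \<tau>\<^sup>2 * ?E) ^ k / fact k)"
  proof -
    have t: "\<tau> ^ n = \<tau> ^ (n - 2 * k) * \<tau>\<^sup>2 ^ k" "m ^ n = m ^ (n - 2 * k) * m\<^sup>2 ^ k"
      using k by (simp_all add: power_mult[symmetric] power_add[symmetric])
    have n3: "real n ^ k * real n ^ (2 * k) = (real n ^ 3) ^ k"
      by (simp add: power_mult[symmetric] power_add[symmetric])
    have "(real n ^ k / fact k) * (R ^ k / m ^ (n - 2 * k) * ((\<tau> ^ (n - 2 * k) * ?E ^ k) * (real n ^ (2 * k) / fact n)))
       = (real n ^ k * real n ^ (2 * k)) * (R ^ k * \<tau> ^ (n - 2 * k) * ?E ^ k) / (fact k * m ^ (n - 2 * k) * fact n)"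
      by (simp add: field_simps)
    also have "\<dots> = \<tau> ^ n / (m ^ n * fact n) * ((R * m\<^sup>2 * real n ^ 3 / \<tau>\<^sup>2 * ?E) ^ k / fact k)"
      unfolding n3 t using pos by (simp add: power_mult_distrib power_divide field_simps)
    finally show ?thesis .
  qed
  finally show ?thesis .
qed

text \<open>The terms without enough factors to pair are crudely bounded by \<open>C^n\<close> up to the binomial
  coefficient. Their sum is negligible because the main term is at least \<open>(\<tau> / (m * n))^n\<close>.\<close>
lemma far_term_sum:
  fixes m \<tau> C :: real
  assumes pos: "0 < m" "0 < \<tau>" "0 \<le> C"
  shows "(\<Sum>k=1..n. real (n choose k) * C ^ n) \<le> \<tau> ^ n / (m ^ n * fact n) * (2 * C * m * real n / \<tau>) ^ n"
proof -
  have "(\<Sum>k=1..n. real (n choose k)) \<le> (\<Sum>k\<le>n. real (n choose k))" by (rule sum_mono2) auto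
  also have "\<dots> = 2 ^ n" by (simp add: choose_row_sum flip: of_nat_sum)
  finally have "(\<Sum>k=1..n. real (n choose k)) * C ^ n \<le> 2 ^ n * C ^ n" using pos by (intro mult_right_mono) auto
  also have "\<dots> = 2 ^ n * C ^ n * 1" by simp
  also have "\<dots> \<le> 2 ^ n * C ^ n * (real n ^ n / fact n)"
  proof (intro mult_left_mono)
    have "(fact n :: real) \<le> real n ^ n" using fact_le_power[of n, where 'a = real] by simp
    then show "1 \<le> real n ^ n / (fact n :: real)" by simp
  qed (use pos in auto)
  also have "\<dots> = \<tau> ^ n / (m ^ n * fact n) * (2 * C * m * real n / \<tau>) ^ n"
    using pos by (simp add: power_mult_distrib power_divide field_simps)
  finally show ?thesis by (simp add: sum_distrib_right)
qed

lemma exp_partial_sum: "0 \<le> x \<Longrightarrow> (\<Sum>k=1..n. x ^ k / fact k) \<le> exp x - (1::real)"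
proof -
  assume x: "0 \<le> x"
  have s: "(\<lambda>k. x ^ k / fact k) sums exp x" using exp_converges[of x] by (simp add: field_simps)
  have "(\<Sum>k\<in>insert 0 {1..n}. x ^ k / fact k) \<le> (\<Sum>k. x ^ k / fact k)"
    using s x by (intro sum_le_suminf) (auto simp: sums_iff)
  also have "\<dots> = exp x" using s by (simp add: sums_iff)
  finally show ?thesis by (subst (asm) sum.insert) auto
qed

lemma expansion_error:
  fixes m \<tau> e R B :: real and n :: nat
  assumes pos: "0 < m" "0 < \<tau>" "0 \<le> e" "0 \<le> R" "0 \<le> B"
  defines "x \<equiv> R * m\<^sup>2 * real n ^ 3 / \<tau>\<^sup>2 * exp (2 * e * real n / \<tau>)"
    and "y \<equiv> 2 * max 1 (max B R) * m * real n / \<tau>"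
  shows "(\<Sum>k=1..n. real (n choose k) *
     (if 2 * k \<le> n then R ^ k * ((\<tau> + 2 * real k * e) ^ (n - 2 * k) / (m ^ (n - 2 * k) * fact (n - 2 * k)))
      else B ^ (2 * k - n) * R ^ (n - k)))
    \<le> \<tau> ^ n / (m ^ n * fact n) * (exp x - 1 + y ^ n)"
proof -
  define C where "C = max 1 (max B R)"
  define M where "M = \<tau> ^ n / (m ^ n * fact n)"
  have M: "0 \<le> M" using pos by (simp add: M_def)
  have x: "0 \<le> x" unfolding x_def using pos by simp
  have "(\<Sum>k=1..n. real (n choose k) *
     (if 2 * k \<le> n then R ^ k * ((\<tau> + 2 * real k * e) ^ (n - 2 * k) / (m ^ (n - 2 * k) * fact (n - 2 * k)))
      else B ^ (2 * k - n) * R ^ (n - k)))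
    \<le> (\<Sum>k=1..n. M * (x ^ k / fact k) + real (n choose k) * C ^ n)"
  proof (rule sum_mono)
    fix k assume k: "k \<in> {1..n}"
    show "real (n choose k) *
     (if 2 * k \<le> n then R ^ k * ((\<tau> + 2 * real k * e) ^ (n - 2 * k) / (m ^ (n - 2 * k) * fact (n - 2 * k)))
      else B ^ (2 * k - n) * R ^ (n - k)) \<le> M * (x ^ k / fact k) + real (n choose k) * C ^ n"
    proof (cases "2 * k \<le> n")
      case True
      moreover have "0 \<le> real (n choose k) * C ^ n" by (simp add: C_def)
      ultimately show ?thesis
        using near_term_ratio[OF pos(1-4) True] unfolding M_def x_def by simp
    next
      case False
      have "B ^ (2 * k - n) * R ^ (n - k) \<le> C ^ (2 * k - n) * C ^ (n - k)"
        using pos by (intro mult_mono power_mono) (auto simp: C_def)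
      also have "\<dots> = C ^ (2 * k - n + (n - k))" by (simp add: power_add)
      also have "\<dots> \<le> C ^ n" using k by (intro power_increasing) (auto simp: C_def)
      finally have "real (n choose k) * (B ^ (2 * k - n) * R ^ (n - k)) \<le> real (n choose k) * C ^ n"
        by (rule mult_left_mono) simp
      moreover have "0 \<le> M * (x ^ k / fact k)" using M x by simp
      ultimately show ?thesis using False by simp
    qed
  qed
  also have "\<dots> = M * (\<Sum>k=1..n. x ^ k / fact k) + (\<Sum>k=1..n. real (n choose k) * C ^ n)"
    by (simp add: sum.distrib sum_distrib_left)
  also have "\<dots> \<le> M * (exp x - 1) + M * y ^ n"
    unfolding M_def y_def C_def[symmetric] using pos x
    by (intro add_mono mult_left_mono exp_partial_sum far_term_sum) (auto simp: C_def)
  finally show ?thesis by (simp add: M_def distrib_left)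
qed

lemma small_order_ratios:
  fixes j :: "real \<Rightarrow> nat"
  assumes "(\<lambda>t. real (j t)) \<in> o[at_top](\<lambda>t. t powr (2 / 3))"
  shows "((\<lambda>t. real (j t) ^ 3 / t\<^sup>2) \<longlongrightarrow> 0) at_top" "((\<lambda>t. real (j t) / t) \<longlongrightarrow> 0) at_top"
proof -
  have u: "((\<lambda>t. real (j t) / t powr (2 / 3)) \<longlongrightarrow> 0) at_top" using assms by (rule smalloD_tendsto)
  have "((\<lambda>t. (real (j t) / t powr (2 / 3)) ^ 3) \<longlongrightarrow> 0) at_top"
    using tendsto_power[OF u, of 3] by simp
  moreover have "eventually (\<lambda>t. (real (j t) / t powr (2 / 3)) ^ 3 = real (j t) ^ 3 / t\<^sup>2) at_top"
    using eventually_gt_at_top[of 0]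
  proof eventually_elim
    case (elim t)
    have "(t powr (2 / 3)) ^ 3 = t powr (real 3 * (2 / 3))" using elim by (subst powr_power) auto
    also have "\<dots> = t\<^sup>2" using elim by simp
    finally show ?case by (simp add: power_divide)
  qed
  ultimately show "((\<lambda>t. real (j t) ^ 3 / t\<^sup>2) \<longlongrightarrow> 0) at_top"
    by (rule Lim_transform_eventually)
  have "((\<lambda>t. real (j t) / t powr (2 / 3) * t powr (- (1 / 3))) \<longlongrightarrow> 0) at_top"
    using tendsto_mult[OF u tendsto_neg_powr[OF _ filterlim_ident, of "- (1 / 3)"]] by simp
  moreover have "eventually (\<lambda>t. real (j t) / t powr (2 / 3) * t powr (- (1 / 3)) = real (j t) / t) at_top"
    using eventually_gt_at_top[of 0]
  proof eventually_elim
    case (elim t)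
    have "real (j t) / t powr (2 / 3) * t powr (- (1 / 3)) = real (j t) / (t powr (2 / 3) * t powr (1 / 3))"
      by (simp add: powr_minus_divide)
    also have "t powr (2 / 3) * t powr (1 / 3) = t" using elim by (subst powr_add[symmetric]) simp
    finally show ?case .
  qed
  ultimately show "((\<lambda>t. real (j t) / t) \<longlongrightarrow> 0) at_top"
    by (rule Lim_transform_eventually)
qed

text \<open>Second order Taylor expansion of the logarithm, with error of order \<open>j * (j / t)^2\<close>.\<close>
lemma shifted_power_asymptotics:
  fixes j :: "real \<Rightarrow> nat" and a :: real
  assumes j3: "((\<lambda>t. real (j t) ^ 3 / t\<^sup>2) \<longlongrightarrow> 0) at_top" and j1: "((\<lambda>t. real (j t) / t) \<longlongrightarrow> 0) at_top"
  shows "((\<lambda>t. (1 + real (j t) * a / t) ^ j t / exp (a * real (j t) ^ 2 / t)) \<longlongrightarrow> 1) at_top"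
proof -
  have v: "((\<lambda>t. a * (real (j t) / t)) \<longlongrightarrow> a * 0) at_top" by (intro tendsto_intros j1)
  then have "eventually (\<lambda>t. \<bar>a * (real (j t) / t)\<bar> < 1 / 2) at_top"
    using tendsto_rabs[OF v] by (intro order_tendstoD) auto
  then have ev: "eventually (\<lambda>t. \<bar>real (j t) * ln (1 + a * (real (j t) / t)) - a * real (j t) ^ 2 / t\<bar>
      \<le> 2 * a\<^sup>2 * (real (j t) ^ 3 / t\<^sup>2)) at_top"
  proof eventually_elim
    case (elim t)
    let ?v = "a * (real (j t) / t)"
    have "\<bar>ln (1 + ?v) - ?v\<bar> \<le> 2 * ?v\<^sup>2" using elim by (intro abs_ln_one_plus_x_minus_x_bound) simp
    then have "real (j t) * \<bar>ln (1 + ?v) - ?v\<bar> \<le> real (j t) * (2 * ?v\<^sup>2)" by (rule mult_left_mono) simp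
    moreover have "real (j t) * \<bar>ln (1 + ?v) - ?v\<bar> = \<bar>real (j t) * ln (1 + ?v) - a * real (j t) ^ 2 / t\<bar>"
    proof -
      have "real (j t) * \<bar>ln (1 + ?v) - ?v\<bar> = \<bar>real (j t) * (ln (1 + ?v) - ?v)\<bar>" by (simp add: abs_mult)
      then show ?thesis by (simp add: right_diff_distrib power2_eq_square mult_ac)
    qed
    ultimately show ?case by (simp add: power_mult_distrib power_divide power2_eq_square power3_eq_cube mult_ac)
  qed
  have "((\<lambda>t. real (j t) * ln (1 + a * (real (j t) / t)) - a * real (j t) ^ 2 / t) \<longlongrightarrow> 0) at_top"
  proof (rule Lim_null_comparison[OF _ tendsto_mult_right_zero[OF j3, of "2 * a\<^sup>2"]])
    show "eventually (\<lambda>t. norm (real (j t) * ln (1 + a * (real (j t) / t)) - a * real (j t) ^ 2 / t)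
      \<le> 2 * a\<^sup>2 * (real (j t) ^ 3 / t\<^sup>2)) at_top" using ev by simp
  qed
  from tendsto_exp[OF this]
  have "((\<lambda>t. exp (real (j t) * ln (1 + a * (real (j t) / t)) - a * real (j t) ^ 2 / t)) \<longlongrightarrow> 1) at_top" by simp
  moreover have "eventually (\<lambda>t. exp (real (j t) * ln (1 + a * (real (j t) / t)) - a * real (j t) ^ 2 / t)
     = (1 + real (j t) * a / t) ^ j t / exp (a * real (j t) ^ 2 / t)) at_top"
    using \<open>eventually (\<lambda>t. \<bar>a * (real (j t) / t)\<bar> < 1 / 2) at_top\<close>
  proof eventually_elim
    case (elim t)
    then have "0 < 1 + a * (real (j t) / t)" by linarith
    then show ?case by (simp add: exp_diff exp_of_nat_mult mult_ac)
  qed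
  ultimately show ?thesis by (rule Lim_transform_eventually)
qed

section \<open>Asymptotics of the convolution powers\<close>

context renewal_deviation
begin

lemma LS_power_main_term_bound:
  fixes n :: nat and t :: real
  defines "\<tau> \<equiv> t + real n * offset"
  defines "x \<equiv> remainder_norm * mean\<^sup>2 * real n ^ 3 / \<tau>\<^sup>2 * exp (2 * (lead - offset) * real n / \<tau>)"
    and "y \<equiv> 2 * max 1 (max (mass + \<bar>gamma\<bar>) remainder_norm) * mean * real n / \<tau>"
  assumes \<tau>: "0 < \<tau>"
  shows "\<bar>LS_power V n t - main_term n t\<bar> \<le> main_term n t * (exp x - 1 + y ^ n)"
proof -
  have e: "0 \<le> lead - offset" by (simp add: lead_def)
  have "0 \<le> mass + \<bar>gamma\<bar>" by (simp add: mass_def)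
  note err = expansion_error[OF mean_pos \<tau> e remainder_norm_nonneg this, of n]
  have "main_term (n - 2 * k) (t + 2 * real k * lead)
     = (\<tau> + 2 * real k * (lead - offset)) ^ (n - 2 * k) / (mean ^ (n - 2 * k) * fact (n - 2 * k))"
    if "2 * k \<le> n" for k
  proof -
    have "t + 2 * real k * lead + real (n - 2 * k) * offset = \<tau> + 2 * real k * (lead - offset)"
      using that by (simp add: \<tau>_def of_nat_diff algebra_simps)
    moreover have "0 \<le> \<tau> + 2 * real k * (lead - offset)" using \<tau> e by (intro add_nonneg_nonneg) auto
    ultimately show ?thesis by (simp add: main_term_def)
  qed
  then have "(\<Sum>k=1..n. real (n choose k) *
     (if 2 * k \<le> n then remainder_norm ^ k * main_term (n - 2 * k) (t + 2 * real k * lead)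
      else (mass + \<bar>gamma\<bar>) ^ (2 * k - n) * remainder_norm ^ (n - k)))
    = (\<Sum>k=1..n. real (n choose k) *
     (if 2 * k \<le> n then remainder_norm ^ k * ((\<tau> + 2 * real k * (lead - offset)) ^ (n - 2 * k) / (mean ^ (n - 2 * k) * fact (n - 2 * k)))
      else (mass + \<bar>gamma\<bar>) ^ (2 * k - n) * remainder_norm ^ (n - k)))"
    by (intro sum.cong refl) auto
  moreover have "main_term n t = \<tau> ^ n / (mean ^ n * fact n)" using \<tau> by (simp add: main_term_def \<tau>_def)
  ultimately show ?thesis
    using LS_power_deviation[of n t] err by (simp only: x_def y_def)
qed

text \<open>Both error terms vanish: \<open>x\<close> is at most of order \<open>j^3 / t^2\<close> and \<open>y\<close> of order \<open>j / t\<close>. As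
  \<open>j\<close> may stay bounded, \<open>j \<ge> 1\<close> is used to bound \<open>y^j\<close> by \<open>y\<close>.\<close>
lemma LS_power_asymptotics:
  fixes j :: "real \<Rightarrow> nat"
  assumes j_pos: "\<forall>t\<ge>0. 1 \<le> j t" and j_small: "(\<lambda>t. real (j t)) \<in> o[at_top](\<lambda>t. t powr (2 / 3))"
  shows "(\<lambda>t. LS_power V (j t) t) \<sim>[at_top]
     (\<lambda>t. t ^ j t / (mean ^ j t * fact (j t)) * exp (gamma * mean * real (j t) ^ 2 / t))"
proof (rule asymp_equivI')
  note j3 = small_order_ratios(1)[OF j_small] and j1 = small_order_ratios(2)[OF j_small]
  define \<tau> where "\<tau> t = t + real (j t) * offset" for t
  define q where "q t = 1 + real (j t) / t * offset" for t
  define x where "x t = remainder_norm * mean\<^sup>2 * real (j t) ^ 3 / (\<tau> t)\<^sup>2 * exp (2 * (lead - offset) * real (j t) / \<tau> t)" for t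
  define y where "y t = 2 * max 1 (max (mass + \<bar>gamma\<bar>) remainder_norm) * mean * real (j t) / \<tau> t" for t
  have q: "(q \<longlongrightarrow> 1) at_top"
  proof -
    have "(q \<longlongrightarrow> 1 + 0 * offset) at_top" unfolding q_def by (intro tendsto_intros j1)
    then show ?thesis by simp
  qed
  have \<tau>_q: "\<tau> t = t * q t" if "0 < t" for t using that by (simp add: \<tau>_def q_def distrib_left)
  have q_pos: "eventually (\<lambda>t. 0 < q t) at_top" using q by (rule order_tendstoD) simp
  have x0: "(x \<longlongrightarrow> 0) at_top"
  proof -
    have "((\<lambda>t. remainder_norm * mean\<^sup>2 * ((real (j t) ^ 3 / t\<^sup>2) / (q t)\<^sup>2) * exp (2 * (lead - offset) * (real (j t) / t / q t)))
       \<longlongrightarrow> remainder_norm * mean\<^sup>2 * (0 / 1\<^sup>2) * exp (2 * (lead - offset) * (0 / 1))) at_top"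
      by (intro tendsto_intros j3 j1 q) auto
    then have "((\<lambda>t. remainder_norm * mean\<^sup>2 * ((real (j t) ^ 3 / t\<^sup>2) / (q t)\<^sup>2) * exp (2 * (lead - offset) * (real (j t) / t / q t)))
       \<longlongrightarrow> 0) at_top" by simp
    moreover have "eventually (\<lambda>t. remainder_norm * mean\<^sup>2 * ((real (j t) ^ 3 / t\<^sup>2) / (q t)\<^sup>2) * exp (2 * (lead - offset) * (real (j t) / t / q t)) = x t) at_top"
      using eventually_gt_at_top[of 0] by eventually_elim (simp add: x_def \<tau>_q power_mult_distrib)
    ultimately show ?thesis by (rule Lim_transform_eventually)
  qed
  have y0: "(y \<longlongrightarrow> 0) at_top"
  proof -
    have "((\<lambda>t. 2 * max 1 (max (mass + \<bar>gamma\<bar>) remainder_norm) * mean * (real (j t) / t / q t))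
      \<longlongrightarrow> 2 * max 1 (max (mass + \<bar>gamma\<bar>) remainder_norm) * mean * (0 / 1)) at_top"
      by (intro tendsto_intros j1 q) auto
    then have "((\<lambda>t. 2 * max 1 (max (mass + \<bar>gamma\<bar>) remainder_norm) * mean * (real (j t) / t / q t)) \<longlongrightarrow> 0) at_top"
      by simp
    moreover have "eventually (\<lambda>t. 2 * max 1 (max (mass + \<bar>gamma\<bar>) remainder_norm) * mean * (real (j t) / t / q t) = y t) at_top"
      using eventually_gt_at_top[of 0] by eventually_elim (simp add: y_def \<tau>_q)
    ultimately show ?thesis by (rule Lim_transform_eventually)
  qed
  have good: "eventually (\<lambda>t. 0 < t \<and> 0 < \<tau> t) at_top"
    using eventually_gt_at_top[of 0] q_pos by eventually_elim (simp add: \<tau>_q)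
  have main: "((\<lambda>t. LS_power V (j t) t / main_term (j t) t) \<longlongrightarrow> 1) at_top"
  proof -
    have "((\<lambda>t. exp (x t) - 1 + y t) \<longlongrightarrow> exp 0 - 1 + 0) at_top" by (intro tendsto_intros x0 y0)
    then have lim: "((\<lambda>t. exp (x t) - 1 + y t) \<longlongrightarrow> 0) at_top" by simp
    have "eventually (\<lambda>t. y t < 1) at_top" using y0 by (rule order_tendstoD) simp
    then have "eventually (\<lambda>t. norm (LS_power V (j t) t / main_term (j t) t - 1) \<le> exp (x t) - 1 + y t) at_top"
      using good
    proof eventually_elim
      case (elim t)
      have mt: "0 < main_term (j t) t" using elim mean_pos by (simp add: main_term_def \<tau>_def)
      have "0 \<le> y t" unfolding y_def using elim mean_pos by simp
      moreover have "1 \<le> j t" using j_pos elim by simp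
      ultimately have "y t ^ j t \<le> y t ^ 1" using elim by (intro power_decreasing) auto
      then have 1: "main_term (j t) t * (exp (x t) - 1 + y t ^ j t) \<le> main_term (j t) t * (exp (x t) - 1 + y t)"
        using mt by (intro mult_left_mono) auto
      have 2: "\<bar>LS_power V (j t) t - main_term (j t) t\<bar> \<le> main_term (j t) t * (exp (x t) - 1 + y t ^ j t)"
        using LS_power_main_term_bound[of t "j t"] elim by (simp add: x_def y_def \<tau>_def)
      have "\<bar>LS_power V (j t) t - main_term (j t) t\<bar> / main_term (j t) t \<le> exp (x t) - 1 + y t"
        using order_trans[OF 2 1] mt by (subst pos_divide_le_eq) (auto simp: mult.commute)
      moreover have "LS_power V (j t) t / main_term (j t) t - 1 = (LS_power V (j t) t - main_term (j t) t) / main_term (j t) t"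
        using mt by (simp add: diff_divide_distrib)
      ultimately show ?case using mt by (simp add: abs_divide)
    qed
    from Lim_null_comparison[OF this lim]
    have "((\<lambda>t. (LS_power V (j t) t / main_term (j t) t - 1) + 1) \<longlongrightarrow> 0 + 1) at_top"
      by (intro tendsto_intros)
    then show ?thesis by simp
  qed
  have "((\<lambda>t. LS_power V (j t) t / main_term (j t) t * ((1 + real (j t) * offset / t) ^ j t / exp (offset * real (j t) ^ 2 / t)))
     \<longlongrightarrow> 1 * 1) at_top"
    by (intro tendsto_mult main shifted_power_asymptotics j3 j1)
  then have "((\<lambda>t. LS_power V (j t) t / main_term (j t) t * ((1 + real (j t) * offset / t) ^ j t / exp (offset * real (j t) ^ 2 / t)))
     \<longlongrightarrow> 1) at_top" by simp
  moreover have "eventually (\<lambda>t. LS_power V (j t) t / main_term (j t) t * ((1 + real (j t) * offset / t) ^ j t / exp (offset * real (j t) ^ 2 / t))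
    = LS_power V (j t) t / (t ^ j t / (mean ^ j t * fact (j t)) * exp (gamma * mean * real (j t) ^ 2 / t))) at_top"
    using good
  proof eventually_elim
    case (elim t)
    have "1 + real (j t) * offset / t = \<tau> t / t" using elim by (simp add: \<tau>_def field_simps)
    moreover have "main_term (j t) t = \<tau> t ^ j t / (mean ^ j t * fact (j t))"
      using elim by (simp add: main_term_def \<tau>_def)
    moreover have "gamma * mean = offset" by (simp add: offset_def)
    ultimately show ?case using elim mean_pos by (simp add: power_divide)
  qed
  ultimately show "((\<lambda>t. LS_power V (j t) t / (t ^ j t / (mean ^ j t * fact (j t)) * exp (gamma * mean * real (j t) ^ 2 / t))) \<longlongrightarrow> 1) at_top"
    by (rule Lim_transform_eventually)
qed

end

theorem theorem2p5:
  fixes M :: "'a measure" and P :: "'b measure"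
    and X Y :: "nat \<Rightarrow> 'a \<Rightarrow> real" and \<xi> \<eta> :: "'b \<Rightarrow> real"
    and V :: "real \<Rightarrow> real" and m :: real
  assumes "prob_space M" and "prob_space P"
    and "\<xi> \<in> borel_measurable P" and "\<eta> \<in> borel_measurable P"
    and "AE \<omega> in P. 0 < \<xi> \<omega> \<and> 0 < \<eta> \<omega>"
    and "iid_copies M X Y P \<xi> \<eta>"
    and "spread_out (distr P borel \<xi>)"
    and "integrable P (\<lambda>\<omega>. \<xi> \<omega> ^ 3)"
    and "integrable P (\<lambda>\<omega>. \<eta> \<omega> ^ 2)"
    and "m = (LINT \<omega>|P. \<xi> \<omega>)"
    and "V = mean_counting M X Y"
  shows "\<exists>\<gamma>\<^sub>0. has_LS_total_mass (\<lambda>y. V y - y / m) \<gamma>\<^sub>0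
    \<and> ((\<lambda>t. V t - t / m) \<longlongrightarrow> \<gamma>\<^sub>0) at_top
    \<and> \<gamma>\<^sub>0 = (LINT \<omega>|P. \<xi> \<omega> ^ 2) / (2 * m ^ 2) - (LINT \<omega>|P. \<eta> \<omega>) / m
    \<and> (\<forall>j :: real \<Rightarrow> nat.
          (\<forall>t\<ge>0. 1 \<le> j t) \<and> (\<lambda>t. real (j t)) \<in> o[at_top](\<lambda>t. t powr (2 / 3)) \<longrightarrow>
          (\<lambda>t. LS_power V (j t) t) \<sim>[at_top]
          (\<lambda>t. t ^ j t / (m ^ j t * fact (j t)) * exp (\<gamma>\<^sub>0 * m * real (j t) ^ 2 / t)))"
proof -
  note [measurable] = assms(3,4)
  define \<mu> where "\<mu> = distr P borel \<xi>"
  define \<nu> where "\<nu> = distr P borel \<eta>"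
  interpret M: prob_space M by fact
  interpret P: prob_space P by fact
  interpret \<mu>: real_distribution \<mu> unfolding \<mu>_def by (rule P.real_distribution_distr) fact
  have \<xi>_pos: "AE \<omega> in P. 0 < \<xi> \<omega>" using assms(5) by (rule eventually_mono) simp
  have cube: "integrable \<mu> (\<lambda>s. s ^ 3)" unfolding \<mu>_def using assms(8) by (simp add: integrable_distr_eq)
  have \<mu>_pos: "AE s in \<mu>. 0 < s" unfolding \<mu>_def by (subst AE_distr_iff) (use \<xi>_pos in auto)
  have square: "integrable \<mu> (\<lambda>s. s ^ 2)"
  proof (rule Bochner_Integration.integrable_bound)
    show "integrable \<mu> (\<lambda>s. 1 + s ^ 3)" using cube by simp
    show "AE s in \<mu>. norm (s ^ 2) \<le> norm (1 + s ^ 3)"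
    proof (rule eventually_mono[OF \<mu>_pos])
      fix s :: real assume s: "0 < s"
      have "s ^ 2 \<le> 1 + s ^ 3"
      proof (cases "s \<le> 1")
        case True
        then have "s ^ 2 \<le> 1" using s by (simp add: power_le_one)
        then show ?thesis using s by (simp add: add_increasing2)
      next
        case False
        then have "s ^ 2 \<le> s ^ 3" by (intro power_increasing) auto
        then show ?thesis by simp
      qed
      then show "norm (s ^ 2) \<le> norm (1 + s ^ 3)" using s by simp
    qed
  qed simp
  have indep: "M.indep_vars (\<lambda>_. borel) (\<lambda>i \<omega>. (X i \<omega>, Y i \<omega>)) {1..}"
    and law: "\<And>i. 1 \<le> i \<Longrightarrow> distr M borel (\<lambda>\<omega>. (X i \<omega>, Y i \<omega>)) = distr P borel (\<lambda>\<omega>. (\<xi> \<omega>, \<eta> \<omega>))"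
    using assms(6) by (auto simp: iid_copies_def)
  have proj: "fst \<in> (borel :: (real \<times> real) measure) \<rightarrow>\<^sub>M (borel :: real measure)"
    "snd \<in> (borel :: (real \<times> real) measure) \<rightarrow>\<^sub>M (borel :: real measure)"
    using measurable_fst[of "borel :: real measure" "borel :: real measure"]
      measurable_snd[of "borel :: real measure" "borel :: real measure"] by (simp_all add: borel_prod)
  have pair: "(\<lambda>\<omega>. (X i \<omega>, Y i \<omega>)) \<in> M \<rightarrow>\<^sub>M borel" if "1 \<le> i" for i
    using indep that by (auto simp: M.indep_vars_def)
  have pairP: "(\<lambda>\<omega>. (\<xi> \<omega>, \<eta> \<omega>)) \<in> P \<rightarrow>\<^sub>M borel" by measurable
  have X_law: "distr M borel (X i) = \<mu>" and Y_law: "distr M borel (Y i) = \<nu>" if i: "1 \<le> i" for i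
  proof -
    have "distr M borel (X i) = distr (distr M borel (\<lambda>\<omega>. (X i \<omega>, Y i \<omega>))) borel fst"
      by (subst distr_distr[OF proj(1) pair[OF i]]) (simp add: o_def)
    also have "\<dots> = \<mu>" unfolding law[OF i] \<mu>_def by (subst distr_distr[OF proj(1) pairP]) (simp add: o_def)
    finally show "distr M borel (X i) = \<mu>" .
    have "distr M borel (Y i) = distr (distr M borel (\<lambda>\<omega>. (X i \<omega>, Y i \<omega>))) borel snd"
      by (subst distr_distr[OF proj(2) pair[OF i]]) (simp add: o_def)
    also have "\<dots> = \<nu>" unfolding law[OF i] \<nu>_def by (subst distr_distr[OF proj(2) pairP]) (simp add: o_def)
    finally show "distr M borel (Y i) = \<nu>" .
  qed
  interpret R: renewal_setting \<mu> M X Y \<nu>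
  proof
    show "AE s in \<mu>. 0 < s" by (rule \<mu>_pos)
    show "integrable \<mu> (\<lambda>s. s\<^sup>2)" by (rule square)
    show "spread_out \<mu>" unfolding \<mu>_def by fact
    show "AE y in \<nu>. 0 < y" unfolding \<nu>_def
      by (subst AE_distr_iff) (use assms(5) in \<open>auto elim: eventually_mono\<close>)
    show "integrable \<nu> (\<lambda>y. y\<^sup>2)" unfolding \<nu>_def using assms(9) by (simp add: integrable_distr_eq)
  qed (fact indep X_law Y_law cube)+
  obtain PP N where PN: "finite_borel_measure PP" "finite_borel_measure N"
    "AE x in PP. 0 \<le> x" "AE x in N. 0 \<le> x" "integrable PP (\<lambda>x. x)" "integrable N (\<lambda>x. x)"
    "\<And>C f. exp_dominated C f \<Longrightarrow>
      (LINT x|R.intensity. f x) - (LINT y|lborel. indicator {0..} y * f y) / R.mean = (LINT x|PP. f x) - (LINT x|N. f x)"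
    by (rule R.signed_deviation) (rule that)
  interpret D: renewal_deviation \<mu> M X Y \<nu> PP N
    by (intro renewal_deviation.intro renewal_deviation_axioms.intro R.renewal_setting_axioms PN)
  have V: "V = R.V" using assms(11) R.V_eq_mean_counting by simp
  have m: "m = R.mean" unfolding R.mean_def by (simp add: \<mu>_def integral_distr assms(10))
  have s: "R.second_moment = (LINT \<omega>|P. \<xi> \<omega> ^ 2)" unfolding R.second_moment_def by (simp add: \<mu>_def integral_distr)
  have e: "(LINT y|\<nu>. y) = (LINT \<omega>|P. \<eta> \<omega>)" unfolding \<nu>_def by (simp add: integral_distr)
  show ?thesis
    unfolding V m
    using D.has_LS_total_mass_V D.tendsto_V D.gamma_eq D.LS_power_asymptotics
    by (intro exI[of _ D.gamma]) (simp add: s e)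
qed

end
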